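(* Let $R$ be a polynomial of degree $N\ge 2$ with $R(0)=0$, $c=R'(0)>1$, and Julia set $\mathcal J_R\subset[0,\infty)$. Let $d_R=\frac{2\log N}{\log c}$, let $z_0\in I_0$, and let $\zeta_{R,z_0}(s)$, $\operatorname{Re}(s)>d_R$, be the zeta function of the polynomial $R$ (see the context for $I_0$, $\zeta_{R,z_0}$, $\mathcal J_+$, $\mathcal R$, $\kappa$). Then $\zeta_{R,z_0}$ has a meromorphic continuation of the form $$\zeta_{R,z_0}(s)=\frac{\xi_R(s)}{1-Nc^{-s/2}}+\psi_{R,z_0}(s),$$ where $$\xi_R(s)=\int_{\mathcal J_+}(\mathcal R(z))^{-s/2}\,d\kappa(z)$$ is analytic in $\mathbb C$ and $\psi_{R,z_0}(s)$ is analytic for $\operatorname{Re}(s)>0$. The set of poles of $\zeta_{R,z_0}$ is contained in $$\Big\{d_R+\tfrac{4 i n\pi}{\log c}: n\in\mathbb Z\Big\},$$ and there always is a pole at $d_R$. If $\mathcal J_R$ is totally disconnected, then there exists $\varepsilon>0$ such that $\psi_{R,z_0}(s)$ is analytic for $\operatorname{Re}(s)>-\varepsilon$. If, in addition, $r=\max_{z\in\mathcal J_R}|R'(z)|^{-1}<1$, then one can take $\varepsilon=-\frac{2\log r}{\log c}$.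
   Context: Under the assumptions on $R$, its coefficients are real. Let $I$ be the convex hull of $\mathcal J_R$, a compact interval with left endpoint $0$. There is a unique decomposition $I=\bigcup_{j=1}^N I_j$ into $N$ closed intervals with disjoint interiors, numbered consecutively starting from the origin, such that $R$ is monotone on each $I_j$. Put $I_0=\bigcap_{j=1}^N R(I_j)$; one has $R^{-1}(I_0)\subseteq I\subseteq I_0\subset[0,\infty)$. Let $R_j^{-1}$ be the inverse of $R|_{I_j}$ and let $R_1^{-n}$ be the $n$-th composition power of $R_1^{-1}$ (the branch through the origin). The zeta function of $R$ is, for $z_0\in I_0$ and $\operatorname{Re}(s)>d_R$, $$\zeta_{R,z_0}(s)=\lim_{n\to\infty}\sum_{z\in R^{-n}\{z_0\}\setminus\{0\}}(c^n z)^{-s/2},$$ where $R^{-n}\{z_0\}$ denotes the $N^n$ preimages of $z_0$ under the $n$-th iterate of $R$, counted with multiplicity; the limit exists and is analytic for $\operatorname{Re}(s)>d_R$. $\mathcal J_+=\bigcup_{k=2}^N R_k^{-1}(\mathcal J_R)$. The function $\mathcal R(z)=\lim_{n\to\infty}c^nR_1^{-n}(z)$ exists for $z\in I_0$ and is increasing and continuous there. $\kappa$ is the unique balanced invariant probability measure on $\mathcal J_R$, characterized by $\kappa(R^{-1}_{j_1}\cdots R^{-1}_{j_m}(I))=N^{-m}$ for every finite sequence $j_1,\dots,j_m\in\{1,\dots,N\}$. "Totally disconnected" has its usual topological meaning (here $\mathcal J_R$ is either an interval or a Cantor set). If $R'$ vanishes somewhere on $\mathcal J_R$, $r$ is understood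 as $+\infty$. *)

theory Defs
  imports
    "HOL-Complex_Analysis.Complex_Analysis"
    "HOL-Probability.Probability"
    "HOL-Computational_Algebra.Computational_Algebra"
begin

text \<open>
  Normality in the sense of Montel, for maps into the Riemann sphere: locally uniform limits are
  either finite functions or the constant infinity.  No mixed limits are considered, which is
  the right notion on connected open sets; this is why the Fatou set below asks for a connected
  neighbourhood.
\<close>

definition normal_family_on :: "complex set \<Rightarrow> (complex \<Rightarrow> complex) set \<Rightarrow> bool" where
  "normal_family_on U F \<longleftrightarrow>
     (\<forall>f :: nat \<Rightarrow> complex \<Rightarrow> complex. range f \<subseteq> F \<longrightarrow>
        (\<exists>r :: nat \<Rightarrow> nat. strict_mono r \<and>
           ((\<exists>g. \<forall>K. compact K \<and> K \<subseteq> U \<longrightarrow> uniform_limit K (\<lambda>n. f (r n)) g sequentially) \<or>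
            (\<forall>K B. compact K \<and> K \<subseteq> U \<longrightarrow> (\<forall>\<^sub>F n in sequentially. \<forall>z\<in>K. B < norm (f (r n) z))))))"

definition fatou_set :: "complex poly \<Rightarrow> complex set" where
  "fatou_set R =
     {z. \<exists>U. open U \<and> connected U \<and> z \<in> U \<and> normal_family_on U (range (\<lambda>n. poly R ^^ n))}"

definition julia_set :: "complex poly \<Rightarrow> complex set" where
  "julia_set R = - fatou_set R"

definition totally_disconnected :: "'a::topological_space set \<Rightarrow> bool" where
  "totally_disconnected S \<longleftrightarrow> (\<forall>x\<in>S. connected_component_set S x = {x})"


text \<open>
  The Julia set is used for \<open>R\<close> with \<open>julia_set R \<subseteq> \<real>\<^sub>\<ge>\<^sub>0\<close>; the coefficients of \<open>R\<close> are then
  real.  Hence passing to the real trace of the Julia set and of the map \<open>R\<close> loses nothing.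
\<close>

definition rjulia :: "complex poly \<Rightarrow> real set" where
  "rjulia R = {x. complex_of_real x \<in> julia_set R}"

definition rmap :: "complex poly \<Rightarrow> real \<Rightarrow> real" where
  "rmap R x = Re (poly R (complex_of_real x))"

definition multiplier :: "complex poly \<Rightarrow> real" where
  "multiplier R = Re (poly (pderiv R) 0)"

definition hull_interval :: "complex poly \<Rightarrow> real set" where
  "hull_interval R = convex hull (rjulia R)"

text \<open>
  The decomposition of the interval \<open>I\<close> into consecutive intervals \<open>I\<^sub>1, \<dots>, I\<^sub>N\<close> of monotonicity
  is encoded by the increasing list of its \<open>N + 1\<close> break points.
\<close>

definition is_monotone_decomposition :: "complex poly \<Rightarrow> real list \<Rightarrow> bool" where
  "is_monotone_decomposition R xs \<longleftrightarrow>
     length xs = Suc (degree R) \<and> sorted_wrt (<) xs \<and>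
     (\<Union>j<degree R. {xs ! j .. xs ! Suc j}) = hull_interval R \<and>
     (\<forall>j<degree R. mono_on {xs ! j .. xs ! Suc j} (rmap R) \<or>
                    antimono_on {xs ! j .. xs ! Suc j} (rmap R))"

definition break_points :: "complex poly \<Rightarrow> real list" where
  "break_points R = (THE xs. is_monotone_decomposition R xs)"

text \<open>The index \<open>j\<close> of \<open>I\<^sub>j\<close> and of the inverse branches ranges over \<open>{1..degree R}\<close>.\<close>

definition piece :: "complex poly \<Rightarrow> nat \<Rightarrow> real set" where
  "piece R j = {break_points R ! (j - 1) .. break_points R ! j}"

definition I0 :: "complex poly \<Rightarrow> real set" where
  "I0 R = (\<Inter>j\<in>{1..degree R}. rmap R ` piece R j)"

definition inv_branch :: "complex poly \<Rightarrow> nat \<Rightarrow> real \<Rightarrow> real" where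
  "inv_branch R j = inv_into (piece R j) (rmap R)"

definition julia_plus :: "complex poly \<Rightarrow> real set" where
  "julia_plus R = (\<Union>k\<in>{2..degree R}. inv_branch R k ` rjulia R)"

definition koenigs :: "complex poly \<Rightarrow> real \<Rightarrow> real" where
  "koenigs R z = lim (\<lambda>n. multiplier R ^ n * (inv_branch R 1 ^^ n) z)"


text \<open>\<open>cylinder R [j\<^sub>1, \<dots>, j\<^sub>m]\<close> is the image of \<open>I\<close> under \<open>R\<^sub>j\<^sub>1\<^sup>-\<^sup>1 \<circ> \<dots> \<circ> R\<^sub>j\<^sub>m\<^sup>-\<^sup>1\<close>.\<close>

definition cylinder :: "complex poly \<Rightarrow> nat list \<Rightarrow> real set" where
  "cylinder R js = foldr (\<lambda>j A. inv_branch R j ` A) js (hull_interval R)"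

definition is_balanced_measure :: "complex poly \<Rightarrow> real measure \<Rightarrow> bool" where
  "is_balanced_measure R \<kappa> \<longleftrightarrow>
     prob_space \<kappa> \<and> sets \<kappa> = sets borel \<and> measure \<kappa> (rjulia R) = 1 \<and>
     (\<forall>js. set js \<subseteq> {1..degree R} \<longrightarrow>
        measure \<kappa> (cylinder R js) = 1 / real (degree R) ^ length js)"

text \<open>
  For the polynomials considered here exactly one such measure exists, so the choice operator
  involves no arbitrariness.
\<close>

definition balanced_measure :: "complex poly \<Rightarrow> real measure" where
  "balanced_measure R = (SOME \<kappa>. is_balanced_measure R \<kappa>)"


definition iter_poly :: "complex poly \<Rightarrow> nat \<Rightarrow> complex poly" where
  "iter_poly R n = (pcompose R ^^ n) [:0, 1:]"

text \<open>
  \<open>proots\<close> is the multiset of roots with multiplicity.  The complex power is the principal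
  one; all the preimages occurring here are real and non-negative.
\<close>

definition zeta_partial :: "complex poly \<Rightarrow> real \<Rightarrow> nat \<Rightarrow> complex \<Rightarrow> complex" where
  "zeta_partial R z0 n s =
     (\<Sum>z\<in>#filter_mset (\<lambda>z. z \<noteq> 0) (proots (iter_poly R n - [:complex_of_real z0:])).
        (complex_of_real (multiplier R ^ n) * z) powr (- s / 2))"

definition zeta_fun :: "complex poly \<Rightarrow> real \<Rightarrow> complex \<Rightarrow> complex" where
  "zeta_fun R z0 s = lim (\<lambda>n. zeta_partial R z0 n s)"

definition xi_fun :: "complex poly \<Rightarrow> complex \<Rightarrow> complex" where
  "xi_fun R s =
     (LINT z:julia_plus R|balanced_measure R. complex_of_real (koenigs R z) powr (- s / 2))"

text \<open>In \<open>ereal\<close> one has \<open>inverse 0 = \<infinity>\<close>, so the value is \<open>\<infinity>\<close> if \<open>R'\<close> vanishes somewhere on the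
  (compact) Julia set; otherwise the supremum is a maximum.\<close>

definition contraction_ratio :: "complex poly \<Rightarrow> ereal" where
  "contraction_ratio R = (SUP z\<in>julia_set R. inverse (ereal (norm (poly (pderiv R) z))))"

end

theory Submission
  imports Defs "HOL-Real_Asymp.Real_Asymp"
begin

text \<open>
  All preimages of points of the Julia set are real, so \<open>R\<close> has real coefficients, Laguerre's
  inequality makes its critical points simple with critical values outside the interior of the hull, and
  \<open>R\<close> has \<open>N\<close> full real inverse branches \<open>\<phi> j\<close>. Writing a preimage
  of order \<open>n\<close> as a word in the branches and sorting the words by the number of leading letters 1,
  the zeta function becomes \<open>\<Sum>m. q\<^sup>m\<^sup>+\<^sup>1 a\<^sub>m\<close> plus an entire term,
  where \<open>q = N c\<^sup>-\<^sup>s\<^sup>/\<^sup>2\<close> and \<open>a\<^sub>m\<close> is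
  \<open>1/N\<close> times the average over the words of length \<open>m\<close> of \<open>\<Sum>j\<ge>2. (\<K>
  \<circ> \<phi> j)\<^sup>-\<^sup>s\<^sup>/\<^sup>2\<close>. These averages tend to \<open>xi_fun R s\<close>,
  and the speed of convergence, which is controlled by the dependence of \<open>a\<^sub>m\<close> on the base
  point, determines how far \<open>\<Sum>m. q\<^sup>m\<^sup>+\<^sup>1 (a\<^sub>m - xi_fun R s)\<close> extends.
  Monotonicity of \<open>\<K>\<close> and of the branches bounds the total variation over all words, which gives
  \<open>O(N\<^sup>-\<^sup>m)\<close> and the half plane \<open>Re s > 0\<close>. If the Julia set has a gap,
  then Lagrange interpolation of the polynomial vanishing at the midpoints of the gaps shows that the branches
  together contract the arcsine metric of the hull by a factor \<open>\<gamma> < 1\<close>, which gives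
  \<open>O((\<gamma>/N)\<^sup>m)\<close>. If \<open>R\<close> is expanding on the Julia set, then
  \<open>a\<^sub>m\<close> is a Cauchy integral over a fixed contour of word sums of the Cauchy kernel; these
  are logarithmic derivatives of the iterates of \<open>R\<close>, which escape to infinity on the contour, and
  the convergence is faster than any exponential.
\<close>

section \<open>Escape to infinity\<close>

text \<open>Two foundations are tacit in the overview. First, the Julia set is defined by normality,
  whereas the estimates need orbits: since the Julia set lies in a half-line, the Fatou set is
  connected and coincides with the basin of infinity, so Julia points are those with bounded orbit.
  Second, the ends need care. \<open>I0 R\<close> is [0, B] with B possibly beyond the right end
  \<beta> of the hull, so bounds proved on the hull reach z0 only after one more letter; and \<K>
  vanishes at 0, which is why the averages evaluate powers only at points whose first letter is not
  1, that is, in [b 1, \<beta>]. Each half-plane comes from one comparison. If the averages converge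
  like \<delta>^m, the series converges where \<delta> |q(s)| < 1, and |q(s)| = N c^(-Re s/2). The
  rate 1/N gives Re s > 0; the rate \<gamma>/N gives Re s > 2 ln \<gamma> / ln c, where a gap of
  half-length h yields \<gamma> = sqrt(1 - (h/\<beta>)^2). In the expanding case every exponential
  rate is available, and r/N is the one that produces the stated \<epsilon>.\<close>

lemma poly_superlinear_growth:
  fixes R :: "complex poly"
  assumes "degree R \<ge> 2" "poly R 0 = 0"
  obtains \<rho> where "\<rho> \<ge> 1" "\<And>z. \<rho> \<le> norm z \<Longrightarrow> M * norm z \<le> norm (poly R z)"
proof -
  \<comment> \<open>R(z) = z Q(z) with Q non-constant, so |Q| exceeds any M far out. The value M = 2
    yields an escape radius, large M the super-exponential escape used in the expanding
    case.\<close>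
  obtain a0 Q where R: "R = pCons a0 Q" by (cases R)
  obtain a Q' where Q: "Q = pCons a Q'" by (cases Q)
  have a0: "a0 = 0" using assms R by simp
  have "Q' \<noteq> 0" using assms(1) unfolding R Q by (auto split: if_splits)
  then obtain r where r: "\<And>z. r \<le> norm z \<Longrightarrow> M \<le> norm (poly Q z)"
    using poly_infinity[of Q' M a] unfolding Q by auto
  show ?thesis
  proof (rule that[of "max 1 r"])
    fix z :: complex assume "max 1 r \<le> norm z"
    hence "M \<le> norm (poly Q z)" using r by auto
    hence "M * norm z \<le> norm (poly Q z) * norm z" by (intro mult_right_mono) auto
    thus "M * norm z \<le> norm (poly R z)" by (simp add: R a0 norm_mult mult.commute)
  qed auto
qed

lemma continuous_on_funpow:
  assumes "continuous_on UNIV f"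
  shows "continuous_on A (f ^^ n :: 'a::topological_space \<Rightarrow> 'a)"
proof -
  have "continuous_on UNIV (f ^^ n)"
    by (induction n) (use assms in \<open>auto intro: continuous_on_compose2 simp: o_def id_def\<close>)
  thus ?thesis by (rule continuous_on_subset) auto
qed

lemma funpow_growth:
  fixes f :: "complex \<Rightarrow> complex"
  assumes g: "\<And>z. \<rho> \<le> norm z \<Longrightarrow> M * norm z \<le> norm (f z)" and "M \<ge> 1" "\<rho> \<ge> 1" "\<rho> \<le> norm z"
  shows "M ^ n * norm z \<le> norm ((f ^^ n) z) \<and> \<rho> \<le> norm ((f ^^ n) z)"
proof (induction n)
  case (Suc n)
  have "M * (M ^ n * norm z) \<le> M * norm ((f ^^ n) z)"
    using Suc assms by (intro mult_left_mono) auto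
  also have "\<dots> \<le> norm ((f ^^ Suc n) z)" using g Suc by simp
  finally have 1: "M * (M ^ n * norm z) \<le> norm ((f ^^ Suc n) z)" .
  have "\<rho> \<le> norm ((f ^^ n) z)" using Suc by simp
  also have "\<dots> \<le> M * norm ((f ^^ n) z)" using \<open>M \<ge> 1\<close> by (simp add: mult_le_cancel_right1)
  also have "\<dots> \<le> norm ((f ^^ Suc n) z)" using g Suc by simp
  finally show ?case using 1 by (simp add: mult_ac)
qed (use assms in auto)

lemma fatou_set_open: "open (fatou_set R)"
proof (subst open_subopen, rule ballI)
  fix z assume "z \<in> fatou_set R"
  then obtain U where "open U" "connected U" "z \<in> U" "normal_family_on U (range (\<lambda>n. poly R ^^ n))"
    unfolding fatou_set_def by blast
  thus "\<exists>T. open T \<and> z \<in> T \<and> T \<subseteq> fatou_set R"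
    unfolding fatou_set_def by (intro exI[of _ U]) blast
qed

text \<open>Separates the topological part from the arithmetic one: a radius of doubling, the fixed
  point 0 and the inclusion in a half-line identify the Julia set as the set of bounded
  orbits.\<close>

locale escape_radius =
  fixes R :: "complex poly" and \<rho> :: real
  assumes rho_ge_1: "\<rho> \<ge> 1" and growth: "\<And>z. \<rho> \<le> norm z \<Longrightarrow> 2 * norm z \<le> norm (poly R z)"
    and zero_fixed: "poly R 0 = 0" and julia_nonneg: "julia_set R \<subseteq> \<real>\<^sub>\<ge>\<^sub>0"
begin

definition escaping :: "complex set" where
  "escaping = {z. \<exists>n. \<rho> < norm ((poly R ^^ n) z)}"

lemma escaping_to_infinity:
  assumes "z \<in> escaping"
  shows "filterlim (\<lambda>n. norm ((poly R ^^ n) z)) at_top sequentially"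
proof -
  obtain k where k: "\<rho> < norm ((poly R ^^ k) z)" using assms by (auto simp: escaping_def)
  have "filterlim (\<lambda>n. norm ((poly R ^^ (n + k)) z)) at_top sequentially"
  proof (rule filterlim_at_top_mono)
    show "filterlim (\<lambda>n. (2::real) ^ n) at_top sequentially"
      by real_asymp
    show "\<forall>\<^sub>F n in sequentially. 2 ^ n \<le> norm ((poly R ^^ (n + k)) z)"
    proof (intro always_eventually allI)
      fix n
      have "2 ^ n * norm ((poly R ^^ k) z) \<le> norm ((poly R ^^ n) ((poly R ^^ k) z))"
        using funpow_growth[of \<rho> 2 "poly R" "(poly R ^^ k) z" n] growth rho_ge_1 k by simp
      moreover have "(2::real) ^ n \<le> 2 ^ n * norm ((poly R ^^ k) z)"
        using k rho_ge_1 by simp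
      ultimately show "2 ^ n \<le> norm ((poly R ^^ (n + k)) z)"
        unfolding funpow_add o_apply by linarith
    qed
  qed
  hence "\<forall>\<^sub>F n in sequentially. Z \<le> norm ((poly R ^^ (n + k)) z)" for Z
    by (auto simp: filterlim_at_top)
  thus ?thesis
    unfolding filterlim_at_top
    using eventually_sequentially_seg[of "\<lambda>n. _ \<le> norm ((poly R ^^ n) z)" k] by blast
qed

lemma escaping_subset_fatou: "escaping \<subseteq> fatou_set R"
proof
  fix z assume "z \<in> escaping"
  then obtain n where n: "\<rho> < norm ((poly R ^^ n) z)" by (auto simp: escaping_def)
  have "open {w. \<rho> < norm ((poly R ^^ n) w)}"
    by (intro open_Collect_less continuous_intros continuous_on_funpow)
  then obtain e where e: "e > 0" "ball z e \<subseteq> {w. \<rho> < norm ((poly R ^^ n) w)}"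
    using n by (metis open_contains_ball mem_Collect_eq)
  have "normal_family_on (ball z e) (range (\<lambda>n. poly R ^^ n))"
    unfolding normal_family_on_def
  proof (intro allI impI)
    fix f :: "nat \<Rightarrow> complex \<Rightarrow> complex"
    assume "range f \<subseteq> range (\<lambda>n. poly R ^^ n)"
    hence "\<forall>k. \<exists>m. f k = poly R ^^ m" by auto
    then obtain m where m: "\<And>k. f k = poly R ^^ (m k)" by metis
    show "\<exists>r. strict_mono (r :: nat \<Rightarrow> nat) \<and>
           ((\<exists>g. \<forall>K. compact K \<and> K \<subseteq> ball z e \<longrightarrow> uniform_limit K (\<lambda>n. f (r n)) g sequentially) \<or>
            (\<forall>K B. compact K \<and> K \<subseteq> ball z e \<longrightarrow>
               (\<forall>\<^sub>F n in sequentially. \<forall>z\<in>K. B < norm (f (r n) z))))"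
    \<comment> \<open>A sequence of iterates either uses some exponent infinitely often, which gives
      a constant subsequence, or its exponents tend to infinity, and then the whole sequence escapes
      uniformly on the ball.\<close>
    proof (cases "\<exists>b. infinite {k. m k < b}")
      case True
      then obtain b where b: "infinite {k. m k < b}" by blast
      have "m ` {k. m k < b} \<subseteq> {..<b}" by auto
      hence "finite (m ` {k. m k < b})" using finite_subset by blast
      from pigeonhole_infinite[OF b this] obtain k0 where
        "infinite {k \<in> {k. m k < b}. m k = m k0}" by blast
      hence inf: "infinite {k. m k = m k0}" by (rule infinite_super[rotated]) auto
      define r where "r = enumerate {k. m k = m k0}"
      have "strict_mono r" unfolding r_def using inf by (rule strict_mono_enumerate)
      moreover have "m (r n) = m k0" for n
        using enumerate_in_set[OF inf, of n] by (simp add: r_def)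
      ultimately show ?thesis
        by (intro exI[of _ r] conjI disjI1 exI[of _ "poly R ^^ m k0"])
           (auto simp: m intro!: uniform_limit_const)
    next
      case False
      hence fin: "\<And>b. finite {k. m k < b}" by blast
      have "\<forall>\<^sub>F k in sequentially. \<forall>w\<in>K. B < norm (f k w)" if "K \<subseteq> ball z e" for K B
      proof -
        obtain l where l: "B < 2 ^ l" using real_arch_pow[of 2 B] by auto
        have "\<forall>\<^sub>F k in sequentially. n + l \<le> m k"
          using fin[of "n + l"] unfolding cofinite_eq_sequentially[symmetric] eventually_cofinite
          by (simp add: not_le)
        thus ?thesis
        proof eventually_elim
          case (elim k)
          show ?case
          proof
            fix w assume "w \<in> K"
            hence w: "\<rho> < norm ((poly R ^^ n) w)" using that e by auto
            define j where "j = m k - n"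
            have j: "m k = j + n" "l \<le> j" using elim by (auto simp: j_def)
            have "2 ^ l \<le> (2::real) ^ j" using j by (intro power_increasing) auto
            also have "\<dots> = 2 ^ j * 1" by simp
            also have "\<dots> \<le> 2 ^ j * norm ((poly R ^^ n) w)"
              using w rho_ge_1 by (intro mult_left_mono) auto
            also have "\<dots> \<le> norm ((poly R ^^ j) ((poly R ^^ n) w))"
              using funpow_growth[of \<rho> 2 "poly R" "(poly R ^^ n) w" j] growth rho_ge_1 w by simp
            finally show "B < norm (f k w)" using l by (simp add: m j funpow_add)
          qed
        qed
      qed
      thus ?thesis
        by (intro exI[of _ id] conjI disjI2) (auto simp: strict_mono_def)
    qed
  qed
  thus "z \<in> fatou_set R"
    unfolding fatou_set_def using e(1) by (auto intro!: exI[of _ "ball z e"])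
qed

text \<open>The plane slit along the half-line is connected and dense, and it lies in the Fatou set
  because the Julia set lies on the slit. Every set between a connected set and its closure is
  connected.\<close>

lemma fatou_connected: "connected (fatou_set R)"
proof (rule connected_intermediate_closure)
  have eq: "(\<real>\<^sub>\<ge>\<^sub>0 :: complex set) = complex_of_real ` {0..}"
    by (auto simp: nonneg_Reals_def)
  show "connected (- (\<real>\<^sub>\<ge>\<^sub>0 :: complex set))"
    unfolding eq by (intro starlike_imp_connected starlike_slotted_complex_plane_right)
  show "- \<real>\<^sub>\<ge>\<^sub>0 \<subseteq> fatou_set R" using julia_nonneg by (auto simp: julia_set_def)
  have "w \<in> closure (- \<real>\<^sub>\<ge>\<^sub>0)" for w :: complex
    unfolding closure_approachable
  proof (intro allI impI)
    fix e :: real assume e: "e > 0"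
    define y where "y = (if Im w = 0 then w + \<i> * of_real (e / 2) else w)"
    have "Im y \<noteq> 0" using e by (auto simp: y_def)
    moreover have "dist y w < e" using e by (auto simp: y_def dist_norm norm_mult)
    ultimately show "\<exists>y\<in>- \<real>\<^sub>\<ge>\<^sub>0. dist y w < e"
      by (intro bexI[of _ y]) (auto simp: complex_nonneg_Reals_iff)
  qed
  thus "fatou_set R \<subseteq> closure (- \<real>\<^sub>\<ge>\<^sub>0)" by blast
qed

lemma escaping_open: "open escaping"
proof -
  have "open {w. \<rho> < norm ((poly R ^^ n) w)}" for n
    by (intro open_Collect_less continuous_intros continuous_on_funpow)
  hence "open (\<Union>n. {w. \<rho> < norm ((poly R ^^ n) w)})" by (intro open_UN) auto
  thus ?thesis unfolding escaping_def by (simp add: Collect_ex_eq)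
qed

text \<open>A normal neighbourhood of z meets the basin in some y. The iterates are unbounded at y,
  so the subsequence given by normality cannot have a finite limit; since
  \<open>normal_family_on\<close> admits no mixed limits, it tends to infinity at z as well.\<close>

lemma escapes_near:
  assumes "z \<in> fatou_set R" "z \<in> closure escaping"
  shows "z \<in> escaping"
proof -
  obtain U where U: "open U" "z \<in> U" "normal_family_on U (range (\<lambda>n. poly R ^^ n))"
    using assms unfolding fatou_set_def by blast
  obtain y where y: "y \<in> U" "y \<in> escaping"
    using assms(2) U(1,2) open_Int_closure_eq_empty[of U escaping] by blast
  obtain r :: "nat \<Rightarrow> nat" where r: "strict_mono r"
     "(\<exists>g. \<forall>K. compact K \<and> K \<subseteq> U \<longrightarrow> uniform_limit K (\<lambda>n. poly R ^^ r n) g sequentially) \<or>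
            (\<forall>K B. compact K \<and> K \<subseteq> U \<longrightarrow> (\<forall>\<^sub>F n in sequentially. \<forall>z\<in>K. B < norm ((poly R ^^ r n) z)))"
    using U(3)[unfolded normal_family_on_def, rule_format, of "\<lambda>n. poly R ^^ n"] by auto
  from r(2) show ?thesis
  proof
    assume "\<exists>g. \<forall>K. compact K \<and> K \<subseteq> U \<longrightarrow> uniform_limit K (\<lambda>n. poly R ^^ r n) g sequentially"
    then obtain g where "uniform_limit {y} (\<lambda>n. poly R ^^ r n) g sequentially"
      using y by (metis compact_sing empty_subsetI insert_subset)
    hence "(\<lambda>n. (poly R ^^ r n) y) \<longlonglongrightarrow> g y" by (rule tendsto_uniform_limitI) auto
    hence "(\<lambda>n. norm ((poly R ^^ r n) y)) \<longlonglongrightarrow> norm (g y)" by (intro tendsto_norm)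
    moreover have "filterlim (\<lambda>n. norm ((poly R ^^ r n) y)) at_top sequentially"
      using filterlim_compose[OF escaping_to_infinity[OF y(2)] filterlim_subseq[OF r(1)]] .
    ultimately have False
      using not_tendsto_and_filterlim_at_infinity[OF sequentially_bot]
        filterlim_at_top_imp_at_infinity by blast
    thus ?thesis ..
  next
    assume *: "\<forall>K B. compact K \<and> K \<subseteq> U \<longrightarrow> (\<forall>\<^sub>F n in sequentially. \<forall>z\<in>K. B < norm ((poly R ^^ r n) z))"
    have "\<forall>\<^sub>F n in sequentially. \<forall>w\<in>{z}. \<rho> < norm ((poly R ^^ r n) w)"
      using *[rule_format, of "{z}" \<rho>] U(2) by simp
    then obtain n where "\<rho> < norm ((poly R ^^ r n) z)"
      using eventually_happens'[OF sequentially_bot] by fastforce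
    thus ?thesis by (auto simp: escaping_def)
  qed
qed

text \<open>The basin of infinity is open, relatively closed by \<open>escapes_near\<close>, and
  non-empty, so it exhausts the connected Fatou set. Bounded orbits then characterise the Julia set,
  the form used from here on.\<close>

lemma fatou_eq_escaping: "fatou_set R = escaping"
proof -
  have "openin (top_of_set (fatou_set R)) escaping"
    using escaping_subset_fatou escaping_open by (simp add: open_subset)
  moreover have "closedin (top_of_set (fatou_set R)) escaping"
  proof -
    have "fatou_set R \<inter> closure escaping = escaping"
      using escapes_near escaping_subset_fatou closure_subset by blast
    thus ?thesis by (metis closed_closure closedin_closed_Int)
  qed
  moreover have "of_real (\<rho> + 1) \<in> escaping"
    unfolding escaping_def using rho_ge_1
    by (auto intro!: exI[of _ 0] simp del: of_real_add)
  ultimately show ?thesis using fatou_connected unfolding connected_clopen by blast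
qed

lemma julia_iff: "z \<in> julia_set R \<longleftrightarrow> (\<forall>n. norm ((poly R ^^ n) z) \<le> \<rho>)"
  by (auto simp: julia_set_def fatou_eq_escaping escaping_def not_less)

lemma julia_invariant: "poly R z \<in> julia_set R \<longleftrightarrow> z \<in> julia_set R"
proof -
  have "z \<in> escaping" if "poly R z \<in> escaping"
    using that unfolding escaping_def mem_Collect_eq by (metis comp_apply funpow_Suc_right)
  moreover have "poly R z \<in> escaping" if z: "z \<in> escaping"
  proof -
    obtain n where n: "\<rho> < norm ((poly R ^^ n) z)" using z by (auto simp: escaping_def)
    have "\<rho> < norm (poly R ((poly R ^^ n) z))" using growth[of "(poly R ^^ n) z"] n rho_ge_1 by simp
    hence "\<rho> < norm ((poly R ^^ n) (poly R z))" by (simp add: funpow_swap1)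
    thus ?thesis by (auto simp: escaping_def)
  qed
  ultimately show ?thesis by (auto simp: julia_set_def fatou_eq_escaping)
qed

lemma zero_in_julia: "0 \<in> julia_set R"
proof -
  have "(poly R ^^ n) 0 = 0" for n by (induction n) (auto simp: zero_fixed)
  thus ?thesis using rho_ge_1 by (simp add: julia_iff)
qed

lemma julia_compact: "compact (julia_set R)"
proof -
  have "closed (julia_set R)" by (simp add: julia_set_def closed_Compl fatou_set_open)
  moreover have "julia_set R \<subseteq> cball 0 \<rho>"
    using julia_iff by (metis funpow_0 mem_cball_0 subsetI)
  ultimately show ?thesis using bounded_subset[OF bounded_cball] by (auto simp: compact_eq_bounded_closed)
qed

end

section \<open>Polynomials with real roots\<close>

lemma pderiv_linear_mult:
  fixes q :: "'a :: idom poly"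
  shows "pderiv ([:-a, 1:] * q) = q + [:-a, 1:] * pderiv q"
  by (subst pderiv_mult) (simp add: pderiv_pCons)

text \<open>Away from the roots this is p^2 times the sum of 1/(x - a)^2, that is, -p^2 (p'/p)'. The
  induction over the roots avoids the division: a new root a turns the expression L of q into q^2 +
  (x - a)^2 L.\<close>

lemma laguerre_inequality:
  fixes A :: "real multiset"
  defines "p \<equiv> (\<Prod>a\<in>#A. [:-a, 1:])"
  shows "poly (pderiv p) x ^ 2 - poly p x * poly (pderiv (pderiv p)) x \<ge> 0"
    and "A \<noteq> {#} \<Longrightarrow> poly p x \<noteq> 0 \<Longrightarrow>
           poly (pderiv p) x ^ 2 - poly p x * poly (pderiv (pderiv p)) x > 0"
  unfolding atomize_conj atomize_imp p_def
proof (induction A)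
  case (add a A)
  define q where "q = (\<Prod>a\<in>#A. [:-a, 1:])"
  have pq: "(\<Prod>a\<in>#add_mset a A. [:-a, 1:]) = [:-a, 1:] * q" by (simp add: q_def)
  have 1: "pderiv ([:-a, 1:] * q) = q + [:-a, 1:] * pderiv q"
    by (rule pderiv_linear_mult)
  have 2: "pderiv (pderiv ([:-a, 1:] * q)) = 2 * pderiv q + [:-a, 1:] * pderiv (pderiv q)"
    unfolding 1 pderiv_add pderiv_linear_mult by simp
  have L: "poly (pderiv ([:-a, 1:] * q)) x ^ 2 - poly ([:-a, 1:] * q) x * poly (pderiv (pderiv ([:-a, 1:] * q))) x
     = poly q x ^ 2 + (x - a) ^ 2 * (poly (pderiv q) x ^ 2 - poly q x * poly (pderiv (pderiv q)) x)"
    unfolding 2 unfolding 1 by (simp add: algebra_simps power2_eq_square)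
  show ?case unfolding pq L using add unfolding q_def[symmetric]
    by (auto intro!: add_pos_nonneg)
qed simp

text \<open>The product is p^2 times the logarithmic derivative, the sum of 1/(x - a), whose terms
  all have the same sign on one side of the roots.\<close>

lemma logderiv_sign:
  fixes A :: "real multiset"
  defines "p \<equiv> (\<Prod>a\<in>#A. [:-a, 1:])"
  shows "(\<And>a. a \<in># A \<Longrightarrow> a \<le> x) \<Longrightarrow> poly (pderiv p) x * poly p x \<ge> 0 \<and>
            (A \<noteq> {#} \<longrightarrow> poly p x \<noteq> 0 \<longrightarrow> poly (pderiv p) x * poly p x > 0)"
    and "(\<And>a. a \<in># A \<Longrightarrow> x \<le> a) \<Longrightarrow> poly (pderiv p) x * poly p x \<le> 0 \<and>
            (A \<noteq> {#} \<longrightarrow> poly p x \<noteq> 0 \<longrightarrow> poly (pderiv p) x * poly p x < 0)"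
proof -
  have pq: "poly (pderiv (\<Prod>a\<in>#add_mset a A. [:-a, 1:])) x * poly (\<Prod>a\<in>#add_mset a A. [:-a, 1:]) x =
    (x - a) * poly (\<Prod>a\<in>#A. [:-a, 1:]) x ^ 2 +
    (x - a) ^ 2 * (poly (pderiv (\<Prod>a\<in>#A. [:-a, 1:])) x * poly (\<Prod>a\<in>#A. [:-a, 1:]) x)" for a and A :: "real multiset"
    unfolding image_mset_add_mset prod_mset.add_mset pderiv_linear_mult
    by (simp add: algebra_simps power2_eq_square)
  show "(\<And>a. a \<in># A \<Longrightarrow> a \<le> x) \<Longrightarrow> poly (pderiv p) x * poly p x \<ge> 0 \<and>
            (A \<noteq> {#} \<longrightarrow> poly p x \<noteq> 0 \<longrightarrow> poly (pderiv p) x * poly p x > 0)"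
    unfolding p_def
  proof (induction A)
    case (add a A)
    have ax: "a \<le> x" using add.prems by simp
    show ?case
    proof (cases "x = a")
      case False
      hence "x - a > 0" using ax by simp
      thus ?thesis unfolding pq using add by (auto intro!: add_pos_nonneg)
    qed (simp add: pq)
  qed simp
  show "(\<And>a. a \<in># A \<Longrightarrow> x \<le> a) \<Longrightarrow> poly (pderiv p) x * poly p x \<le> 0 \<and>
            (A \<noteq> {#} \<longrightarrow> poly p x \<noteq> 0 \<longrightarrow> poly (pderiv p) x * poly p x < 0)"
    unfolding p_def
  proof (induction A)
    case (add a A)
    have ax: "x \<le> a" using add.prems by simp
    show ?case
    proof (cases "x = a")
      case False
      hence xa: "x - a < 0" using ax by simp
      define u where "u = poly (\<Prod>a\<in>#A. [:-a, 1:]) x"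
      define v where "v = poly (pderiv (\<Prod>a\<in>#A. [:-a, 1:])) x"
      have IHp: "x \<le> b" if "b \<in># A" for b using add.prems that by simp
      have v: "v * u \<le> 0" unfolding u_def v_def using add.IH[OF IHp] by blast
      have "(x - a) ^ 2 * (v * u) \<le> 0" by (rule mult_nonneg_nonpos[OF _ v]) simp
      moreover have "(x - a) * u ^ 2 \<le> 0" using xa by (intro mult_nonpos_nonneg) auto
      moreover have "(x - a) * u ^ 2 < 0" if "u \<noteq> 0" using xa that by (intro mult_neg_pos) auto
      moreover have "u \<noteq> 0" if "poly (\<Prod>a\<in>#add_mset a A. [:-a, 1:]) x \<noteq> 0"
        using that by (auto simp: u_def)
      ultimately show ?thesis unfolding pq u_def[symmetric] v_def[symmetric] by fastforce
    qed (simp add: pq)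
  qed simp
qed

text \<open>The Gauss-Lucas argument: p' times the conjugate of p is |p|^2 p'/p, and each summand
  1/(z - a) of p'/p has imaginary part of the sign opposite to that of Im z.\<close>

lemma gauss_lucas_real_roots:
  fixes A :: "real multiset"
  defines "p \<equiv> (\<Prod>a\<in>#A. [:- complex_of_real a, 1:])"
  assumes "Im z \<noteq> 0"
  shows "poly p z \<noteq> 0" "Im z * Im (poly (pderiv p) z * cnj (poly p z)) \<le> 0"
    "A \<noteq> {#} \<Longrightarrow> Im z * Im (poly (pderiv p) z * cnj (poly p z)) < 0"
  unfolding atomize_conj atomize_imp p_def
proof (induction A)
  case (add a A)
  define q where "q = (\<Prod>a\<in>#A. [:- complex_of_real a, 1:])"
  have *: "Im (poly (pderiv (\<Prod>a\<in>#add_mset a A. [:- complex_of_real a, 1:])) z *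
      cnj (poly (\<Prod>a\<in>#add_mset a A. [:- complex_of_real a, 1:]) z)) =
      - Im z * norm (poly q z) ^ 2 + norm (z - of_real a) ^ 2 * Im (poly (pderiv q) z * cnj (poly q z))"
  proof -
    have "poly (pderiv (\<Prod>a\<in>#add_mset a A. [:- complex_of_real a, 1:])) z *
      cnj (poly (\<Prod>a\<in>#add_mset a A. [:- complex_of_real a, 1:]) z) =
      cnj (z - of_real a) * (poly q z * cnj (poly q z)) +
      ((z - of_real a) * cnj (z - of_real a)) * (poly (pderiv q) z * cnj (poly q z))"
      unfolding image_mset_add_mset prod_mset.add_mset pderiv_linear_mult q_def[symmetric]
      by (simp add: algebra_simps)
    also have "\<dots> = cnj (z - of_real a) * of_real (norm (poly q z) ^ 2) +
        of_real (norm (z - of_real a) ^ 2) * (poly (pderiv q) z * cnj (poly q z))"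
      by (simp only: complex_norm_square)
    finally show ?thesis by (simp del: of_real_power)
  qed
  have IH: "poly q z \<noteq> 0" "Im z * Im (poly (pderiv q) z * cnj (poly q z)) \<le> 0"
    using add by (auto simp: q_def)
  have za: "z - of_real a \<noteq> 0" using assms(2) by (auto simp: complex_eq_iff)
  have "Im z * (- Im z * norm (poly q z) ^ 2 + norm (z - of_real a) ^ 2 * Im (poly (pderiv q) z * cnj (poly q z)))
    = - (Im z ^ 2 * norm (poly q z) ^ 2) + norm (z - of_real a) ^ 2 * (Im z * Im (poly (pderiv q) z * cnj (poly q z)))"
    by (simp add: algebra_simps power2_eq_square)
  also have "\<dots> < 0"
    using IH za assms(2) by (intro add_neg_nonpos) (auto simp: mult_nonneg_nonpos)
  finally have "Im z * (- Im z * norm (poly q z) ^ 2 + norm (z - of_real a) ^ 2 * Im (poly (pderiv q) z * cnj (poly q z))) < 0" .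
  thus ?case unfolding * using IH za by (auto simp: q_def[symmetric])
qed simp

lemma real_coeffs_prod_mset:
  assumes "\<And>a. a \<in># A \<Longrightarrow> a \<in> \<real>"
  shows "coeff (\<Prod>a\<in>#A. [:-a, 1 :: complex:]) i \<in> \<real>"
  using assms
proof (induction A arbitrary: i)
  case (add a A)
  have "coeff [:-a, 1:] k \<in> \<real>" for k using add.prems by (auto simp: coeff_pCons split: nat.splits)
  thus ?case using add by (auto simp: coeff_mult simp del: mult_pCons_left intro!: sum_in_Reals Reals_mult)
qed auto

lemma rsquarefree_card_roots:
  fixes p :: "complex poly"
  assumes "rsquarefree p"
  shows "card {z. poly p z = 0} = degree p"
proof -
  have p0: "p \<noteq> 0" using assms by (simp add: rsquarefree_def)
  have "degree p = degree (\<Prod>z|poly p z = 0. [:-z, 1:])"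
    by (subst complex_poly_decompose_rsquarefree[OF assms, symmetric]) (use p0 in simp)
  also have "\<dots> = card {z. poly p z = 0}"
    by (subst degree_prod_sum_eq) auto
  finally show ?thesis by simp
qed

text \<open>V equals its Lagrange interpolant at \<open>card A\<close> nodes, and the leading
  coefficients are compared. With the preimages of a point as nodes, the denominators are values of
  P' up to the leading coefficient, which turns this into an identity for sums over
  branches.\<close>

lemma lagrange_leading_coeff:
  fixes y :: "'b \<Rightarrow> real"
  assumes fin: "finite A" and inj: "inj_on y A" and V: "lead_coeff V = 1" "Suc (degree V) = card A"
  shows "(\<Sum>j\<in>A. poly V (y j) / (\<Prod>k\<in>A-{j}. y j - y k)) = 1"
proof -
  define l where "l j = (\<Prod>k\<in>A-{j}. [:- y k, 1:])" for j
  define w where "w j = poly V (y j) / (\<Prod>k\<in>A-{j}. y j - y k)" for j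
  define L where "L = (\<Sum>j\<in>A. smult (w j) (l j))"
  have degl: "degree (l j) = degree V" if "j \<in> A" for j
    unfolding l_def using that fin V by (subst degree_prod_sum_eq) auto
  have degL: "degree L \<le> degree V" unfolding L_def
    by (intro degree_sum_le fin) (use degl degree_smult_le in force)
  have nz: "(\<Prod>k\<in>A-{j}. y j - y k) \<noteq> 0" if "j \<in> A" for j
    using that fin inj by (auto simp: inj_on_def)
  have "L = V"
  proof (rule poly_eqI_degree[of "y ` A"])
    fix x assume "x \<in> y ` A"
    then obtain i where i: "i \<in> A" "x = y i" by blast
    have "poly L x = (\<Sum>j\<in>A. w j * (\<Prod>k\<in>A-{j}. y i - y k))"
      by (simp add: L_def l_def poly_sum poly_prod i)
    also have "\<dots> = (\<Sum>j\<in>A. if j = i then poly V (y i) else 0)"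
    proof (intro sum.cong refl)
      fix j assume j: "j \<in> A"
      show "w j * (\<Prod>k\<in>A-{j}. y i - y k) = (if j = i then poly V (y i) else 0)"
      proof (cases "j = i")
        case True
        thus ?thesis using nz[OF i(1)] by (simp add: w_def)
      next
        case False
        hence "(\<Prod>k\<in>A-{j}. y i - y k) = 0" using i fin by (intro prod_zero) auto
        thus ?thesis using False by simp
      qed
    qed
    finally show "poly L x = poly V x" using fin i by simp
  qed (use inj degL V in \<open>auto simp: card_image\<close>)
  hence "1 = coeff L (degree V)" using V by simp
  also have "\<dots> = (\<Sum>j\<in>A. w j * coeff (l j) (degree V))" by (simp add: L_def coeff_sum)
  also have "\<dots> = (\<Sum>j\<in>A. w j * lead_coeff (l j))" using degl by (intro sum.cong refl) simp
  also have "\<dots> = (\<Sum>j\<in>A. w j)" by (simp add: l_def lead_coeff_prod)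
  finally show ?thesis by (simp add: w_def)
qed

section \<open>Polynomials with non-negative Julia set\<close>

locale julia_poly =
  fixes R :: "complex poly" and N :: nat and c :: real
  assumes deg: "degree R = N" and N2: "N \<ge> 2" and R0: "poly R 0 = 0"
    and R'0: "poly (pderiv R) 0 = complex_of_real c" and c1: "c > 1"
    and julia_nonneg: "julia_set R \<subseteq> \<real>\<^sub>\<ge>\<^sub>0"
begin

lemma escape_radius_exists: "\<exists>\<rho>. escape_radius R \<rho>"
proof -
  obtain \<rho> where "\<rho> \<ge> 1" "\<And>z. \<rho> \<le> norm z \<Longrightarrow> 2 * norm z \<le> norm (poly R z)"
    using poly_superlinear_growth[of R 2] deg N2 R0 by auto
  thus ?thesis by (intro exI[of _ \<rho>]) (unfold_locales, use R0 julia_nonneg in auto)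
qed

definition rad :: real where "rad = (SOME \<rho>. escape_radius R \<rho>)"

sublocale escape_radius R rad
  unfolding rad_def using escape_radius_exists by (rule someI_ex)

lemma julia_real: "z \<in> julia_set R \<Longrightarrow> z = of_real (Re z) \<and> 0 \<le> Re z"
  using julia_nonneg by (auto simp: complex_nonneg_Reals_iff complex_eq_iff)

lemma rjulia_eq: "rjulia R = Re ` julia_set R"
  using julia_real by (force simp: rjulia_def image_iff)

lemma rjulia_compact: "compact (rjulia R)"
  unfolding rjulia_eq by (intro compact_continuous_image julia_compact continuous_intros)

lemma zero_rjulia: "0 \<in> rjulia R"
  using zero_in_julia by (simp add: rjulia_def)

lemma rjulia_nonneg: "x \<in> rjulia R \<Longrightarrow> 0 \<le> x"
  using julia_nonneg by (auto simp: rjulia_def)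

definition \<beta> :: real where "\<beta> = Sup (rjulia R)"

lemma beta_rjulia: "\<beta> \<in> rjulia R"
  unfolding \<beta>_def using rjulia_compact zero_rjulia closed_contains_Sup compact_imp_closed
    bounded_imp_bdd_above compact_imp_bounded by (metis empty_iff)

lemma rjulia_le: "x \<in> rjulia R \<Longrightarrow> x \<le> \<beta>"
  unfolding \<beta>_def using rjulia_compact by (intro cSup_upper bounded_imp_bdd_above compact_imp_bounded)

lemma R_nz: "R \<noteq> 0" using deg N2 by auto

lemma preimage_roots_julia:
  assumes "w \<in> rjulia R" "poly R z = of_real w"
  shows "z \<in> julia_set R"
  using assms julia_invariant[of z] by (auto simp: rjulia_def)

text \<open>The roots of R are preimages of the Julia point 0, hence real, so the monic part of R
  has real coefficients. The real multiplier c then forces the leading coefficient to be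
  real.\<close>

lemma R_coeff_real: "coeff R i \<in> \<real>"
proof -
  define Q where "Q = (\<Prod>a\<in>#proots R. [:-a, 1 :: complex:])"
  have RQ: "R = smult (lead_coeff R) Q"
    unfolding Q_def by (rule complex_poly_decompose_multiset[symmetric])
  have Q: "coeff Q i \<in> \<real>" for i
    unfolding Q_def
  proof (rule real_coeffs_prod_mset)
    fix a assume "a \<in># proots R"
    hence "poly R a = of_real 0" using R_nz by (simp add: set_count_proots)
    hence "a \<in> julia_set R" using preimage_roots_julia zero_rjulia by blast
    thus "a \<in> \<real>" using julia_real by (metis Reals_of_real)
  qed
  have "of_real c = lead_coeff R * poly (pderiv Q) 0"
    using R'0 by (subst (asm) RQ) (simp add: pderiv_smult)
  also have "poly (pderiv Q) 0 = coeff Q 1" by (simp add: poly_0_coeff_0 coeff_pderiv)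
  finally have *: "of_real c = lead_coeff R * coeff Q 1" .
  hence "coeff Q 1 \<noteq> 0" using c1 by auto
  hence "lead_coeff R = of_real c / coeff Q 1" using * by (simp add: field_simps)
  hence "lead_coeff R \<in> \<real>" using Q by (metis Reals_divide Reals_of_real)
  thus ?thesis by (subst RQ) (use Q in auto)
qed

definition P :: "real poly" where "P = map_poly Re R"

lemma coeff_P: "of_real (coeff P i) = coeff R i"
  using R_coeff_real[of i] by (simp add: P_def coeff_map_poly)

lemma deg_P: "degree P = N"
proof -
  have "coeff P i = 0 \<longleftrightarrow> coeff R i = 0" for i
    using coeff_P[of i] by (metis of_real_eq_0_iff)
  hence "degree P = degree R" unfolding degree_def by simp
  thus ?thesis using deg by simp
qed

lemma P_nz: "P \<noteq> 0" using deg_P N2 by auto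

lemma poly_P: "poly R (of_real x) = of_real (poly P x)"
  by (simp add: poly_altdef deg deg_P coeff_P[symmetric])

lemma poly_P': "poly (pderiv R) (of_real x) = of_real (poly (pderiv P) x)"
proof -
  have "degree (pderiv R) = degree (pderiv P)" by (simp add: degree_pderiv deg deg_P)
  thus ?thesis by (simp add: poly_altdef coeff_pderiv coeff_P[symmetric])
qed

lemma poly_P'': "poly (pderiv (pderiv R)) (of_real x) = of_real (poly (pderiv (pderiv P)) x)"
proof -
  have "degree (pderiv (pderiv R)) = degree (pderiv (pderiv P))" by (simp add: degree_pderiv deg deg_P)
  thus ?thesis by (simp add: poly_altdef coeff_pderiv coeff_P[symmetric])
qed

lemma rmap_eq: "rmap R = poly P" by (auto simp: rmap_def poly_P)

lemma multiplier_eq: "multiplier R = c" by (simp add: multiplier_def R'0)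

lemma P0: "poly P 0 = 0" using poly_P[of 0] R0 by simp
lemma P'0: "poly (pderiv P) 0 = c" using poly_P'[of 0] R'0 by simp

lemma rjulia_invariant: "poly P x \<in> rjulia R \<longleftrightarrow> x \<in> rjulia R"
  using julia_invariant[of "of_real x"] by (simp add: rjulia_def poly_P)

text \<open>All solutions of R = w are Julia points when w is one, so R - w splits over the reals;
  this makes the inequalities for real-rooted polynomials available for every Julia value w.\<close>

lemma factor_julia:
  assumes w: "w \<in> rjulia R"
  obtains A where "P - [:w:] = smult (lead_coeff P) (\<Prod>a\<in>#A. [:-a, 1:])"
     "R - [:of_real w:] = smult (lead_coeff R) (\<Prod>a\<in>#A. [:- complex_of_real a, 1:])"
     "A \<noteq> {#}" "\<And>a. a \<in># A \<Longrightarrow> a \<in> rjulia R"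
proof -
  define Rw where "Rw = R - [:of_real w:]"
  have degw: "degree Rw = N" unfolding Rw_def using deg N2
    by (subst diff_conv_add_uminus, subst degree_add_eq_left) auto
  have nz: "Rw \<noteq> 0" using degw N2 by auto
  have lw: "lead_coeff Rw = lead_coeff R"
    unfolding degw deg using N2 by (simp add: Rw_def coeff_pCons split: nat.splits)
  define A where "A = image_mset Re (proots Rw)"
  have root: "a \<in> julia_set R" if "a \<in># proots Rw" for a
    using that nz w by (intro preimage_roots_julia[of w]) (auto simp: set_count_proots Rw_def)
  have "(\<Prod>a\<in>#A. [:- complex_of_real a, 1:]) = (\<Prod>a\<in>#proots Rw. [:-a, 1:])"
  proof -
    have "image_mset (\<lambda>a. [:- complex_of_real (Re a), 1:]) (proots Rw) = image_mset (\<lambda>a. [:-a, 1:]) (proots Rw)"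
      using root julia_real by (intro image_mset_cong) auto
    thus ?thesis unfolding A_def by (simp add: image_mset.compositionality o_def)
  qed
  hence Req: "Rw = smult (lead_coeff R) (\<Prod>a\<in>#A. [:- complex_of_real a, 1:])"
    using complex_poly_decompose_multiset[of Rw] lw by simp
  have pr: "poly (\<Prod>a\<in>#A. [:- complex_of_real a, 1:]) (of_real x) = of_real (poly (\<Prod>a\<in>#A. [:- a, 1:]) x)" for x
    by (induction A) auto
  have "P - [:w:] = smult (lead_coeff P) (\<Prod>a\<in>#A. [:-a, 1:])"
  proof (rule poly_eq_poly_eq_iff[THEN iffD1, OF ext])
    fix x
    have "complex_of_real (poly (P - [:w:]) x) = poly Rw (of_real x)" by (simp add: Rw_def poly_P)
    also have "\<dots> = of_real (poly (smult (lead_coeff P) (\<Prod>a\<in>#A. [:-a, 1:])) x)"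
      by (subst Req) (simp add: pr deg deg_P coeff_P)
    finally show "poly (P - [:w:]) x = poly (smult (lead_coeff P) (\<Prod>a\<in>#A. [:-a, 1:])) x"
      by (simp only: of_real_eq_iff)
  qed
  moreover have "size A = N" by (simp add: A_def size_proots_complex degw)
  hence "A \<noteq> {#}" using N2 by auto
  moreover have "a \<in> rjulia R" if "a \<in># A" for a
    using that root by (auto simp: A_def rjulia_eq)
  ultimately show ?thesis using that[of A] Req unfolding Rw_def by blast
qed

lemma lead_P_nz: "lead_coeff P \<noteq> 0" using P_nz by simp

text \<open>Laguerre's inequality for P - w with the square term gone: a critical value above w is a
  maximum, one below w a minimum.\<close>

lemma crit_curvature:
  assumes "poly (pderiv P) p = 0" "w \<in> rjulia R" "poly P p \<noteq> w"
  shows "(poly P p - w) * poly (pderiv (pderiv P)) p < 0"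
proof -
  obtain A where A: "P - [:w:] = smult (lead_coeff P) (\<Prod>a\<in>#A. [:-a, 1:])" "A \<noteq> {#}"
    using factor_julia[OF assms(2)] by metis
  define q where "q = (\<Prod>a\<in>#A. [:-a, 1:])"
  have P: "P = smult (lead_coeff P) q + [:w:]" using A unfolding q_def by (simp add: algebra_simps)
  have P': "pderiv P = smult (lead_coeff P) (pderiv q)"
    by (subst P) (simp add: pderiv_add pderiv_smult)
  hence P'': "pderiv (pderiv P) = smult (lead_coeff P) (pderiv (pderiv q))" by (simp add: pderiv_smult)
  have q': "poly (pderiv q) p = 0" using assms(1) lead_P_nz by (simp add: P')
  have Pw: "poly P p - w = lead_coeff P * poly q p" by (subst P) simp
  hence "poly q p \<noteq> 0" using assms(3) by auto
  hence "poly q p * poly (pderiv (pderiv q)) p < 0"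
    using laguerre_inequality(2)[of A p] A q' by (simp add: q_def)
  hence "lead_coeff P ^ 2 * (poly q p * poly (pderiv (pderiv q)) p) < 0"
    using lead_P_nz by (simp add: mult_less_0_iff)
  thus ?thesis unfolding Pw P'' by (simp add: power2_eq_square mult_ac)
qed

lemma crit_complex:
  assumes "poly (pderiv R) z = 0" shows "Im z = 0"
proof (rule ccontr)
  assume z: "Im z \<noteq> 0"
  obtain A where A: "R - [:of_real 0:] = smult (lead_coeff R) (\<Prod>a\<in>#A. [:- complex_of_real a, 1:])" "A \<noteq> {#}"
    using factor_julia[OF zero_rjulia] by metis
  hence "pderiv R = smult (lead_coeff R) (pderiv (\<Prod>a\<in>#A. [:- complex_of_real a, 1:]))"
    by (metis diff_zero of_real_0 pCons_0_0 pderiv_smult)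
  hence "poly (pderiv (\<Prod>a\<in>#A. [:- complex_of_real a, 1:])) z = 0"
    using assms R_nz by simp
  thus False using gauss_lucas_real_roots(3)[OF z A(2)] by simp
qed

text \<open>The product is half the derivative of (P - w)^2. Outside the range of the roots of P - w
  this square is strictly monotone, so all critical points lie inside the hull, and the value of P
  at \<beta> can be determined.\<close>

lemma outside_sign:
  assumes "w \<in> rjulia R" "poly P x \<noteq> w"
  shows "\<beta> \<le> x \<Longrightarrow> (poly P x - w) * poly (pderiv P) x > 0"
    and "x \<le> 0 \<Longrightarrow> (poly P x - w) * poly (pderiv P) x < 0"
proof -
  obtain A where A: "P - [:w:] = smult (lead_coeff P) (\<Prod>a\<in>#A. [:-a, 1:])" "A \<noteq> {#}"
       "\<And>a. a \<in># A \<Longrightarrow> a \<in> rjulia R"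
    using factor_julia[OF assms(1)] by metis
  define q where "q = (\<Prod>a\<in>#A. [:-a, 1:])"
  have P: "P = smult (lead_coeff P) q + [:w:]" using A unfolding q_def by (simp add: algebra_simps)
  have P': "pderiv P = smult (lead_coeff P) (pderiv q)"
    by (subst P) (simp add: pderiv_add pderiv_smult)
  have Pw: "poly P x - w = lead_coeff P * poly q x" by (subst P) simp
  hence nz: "poly q x \<noteq> 0" using assms(2) by auto
  have eq: "(poly P x - w) * poly (pderiv P) x = lead_coeff P ^ 2 * (poly (pderiv q) x * poly q x)"
    unfolding Pw P' by (simp add: power2_eq_square mult_ac)
  show "(poly P x - w) * poly (pderiv P) x > 0" if "\<beta> \<le> x"
  proof -
    have "poly (pderiv q) x * poly q x > 0"
      using logderiv_sign(1)[of A x] A rjulia_le that nz unfolding q_def by fastforce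
    thus ?thesis unfolding eq using lead_P_nz by simp
  qed
  show "(poly P x - w) * poly (pderiv P) x < 0" if "x \<le> 0"
  proof -
    have "poly (pderiv q) x * poly q x < 0"
      using logderiv_sign(2)[of A x] A rjulia_nonneg that nz unfolding q_def by fastforce
    thus ?thesis unfolding eq using lead_P_nz by (simp add: mult_less_0_iff)
  qed
qed

text \<open>The root 0 of R is simple because R'(0) = c is non-zero, so R has a second root; it is a
  Julia point and therefore positive.\<close>

lemma beta_pos: "\<beta> > 0"
proof -
  have "\<exists>q. q \<in> julia_set R \<and> q \<noteq> 0"
  proof -
    obtain Q where Q: "R = pCons 0 Q" using R0 by (cases R) auto
    have "degree Q \<noteq> 0" using deg N2 by (auto simp: Q split: if_splits)
    then obtain q where q: "poly Q q = 0"
      using fundamental_theorem_of_algebra[of Q] constant_degree[of Q] by auto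
    have "poly Q 0 \<noteq> 0" using R'0 c1 by (auto simp: Q pderiv_pCons)
    hence "q \<noteq> 0" using q by auto
    moreover have "q \<in> julia_set R" using preimage_roots_julia[OF zero_rjulia, of q] by (simp add: Q q)
    ultimately show ?thesis by blast
  qed
  then obtain q where "q \<in> julia_set R" "q \<noteq> 0" by blast
  hence "Re q \<in> rjulia R" "Re q > 0" using julia_real[of q] by (auto simp: rjulia_eq complex_eq_iff)
  thus ?thesis using rjulia_le by force
qed

lemma rjulia_other_value: "\<exists>w\<in>rjulia R. y \<noteq> w"
  using zero_rjulia beta_rjulia beta_pos by (metis less_irrefl)

section \<open>Critical points and critical values\<close>

definition crit :: "real set" where "crit = {x. poly (pderiv P) x = 0}"

lemma pderiv_P_nz: "pderiv P \<noteq> 0"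
  using P'0 c1 by auto

lemma finite_crit: "finite crit"
  unfolding crit_def using pderiv_P_nz by (rule poly_roots_finite)

lemma crit_range: "x \<in> crit \<Longrightarrow> 0 < x \<and> x < \<beta>"
proof -
  assume x: "x \<in> crit"
  obtain w where "w \<in> rjulia R" "poly P x \<noteq> w" using rjulia_other_value by metis
  from outside_sign[OF this] x show ?thesis by (force simp: crit_def not_le)
qed

lemma crit_nondegenerate: "x \<in> crit \<Longrightarrow> poly (pderiv (pderiv P)) x \<noteq> 0"
proof -
  assume x: "x \<in> crit"
  obtain w where "w \<in> rjulia R" "poly P x \<noteq> w" using rjulia_other_value by metis
  with crit_curvature[of x w] x show ?thesis by (auto simp: crit_def)
qed

text \<open>\<open>crit_curvature\<close> at the two ends of the Julia set: a maximum below \<beta>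
  or a minimum above 0 would have the wrong curvature. This is why P will map each interval between
  critical points across the whole hull.\<close>

lemma crit_value:
  assumes "x \<in> crit"
  shows "poly (pderiv (pderiv P)) x \<le> 0 \<Longrightarrow> \<beta> \<le> poly P x"
    and "poly (pderiv (pderiv P)) x \<ge> 0 \<Longrightarrow> poly P x \<le> 0"
proof -
  have x: "poly (pderiv P) x = 0" using assms by (simp add: crit_def)
  show "\<beta> \<le> poly P x" if "poly (pderiv (pderiv P)) x \<le> 0"
  proof (cases "poly P x = \<beta>")
    case False
    from crit_curvature[OF x beta_rjulia this] that show ?thesis
      by (auto simp: mult_less_0_iff)
  qed simp
  show "poly P x \<le> 0" if "poly (pderiv (pderiv P)) x \<ge> 0"
  proof (cases "poly P x = 0")
    case False
    from crit_curvature[OF x zero_rjulia this] that show ?thesis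
      by (auto simp: mult_less_0_iff)
  qed simp
qed

lemma complex_crit: "{z. poly (pderiv R) z = 0} = of_real ` crit"
proof (intro equalityI subsetI)
  fix z assume "z \<in> {z. poly (pderiv R) z = 0}"
  hence z: "poly (pderiv R) z = 0" by simp
  hence "z = of_real (Re z)" using crit_complex by (simp add: complex_eq_iff)
  thus "z \<in> of_real ` crit" using z poly_P'[of "Re z"]
    by (intro image_eqI[of _ _ "Re z"]) (auto simp: crit_def)
qed (auto simp: crit_def poly_P')

lemma card_crit: "card crit = N - 1"
proof -
  have "rsquarefree (pderiv R)"
    unfolding rsquarefree_roots
  proof (intro allI notI)
    fix a assume a: "poly (pderiv R) a = 0 \<and> poly (pderiv (pderiv R)) a = 0"
    hence "a \<in> of_real ` crit" unfolding complex_crit[symmetric] by simp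
    then obtain x where x: "a = of_real x" "x \<in> crit" by blast
    thus False using a crit_nondegenerate[of x] poly_P''[of x] by simp
  qed
  from rsquarefree_card_roots[OF this] have "card crit = degree (pderiv R)"
    unfolding complex_crit by (simp add: card_image inj_on_def)
  thus ?thesis by (simp add: degree_pderiv deg)
qed

lemma pderiv_P_factor: "pderiv P = smult (of_nat N * lead_coeff P) (\<Prod>x\<in>crit. [:-x, 1:])"
proof (rule poly_eqI_degree_lead_coeff[of _ "N - 1" _ crit])
  show "coeff (pderiv P) (N - 1) = coeff (smult (of_nat N * lead_coeff P) (\<Prod>x\<in>crit. [:-x, 1:])) (N - 1)"
  proof -
    have "degree (\<Prod>x\<in>crit. [:-x, 1 :: real:]) = N - 1"
      by (subst degree_prod_sum_eq) (auto simp: card_crit)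
    hence "coeff (\<Prod>x\<in>crit. [:-x, 1 :: real:]) (N - 1) = lead_coeff (\<Prod>x\<in>crit. [:-x, 1:])" by simp
    also have "\<dots> = 1" by (simp add: lead_coeff_prod)
    finally show ?thesis using N2 by (simp add: coeff_pderiv deg_P)
  qed
  show "degree (smult (of_nat N * lead_coeff P) (\<Prod>x\<in>crit. [:-x, 1:])) \<le> N - 1"
    by (rule order.trans[OF degree_smult_le]) (subst degree_prod_sum_eq, auto simp: card_crit)
  show "poly (pderiv P) x = poly (smult (of_nat N * lead_coeff P) (\<Prod>x\<in>crit. [:-x, 1:])) x"
    if "x \<in> crit" for x
  proof -
    have "(\<Prod>j\<in>crit. x - j) = 0" using that finite_crit by auto
    thus ?thesis using that by (simp add: poly_prod crit_def[symmetric]) (simp add: crit_def)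
  qed
qed (auto simp: card_crit degree_pderiv deg_P)

section \<open>The intervals of monotonicity\<close>

definition bps :: "real list" where "bps = sorted_list_of_set (insert 0 (insert \<beta> crit))"

abbreviation b :: "nat \<Rightarrow> real" where "b j \<equiv> bps ! j"

lemma set_bps: "set bps = insert 0 (insert \<beta> crit)"
  unfolding bps_def by (rule set_sorted_list_of_set) (simp add: finite_crit)

lemma length_bps: "length bps = Suc N"
proof -
  have "0 \<notin> insert \<beta> crit" "\<beta> \<notin> crit" using crit_range beta_pos by force+
  thus ?thesis using finite_crit card_crit N2 by (simp add: bps_def)
qed

lemma sorted_bps: "sorted_wrt (<) bps"
  by (simp add: bps_def)

lemma b_less: "i < j \<Longrightarrow> j \<le> N \<Longrightarrow> b i < b j"
  using sorted_wrt_nth_less[OF sorted_bps] length_bps by simp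

lemma b_le: "i \<le> j \<Longrightarrow> j \<le> N \<Longrightarrow> b i \<le> b j"
  using b_less[of i j] by (cases "i = j") auto

lemma b_mem: "j \<le> N \<Longrightarrow> b j \<in> insert 0 (insert \<beta> crit)"
  using nth_mem[of j bps] length_bps set_bps by simp

lemma b_nonneg: "j \<le> N \<Longrightarrow> 0 \<le> b j \<and> b j \<le> \<beta>"
  using b_mem[of j] crit_range beta_pos by force

lemma b_0: "b 0 = 0"
proof -
  obtain i where "i < length bps" "b i = 0" using set_bps by (metis in_set_conv_nth insertI1)
  thus ?thesis using b_less[of 0 i] b_nonneg[of 0] length_bps by (cases "i = 0") auto
qed

lemma b_N: "b N = \<beta>"
proof -
  obtain i where "i < length bps" "b i = \<beta>" using set_bps by (metis in_set_conv_nth insertI1 insertI2)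
  thus ?thesis using b_less[of i N] b_nonneg[of N] length_bps by (cases "i = N") auto
qed

lemma b_crit: "0 < j \<Longrightarrow> j < N \<Longrightarrow> b j \<in> crit"
  using b_mem[of j] b_less[of 0 j] b_less[of j N] b_0 b_N by force

lemma crit_b: "x \<in> crit \<Longrightarrow> \<exists>j. 0 < j \<and> j < N \<and> x = b j"
proof -
  assume x: "x \<in> crit"
  then obtain j where "j < length bps" "b j = x" using set_bps by (metis in_set_conv_nth insertI2)
  thus ?thesis using crit_range[OF x] b_0 b_N length_bps
    by (intro exI[of _ j]) (metis gr0I less_SucE less_irrefl)
qed

lemma no_crit_between: "j < N \<Longrightarrow> b j < x \<Longrightarrow> x < b (Suc j) \<Longrightarrow> poly (pderiv P) x \<noteq> 0"
proof
  assume j: "j < N" "b j < x" "x < b (Suc j)" and "poly (pderiv P) x = 0"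
  then obtain i where i: "i < N" "x = b i" using crit_b[of x] by (auto simp: crit_def)
  show False using j i b_le[of i j] b_le[of "Suc j" i] by (cases "i \<le> j") auto
qed

text \<open>The index is shifted: this concerns the interval from \<open>b j\<close> to
  \<open>b (Suc j)\<close>, which is \<open>piece R (Suc j)\<close>. The monotonicity of the branch
  \<open>\<phi> j\<close> is therefore governed by \<open>increasing_piece (j - 1)\<close>.\<close>

definition increasing_piece :: "nat \<Rightarrow> bool" where
  "increasing_piece j \<longleftrightarrow> (\<forall>x. b j < x \<longrightarrow> x < b (Suc j) \<longrightarrow> poly (pderiv P) x > 0)"

lemma decreasing_piece:
  assumes "\<not> increasing_piece j" "j < N" "b j < x" "x < b (Suc j)"
  shows "poly (pderiv P) x < 0"
proof (rule ccontr)
  assume "\<not> poly (pderiv P) x < 0"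
  hence x: "poly (pderiv P) x > 0" using no_crit_between assms by (meson linorder_neqE)
  obtain y where y: "b j < y" "y < b (Suc j)" "\<not> poly (pderiv P) y > 0"
    using assms by (auto simp: increasing_piece_def)
  hence y': "poly (pderiv P) y < 0" using no_crit_between assms by (meson linorder_neqE)
  have "\<exists>z. b j < z \<and> z < b (Suc j) \<and> poly (pderiv P) z = 0"
  proof (cases "x < y")
    case True
    then obtain z where "x < z" "z < y" "poly (pderiv P) z = 0" using poly_IVT_neg x y' by blast
    thus ?thesis using y assms by (intro exI[of _ z]) auto
  next
    case False
    moreover have "x \<noteq> y" using x y' by auto
    ultimately have "y < x" by simp
    then obtain z where "y < z" "z < x" "poly (pderiv P) z = 0" using poly_IVT_pos x y' by blast
    thus ?thesis using y assms by (intro exI[of _ z]) auto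
  qed
  thus False using no_crit_between[OF assms(2)] by blast
qed

text \<open>If the right end is critical, the sign of P' to its left determines the sign of P''
  there, and \<open>crit_value\<close> applies. If it is \<beta>, then P(\<beta>) is a Julia point,
  hence lies in the hull, and \<open>outside_sign\<close> leaves only the end of the hull in
  question.\<close>

lemma piece_right_end:
  assumes "j < N"
  shows "increasing_piece j \<Longrightarrow> \<beta> \<le> poly P (b (Suc j))"
    and "\<not> increasing_piece j \<Longrightarrow> poly P (b (Suc j)) \<le> 0"
proof -
  have lt: "b j < b (Suc j)" using b_less assms by simp
  define m where "m = (b j + b (Suc j)) / 2"
  have m: "b j < m" "m < b (Suc j)" using lt by (auto simp: m_def)
  show "\<beta> \<le> poly P (b (Suc j))" if inc: "increasing_piece j"
  proof (cases "Suc j < N")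
    case True
    hence cr: "b (Suc j) \<in> crit" using b_crit by simp
    have "poly (pderiv (pderiv P)) (b (Suc j)) \<le> 0"
    proof (rule ccontr)
      assume "\<not> ?thesis"
      then obtain d where d: "d > 0" "\<And>h. 0 < h \<Longrightarrow> h < d \<Longrightarrow>
          poly (pderiv P) (b (Suc j) - h) < poly (pderiv P) (b (Suc j))"
        using DERIV_pos_inc_left[OF poly_DERIV[of "pderiv P" "b (Suc j)"]] by auto
      define h where "h = min (d / 2) ((b (Suc j) - b j) / 2)"
      have "0 < h" "h < d" "b j < b (Suc j) - h" using d lt by (auto simp: h_def min_def field_simps)
      thus False using d(2)[of h] inc cr by (force simp: increasing_piece_def crit_def)
    qed
    thus ?thesis using crit_value(1)[OF cr] by blast
  next
    case False
    hence N: "Suc j = N" using assms by simp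
    have "poly (pderiv P) \<beta> \<noteq> 0" using crit_range by (force simp: crit_def)
    moreover have "\<not> poly (pderiv P) \<beta> < 0"
    proof
      assume "poly (pderiv P) \<beta> < 0"
      moreover have "poly (pderiv P) m > 0" "m < \<beta>" using inc m N b_N by (auto simp: increasing_piece_def)
      ultimately obtain z where "m < z" "z < \<beta>" "poly (pderiv P) z = 0" using poly_IVT_neg by blast
      thus False using no_crit_between[OF assms, of z] m N b_N by auto
    qed
    ultimately have "poly (pderiv P) \<beta> > 0" by linarith
    hence "poly P \<beta> = \<beta>"
      using outside_sign(1)[OF beta_rjulia, of \<beta>] rjulia_le[of "poly P \<beta>"] rjulia_invariant[of \<beta>] beta_rjulia
      by (force simp: zero_less_mult_iff)
    thus ?thesis using N b_N by simp
  qed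
  show "poly P (b (Suc j)) \<le> 0" if dec: "\<not> increasing_piece j"
  proof (cases "Suc j < N")
    case True
    hence cr: "b (Suc j) \<in> crit" using b_crit by simp
    have "poly (pderiv (pderiv P)) (b (Suc j)) \<ge> 0"
    proof (rule ccontr)
      assume "\<not> ?thesis"
      then obtain d where d: "d > 0" "\<And>h. 0 < h \<Longrightarrow> h < d \<Longrightarrow>
          poly (pderiv P) (b (Suc j) - h) > poly (pderiv P) (b (Suc j))"
        using DERIV_neg_dec_left[OF poly_DERIV[of "pderiv P" "b (Suc j)"]] by auto
      define h where "h = min (d / 2) ((b (Suc j) - b j) / 2)"
      have "0 < h" "h < d" "b j < b (Suc j) - h" using d lt by (auto simp: h_def min_def field_simps)
      thus False using d(2)[of h] decreasing_piece[OF dec assms, of "b (Suc j) - h"] cr by (force simp: crit_def)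
    qed
    thus ?thesis using crit_value(2)[OF cr] by blast
  next
    case False
    hence N: "Suc j = N" using assms by simp
    have "poly (pderiv P) \<beta> \<noteq> 0" using crit_range by (force simp: crit_def)
    moreover have "\<not> poly (pderiv P) \<beta> > 0"
    proof
      assume "poly (pderiv P) \<beta> > 0"
      moreover have "poly (pderiv P) m < 0" "m < \<beta>" using decreasing_piece[OF dec assms] m N b_N by auto
      ultimately obtain z where "m < z" "z < \<beta>" "poly (pderiv P) z = 0" using poly_IVT_pos by blast
      thus False using no_crit_between[OF assms, of z] m N b_N by auto
    qed
    ultimately have "poly (pderiv P) \<beta> < 0" by linarith
    hence "poly P \<beta> = 0"
      using outside_sign(1)[OF zero_rjulia, of \<beta>] rjulia_nonneg[of "poly P \<beta>"] rjulia_invariant[of \<beta>] beta_rjulia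
      by (force simp: zero_less_mult_iff)
    thus ?thesis using N b_N by simp
  qed
qed

lemma increasing_piece_0: "increasing_piece 0"
proof (rule ccontr)
  assume dec: "\<not> increasing_piece 0"
  define m where "m = b 1 / 2"
  have "b 0 < b 1" using b_less N2 by simp
  hence m: "b 0 < m" "m < b (Suc 0)" "0 < m" using b_0 by (auto simp: m_def)
  have "poly (pderiv P) m < 0" using decreasing_piece[OF dec _ m(1,2)] N2 by simp
  moreover have "poly (pderiv P) 0 > 0" using P'0 c1 by simp
  ultimately obtain z where "0 < z" "z < m" "poly (pderiv P) z = 0" using poly_IVT_neg m(3) by blast
  thus False using no_crit_between[of 0 z] m N2 b_0 by auto
qed

lemma piece_left_end:
  assumes "j < N"
  shows "increasing_piece j \<Longrightarrow> poly P (b j) \<le> 0"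
    and "\<not> increasing_piece j \<Longrightarrow> \<beta> \<le> poly P (b j)"
proof -
  have lt: "b j < b (Suc j)" using b_less assms by simp
  show "poly P (b j) \<le> 0" if inc: "increasing_piece j"
  proof (cases "j = 0")
    case False
    hence cr: "b j \<in> crit" using b_crit assms by simp
    have "poly (pderiv (pderiv P)) (b j) \<ge> 0"
    proof (rule ccontr)
      assume "\<not> ?thesis"
      then obtain d where d: "d > 0" "\<And>h. 0 < h \<Longrightarrow> h < d \<Longrightarrow>
          poly (pderiv P) (b j + h) < poly (pderiv P) (b j)"
        using DERIV_neg_dec_right[OF poly_DERIV[of "pderiv P" "b j"]] by auto
      define h where "h = min (d / 2) ((b (Suc j) - b j) / 2)"
      have "0 < h" "h < d" "b j + h < b (Suc j)" using d lt by (auto simp: h_def min_def field_simps)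
      thus False using d(2)[of h] inc cr by (force simp: increasing_piece_def crit_def)
    qed
    thus ?thesis using crit_value(2)[OF cr] by blast
  qed (simp add: b_0 P0)
  show "\<beta> \<le> poly P (b j)" if dec: "\<not> increasing_piece j"
  proof -
    have "j \<noteq> 0" using dec increasing_piece_0 by metis
    hence cr: "b j \<in> crit" using b_crit assms by simp
    have "poly (pderiv (pderiv P)) (b j) \<le> 0"
    proof (rule ccontr)
      assume "\<not> ?thesis"
      then obtain d where d: "d > 0" "\<And>h. 0 < h \<Longrightarrow> h < d \<Longrightarrow>
          poly (pderiv P) (b j + h) > poly (pderiv P) (b j)"
        using DERIV_pos_inc_right[OF poly_DERIV[of "pderiv P" "b j"]] by auto
      define h where "h = min (d / 2) ((b (Suc j) - b j) / 2)"
      have "0 < h" "h < d" "b j + h < b (Suc j)" using d lt by (auto simp: h_def min_def field_simps)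
      thus False using d(2)[of h] decreasing_piece[OF dec assms, of "b j + h"] cr by (force simp: crit_def)
    qed
    thus ?thesis using crit_value(1)[OF cr] by blast
  qed
qed

lemma increasing_strict:
  assumes "j < N" "increasing_piece j" "b j \<le> x" "x < y" "y \<le> b (Suc j)"
  shows "poly P x < poly P y"
proof (rule DERIV_pos_imp_increasing_open[OF \<open>x < y\<close>])
  fix z assume "x < z" "z < y"
  thus "\<exists>l. DERIV (poly P) z :> l \<and> 0 < l"
    using assms by (intro exI[of _ "poly (pderiv P) z"]) (auto simp: increasing_piece_def)
qed (intro continuous_intros)

lemma decreasing_strict:
  assumes "j < N" "\<not> increasing_piece j" "b j \<le> x" "x < y" "y \<le> b (Suc j)"
  shows "poly P y < poly P x"
proof (rule DERIV_neg_imp_decreasing_open[OF \<open>x < y\<close>])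
  fix z assume "x < z" "z < y"
  thus "\<exists>l. DERIV (poly P) z :> l \<and> l < 0"
    using assms decreasing_piece[of j z] by (intro exI[of _ "poly (pderiv P) z"]) auto
qed (intro continuous_intros)

lemma hull_eq: "hull_interval R = {0..\<beta>}"
proof -
  have "convex hull (rjulia R) \<subseteq> {0..\<beta>}"
    by (rule hull_minimal) (use rjulia_nonneg rjulia_le in auto)
  moreover have "{0..\<beta>} \<subseteq> convex hull (rjulia R)"
    using closed_segment_subset_convex_hull[of 0 "rjulia R" \<beta>] hull_inc[OF zero_rjulia]
      hull_inc[OF beta_rjulia] beta_pos
    by (simp add: closed_segment_eq_real_ivl)
  ultimately show ?thesis by (auto simp: hull_interval_def)
qed

lemma pieces_cover:
  assumes "0 \<le> x" "x \<le> \<beta>"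
  obtains j where "j < N" "b j \<le> x" "x \<le> b (Suc j)"
proof -
  define j where "j = Max {j. j < N \<and> b j \<le> x}"
  have fin: "finite {j. j < N \<and> b j \<le> x}" by simp
  have "0 \<in> {j. j < N \<and> b j \<le> x}" using assms b_0 N2 by simp
  hence j: "j \<in> {j. j < N \<and> b j \<le> x}" unfolding j_def by (intro Max_in[OF fin]) auto
  have "x \<le> b (Suc j)"
  proof (cases "Suc j < N")
    case True
    show ?thesis
    proof (rule ccontr)
      assume "\<not> ?thesis"
      hence "Suc j \<in> {j. j < N \<and> b j \<le> x}" using True by simp
      from Max_ge[OF fin this] have "Suc j \<le> j" unfolding j_def .
      thus False by simp
    qed
  next
    case False
    hence "Suc j = N" using j by simp
    thus ?thesis using b_N assms by simp
  qed
  thus ?thesis using that j by blast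
qed

lemma bps_decomposition: "is_monotone_decomposition R bps"
  unfolding is_monotone_decomposition_def deg hull_eq rmap_eq
proof (intro conjI allI impI)
  show "(\<Union>j<N. {b j..b (Suc j)}) = {0..\<beta>}"
  proof (intro equalityI subsetI)
    fix x assume "x \<in> (\<Union>j<N. {b j..b (Suc j)})"
    then obtain j where "j < N" "b j \<le> x" "x \<le> b (Suc j)" by auto
    thus "x \<in> {0..\<beta>}" using b_nonneg[of j] b_nonneg[of "Suc j"] by auto
  next
    fix x assume "x \<in> {0..\<beta>}"
    then obtain j where "j < N" "b j \<le> x" "x \<le> b (Suc j)" using pieces_cover by auto
    thus "x \<in> (\<Union>j<N. {b j..b (Suc j)})" by auto
  qed
  fix j assume j: "j < N"
  show "mono_on {b j..b (Suc j)} (poly P) \<or> antimono_on {b j..b (Suc j)} (poly P)"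
  proof (cases "increasing_piece j")
    case True
    hence "mono_on {b j..b (Suc j)} (poly P)"
      using increasing_strict[OF j] by (auto intro!: mono_onI simp: le_less)
    thus ?thesis ..
  next
    case False
    hence "antimono_on {b j..b (Suc j)} (poly P)"
      using decreasing_strict[OF j] by (auto intro!: monotone_onI simp: le_less)
    thus ?thesis ..
  qed
qed (auto simp: length_bps sorted_bps)

text \<open>At an interior critical point of an interval of monotonicity P' has an extremum with
  value 0, so P'' vanishes too, contrary to \<open>crit_nondegenerate\<close>.\<close>

lemma monotone_piece_no_crit:
  assumes "mono_on {l..u} (poly P) \<or> antimono_on {l..u} (poly P)" "l < x" "x < u"
  shows "x \<notin> crit"
proof
  assume x: "x \<in> crit"
  define e where "e = min (x - l) (u - x)"
  have e: "e > 0" "l < y" "y < u" if "\<bar>x - y\<bar> < e" for y using assms that by (auto simp: e_def)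
  have e0: "e > 0" using assms by (auto simp: e_def)
  have "poly (pderiv (pderiv P)) x = 0"
    using assms(1)
  proof
    assume m: "mono_on {l..u} (poly P)"
    have nn: "poly (pderiv P) y \<ge> 0" if "l < y" "y < u" for y
      using mono_on_imp_deriv_nonneg[OF m poly_DERIV] that by simp
    show ?thesis
      by (rule DERIV_local_min[OF poly_DERIV e0])
         (use nn e x in \<open>auto simp: crit_def\<close>)
  next
    assume m: "antimono_on {l..u} (poly P)"
    hence m': "mono_on {l..u} (poly (-P))" by (auto simp: monotone_on_def)
    have nn: "poly (pderiv P) y \<le> 0" if "l < y" "y < u" for y
      using mono_on_imp_deriv_nonneg[OF m' poly_DERIV] that by (simp add: pderiv_minus)
    show ?thesis
      by (rule DERIV_local_max[OF poly_DERIV e0])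
         (use nn e x in \<open>auto simp: crit_def\<close>)
  qed
  thus False using crit_nondegenerate[OF x] by simp
qed

text \<open>The points 0, \<beta> and the N - 1 critical points must all occur among the N + 1 break
  points, so there is no room for others.\<close>

lemma decomposition_unique:
  assumes "is_monotone_decomposition R xs"
  shows "xs = bps"
proof -
  have len: "length xs = Suc N" and sorted: "sorted_wrt (<) xs"
    and cover: "(\<Union>j<N. {xs ! j..xs ! Suc j}) = {0..\<beta>}"
    and mono: "\<And>j. j < N \<Longrightarrow> mono_on {xs ! j..xs ! Suc j} (poly P) \<or> antimono_on {xs ! j..xs ! Suc j} (poly P)"
    using assms unfolding is_monotone_decomposition_def deg hull_eq rmap_eq by auto
  have range: "xs ! j \<in> {0..\<beta>}" "xs ! Suc j \<in> {0..\<beta>}" if "j < N" for j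
  proof -
    have "xs ! j \<le> xs ! Suc j" using sorted_wrt_nth_less[OF sorted, of j "Suc j"] that len by simp
    thus "xs ! j \<in> {0..\<beta>}" "xs ! Suc j \<in> {0..\<beta>}" unfolding cover[symmetric] using that by auto
  qed
  have end_or: "\<exists>j<N. xs ! j \<le> x \<and> x \<le> xs ! Suc j" if "x \<in> {0..\<beta>}" for x
    using that unfolding cover[symmetric] by auto
  have "x \<in> set xs" if x: "x \<in> insert 0 (insert \<beta> crit)" for x
  proof -
    have "x \<in> {0..\<beta>}" using x crit_range beta_pos by force
    then obtain j where j: "j < N" "xs ! j \<le> x" "x \<le> xs ! Suc j" using end_or by blast
    have "x = xs ! j \<or> x = xs ! Suc j"
    proof -
      consider "x = 0" | "x = \<beta>" | "x \<in> crit" using x by blast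
      thus ?thesis
      proof cases
        case 3
        with monotone_piece_no_crit[OF mono[OF j(1)], of x] j show ?thesis by force
      qed (use range[OF j(1)] j in auto)
    qed
    thus ?thesis using j len by auto
  qed
  hence sub: "set bps \<subseteq> set xs" unfolding set_bps by blast
  have dist: "distinct xs" "sorted xs" using sorted by (auto simp: strict_sorted_iff)
  have "card (set bps) = card (set xs)"
    using dist sorted_bps len length_bps by (simp add: distinct_card strict_sorted_iff)
  hence "set bps = set xs" using sub by (intro card_subset_eq) auto
  hence eq: "insert 0 (insert \<beta> crit) = set xs" by (simp only: set_bps)
  show ?thesis unfolding bps_def eq using dist
    by (simp add: sorted_list_of_set.idem_if_sorted_distinct)
qed

lemma break_points_eq: "break_points R = bps"
  unfolding break_points_def using bps_decomposition decomposition_unique by blast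

lemma piece_eq: "piece R j = {b (j - 1)..b j}"
  by (simp add: piece_def break_points_eq)

end

section \<open>Inverse branches and the Koenigs function\<close>

text \<open>Stated over a general field because it serves the real branch S and later its complex
  extension. E bounds the product of the factors 1 + K |z n| by means of the geometric decay of z n;
  inserting |z n| \<le> B E c^(-n) into the quadratic error gives the second claim, and summation
  the third.\<close>

lemma koenigs_sequence:
  fixes z :: "nat \<Rightarrow> 'a :: {banach, real_normed_field}"
  assumes c: "c > 1" and \<rho>: "0 \<le> \<rho>" "\<rho> < 1" and K: "K \<ge> 0" and B: "norm (z 0) \<le> B"
    and contr: "\<And>n. norm (z (Suc n)) \<le> \<rho> * norm (z n)"
    and quad: "\<And>n. norm (of_real c * z (Suc n) - z n) \<le> K * norm (z n) ^ 2"
  defines "E \<equiv> exp (K * B / (1 - \<rho>))"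
  shows "norm (of_real c ^ n * z n) \<le> norm (z 0) * E"
    and "norm (of_real c ^ Suc n * z (Suc n) - of_real c ^ n * z n) \<le> K * (B * E) ^ 2 * (1 / c) ^ n"
    and "convergent (\<lambda>n. of_real c ^ n * z n)"
proof -
  have B0: "B \<ge> 0" using B norm_ge_zero order.trans by blast
  have zn: "norm (z n) \<le> \<rho> ^ n * B" for n
  proof (induction n)
    case (Suc n)
    have "norm (z (Suc n)) \<le> \<rho> * norm (z n)" by (rule contr)
    also have "\<dots> \<le> \<rho> * (\<rho> ^ n * B)" using Suc \<rho> by (intro mult_left_mono) auto
    finally show ?case by (simp add: mult_ac)
  qed (use B in auto)
  have E1: "E \<ge> 1" unfolding E_def using K B0 \<rho> by simp
  have *: "norm (of_real c ^ n * z n) \<le> norm (z 0) * exp (K * B * (\<Sum>i<n. \<rho> ^ i))" for n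
  proof (induction n)
    case (Suc n)
    have "norm (of_real c * z (Suc n)) \<le> norm (z n) + norm (of_real c * z (Suc n) - z n)"
      by (metis add.commute diff_add_cancel norm_triangle_ineq)
    also have "\<dots> \<le> norm (z n) + K * norm (z n) ^ 2" using quad by simp
    also have "\<dots> = norm (z n) * (1 + K * norm (z n))" by (simp add: algebra_simps power2_eq_square)
    also have "\<dots> \<le> norm (z n) * exp (K * B * \<rho> ^ n)"
    proof (intro mult_left_mono)
      have "K * norm (z n) \<le> K * (\<rho> ^ n * B)" using zn K by (intro mult_left_mono) auto
      hence "1 + K * norm (z n) \<le> 1 + K * B * \<rho> ^ n" by (simp add: mult_ac)
      also have "\<dots> \<le> exp (K * B * \<rho> ^ n)" by (rule exp_ge_add_one_self)
      finally show "1 + K * norm (z n) \<le> exp (K * B * \<rho> ^ n)" .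
    qed auto
    finally have 1: "norm (of_real c * z (Suc n)) \<le> norm (z n) * exp (K * B * \<rho> ^ n)" .
    have "norm (of_real c ^ Suc n * z (Suc n)) = c ^ n * norm (of_real c * z (Suc n))"
      using c by (simp add: norm_mult norm_power mult_ac)
    also have "\<dots> \<le> c ^ n * (norm (z n) * exp (K * B * \<rho> ^ n))"
      using 1 c by (intro mult_left_mono) auto
    also have "\<dots> = norm (of_real c ^ n * z n) * exp (K * B * \<rho> ^ n)"
      using c by (simp add: norm_mult norm_power mult_ac)
    also have "\<dots> \<le> norm (z 0) * exp (K * B * (\<Sum>i<n. \<rho> ^ i)) * exp (K * B * \<rho> ^ n)"
      using Suc by (intro mult_right_mono) auto
    also have "\<dots> = norm (z 0) * exp (K * B * (\<Sum>i<Suc n. \<rho> ^ i))"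
      by (simp add: exp_add[symmetric] algebra_simps)
    finally show ?case .
  qed auto
  show bd: "norm (of_real c ^ n * z n) \<le> norm (z 0) * E" for n
  proof -
    have "(\<Sum>i<n. \<rho> ^ i) \<le> (\<Sum>i. \<rho> ^ i)"
      using \<rho> by (intro sum_le_suminf summable_geometric) auto
    also have "\<dots> = 1 / (1 - \<rho>)" using \<rho> by (intro suminf_geometric) auto
    finally have "K * B * (\<Sum>i<n. \<rho> ^ i) \<le> K * B * (1 / (1 - \<rho>))"
      using K B0 by (intro mult_left_mono) auto
    hence "exp (K * B * (\<Sum>i<n. \<rho> ^ i)) \<le> E" by (simp add: E_def)
    thus ?thesis using *[of n] by (meson mult_left_mono norm_ge_zero order_trans)
  qed
  show st: "norm (of_real c ^ Suc n * z (Suc n) - of_real c ^ n * z n) \<le> K * (B * E) ^ 2 * (1 / c) ^ n" for n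
  proof -
    have "of_real c ^ Suc n * z (Suc n) - of_real c ^ n * z n = of_real c ^ n * (of_real c * z (Suc n) - z n)"
      by (simp add: algebra_simps)
    hence "norm (of_real c ^ Suc n * z (Suc n) - of_real c ^ n * z n) = c ^ n * norm (of_real c * z (Suc n) - z n)"
      using c by (simp add: norm_mult norm_power)
    also have "\<dots> \<le> c ^ n * (K * norm (z n) ^ 2)" using quad c by (intro mult_left_mono) auto
    also have "\<dots> = K * norm (of_real c ^ n * z n) ^ 2 * (1 / c) ^ n"
      using c by (simp add: norm_mult norm_power power_mult_distrib field_simps power2_eq_square)
    also have "\<dots> \<le> K * (B * E) ^ 2 * (1 / c) ^ n"
    proof -
      have "norm (of_real c ^ n * z n) \<le> B * E"
        using bd[of n] B E1 by (meson mult_right_mono order_trans zero_le_one)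
      thus ?thesis using K c by (intro mult_right_mono mult_left_mono power_mono) auto
    qed
    finally show ?thesis .
  qed
  have "summable (\<lambda>n. of_real c ^ Suc n * z (Suc n) - of_real c ^ n * z n)"
  proof (rule summable_comparison_test')
    show "summable (\<lambda>n. K * (B * E) ^ 2 * (1 / c) ^ n)"
      using c by (intro summable_mult summable_geometric) auto
  qed (use st in auto)
  hence "convergent (\<lambda>n. of_real c ^ n * z n - of_real c ^ 0 * z 0)"
    unfolding summable_iff_convergent sum_lessThan_telescope[of "\<lambda>n. of_real c ^ n * z n"] .
  thus "convergent (\<lambda>n. of_real c ^ n * z n)"
    by (simp only: convergent_diff_const_right_iff)
qed

context julia_poly
begin

lemma piece_image:
  assumes "j < N"
  shows "\<exists>l u. poly P ` {b j..b (Suc j)} = {l..u} \<and> l \<le> 0 \<and> \<beta> \<le> u"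
proof -
  have le: "b j \<le> b (Suc j)" using b_le assms by simp
  have "continuous_on {b j..b (Suc j)} (poly P)" by (intro continuous_intros)
  then obtain l u where lu: "poly P ` {b j..b (Suc j)} = {l..u}"
    using continuous_image_closed_interval[OF le] by blast
  have "poly P (b j) \<in> {l..u}" "poly P (b (Suc j)) \<in> {l..u}" unfolding lu[symmetric] using le by auto
  thus ?thesis using lu piece_left_end[OF assms] piece_right_end[OF assms]
    by (intro exI[of _ l] exI[of _ u]) (cases "increasing_piece j"; force)
qed

lemma I0_pieces: "I0 R = (\<Inter>j\<in>{..<N}. poly P ` {b j..b (Suc j)})"
proof -
  have "{1..N} = Suc ` {..<N}" by (simp add: image_Suc_lessThan)
  thus ?thesis unfolding I0_def deg piece_eq rmap_eq by simp
qed

text \<open>The right end of \<open>I0 R\<close>. It can exceed \<beta>, so z0 may lie outside the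
  hull; every branch maps [0, B] into [0, \<beta>].\<close>

definition B :: real where "B = Sup (I0 R)"

lemma I0_eq: "I0 R = {0..B}" and beta_le_B: "\<beta> \<le> B"
proof -
  have int: "compact (poly P ` {b j..b (Suc j)})" for j
    by (intro compact_continuous_image continuous_intros) auto
  have "\<forall>j\<in>{..<N}. \<exists>l u. poly P ` {b j..b (Suc j)} = {l..u} \<and> l \<le> 0 \<and> \<beta> \<le> u"
    using piece_image by auto
  then obtain l u where lu: "\<And>j. j < N \<Longrightarrow> poly P ` {b j..b (Suc j)} = {l j..u j}"
      "\<And>j. j < N \<Longrightarrow> l j \<le> 0" "\<And>j. j < N \<Longrightarrow> \<beta> \<le> u j"
    by (metis lessThan_iff)
  \<comment> \<open>P increases from P(0) = 0 on the first piece, which fixes the lower end of the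
    intersection.\<close>
  have l0: "l 0 = 0"
  proof -
    have "l 0 \<in> poly P ` {b 0..b (Suc 0)}"
      using lu[of 0] N2 beta_pos by auto
    then obtain x where x: "b 0 \<le> x" "x \<le> b (Suc 0)" "l 0 = poly P x" by auto
    have "poly P 0 \<le> poly P x"
      using increasing_strict[of 0 "b 0" x] increasing_piece_0 N2 x b_0 by (cases "x = 0") auto
    thus ?thesis using x P0 lu(2)[of 0] N2 by simp
  qed
  have fin: "finite (u ` {..<N})" "u ` {..<N} \<noteq> {}" using N2 by (auto simp: lessThan_empty_iff)
  have "I0 R = (\<Inter>j\<in>{..<N}. {l j..u j})" unfolding I0_pieces using lu by auto
  also have "\<dots> = {0..Min (u ` {..<N})}"
  proof (intro equalityI subsetI)
    fix x assume "x \<in> (\<Inter>j\<in>{..<N}. {l j..u j})"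
    thus "x \<in> {0..Min (u ` {..<N})}" using l0 fin N2 by (auto dest: bspec[of _ _ 0])
  next
    fix x assume "x \<in> {0..Min (u ` {..<N})}"
    hence x: "0 \<le> x" "\<And>j. j < N \<Longrightarrow> x \<le> u j" using fin by auto
    have "l j \<le> x" if "j < N" for j using lu(2)[OF that] x(1) by linarith
    thus "x \<in> (\<Inter>j\<in>{..<N}. {l j..u j})" using x by auto
  qed
  finally have I: "I0 R = {0..Min (u ` {..<N})}" .
  have m: "\<beta> \<le> Min (u ` {..<N})" using fin lu(3) by auto
  have "B = Min (u ` {..<N})" unfolding B_def I using m beta_pos by simp
  thus "I0 R = {0..B}" "\<beta> \<le> B" using I m by auto
qed

lemma B_pos: "B > 0" using beta_pos beta_le_B by simp

abbreviation \<phi> :: "nat \<Rightarrow> real \<Rightarrow> real" where "\<phi> j \<equiv> inv_branch R j"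

lemma inj_on_piece: "j < N \<Longrightarrow> inj_on (poly P) {b j..b (Suc j)}"
  unfolding inj_on_def using increasing_strict[of j] decreasing_strict[of j]
  by (metis atLeastAtMost_iff less_irrefl linorder_neqE)

lemma phi_mem:
  assumes "j \<in> {1..N}" "0 \<le> w" "w \<le> B"
  shows "b (j - 1) \<le> \<phi> j w" "\<phi> j w \<le> b j" "poly P (\<phi> j w) = w"
proof -
  have "w \<in> I0 R" using assms by (simp add: I0_eq)
  hence w: "w \<in> poly P ` {b (j - 1)..b j}" using assms(1) unfolding I0_def deg piece_eq rmap_eq by blast
  have "\<phi> j w \<in> {b (j - 1)..b j} \<and> poly P (\<phi> j w) = w"
    unfolding inv_branch_def piece_eq rmap_eq using inv_into_into[OF w] f_inv_into_f[OF w] by blast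
  thus "b (j - 1) \<le> \<phi> j w" "\<phi> j w \<le> b j" "poly P (\<phi> j w) = w" by auto
qed

lemma phi_eq:
  assumes "j \<in> {1..N}" "b (j - 1) \<le> x" "x \<le> b j"
  shows "\<phi> j (poly P x) = x"
  unfolding inv_branch_def piece_eq rmap_eq
  by (rule inv_into_f_f) (use inj_on_piece[of "j - 1"] assms in auto)

lemma phi_range:
  assumes "j \<in> {1..N}" "0 \<le> w" "w \<le> B"
  shows "0 \<le> \<phi> j w" "\<phi> j w \<le> \<beta>" "\<phi> j w \<le> B"
proof -
  have "j - 1 \<le> N" "j \<le> N" using assms by auto
  thus "0 \<le> \<phi> j w" "\<phi> j w \<le> \<beta>" "\<phi> j w \<le> B"
    using phi_mem[OF assms] b_nonneg[of j] b_nonneg[of "j - 1"] beta_le_B by auto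
qed

lemma phi_increasing:
  assumes "j \<in> {1..N}" "increasing_piece (j - 1)" "0 \<le> v" "v < w" "w \<le> B"
  shows "\<phi> j v < \<phi> j w"
proof (rule ccontr)
  assume "\<not> ?thesis"
  moreover have v: "b (j - 1) \<le> \<phi> j v" "\<phi> j v \<le> b j" "poly P (\<phi> j v) = v"
      and w: "b (j - 1) \<le> \<phi> j w" "\<phi> j w \<le> b j" "poly P (\<phi> j w) = w"
    using phi_mem[of j v] phi_mem[of j w] assms by auto
  moreover have "j - 1 < N" using assms(1) by auto
  ultimately show False
    using increasing_strict[of "j - 1" "\<phi> j w" "\<phi> j v"] assms(1,2,4) by (cases "\<phi> j w = \<phi> j v") auto
qed

lemma phi_decreasing:
  assumes "j \<in> {1..N}" "\<not> increasing_piece (j - 1)" "0 \<le> v" "v < w" "w \<le> B"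
  shows "\<phi> j w < \<phi> j v"
proof (rule ccontr)
  assume "\<not> ?thesis"
  moreover have v: "b (j - 1) \<le> \<phi> j v" "\<phi> j v \<le> b j" "poly P (\<phi> j v) = v"
      and w: "b (j - 1) \<le> \<phi> j w" "\<phi> j w \<le> b j" "poly P (\<phi> j w) = w"
    using phi_mem[of j v] phi_mem[of j w] assms by auto
  moreover have "j - 1 < N" using assms(1) by auto
  ultimately show False
    using decreasing_strict[of "j - 1" "\<phi> j v" "\<phi> j w"] assms(1,2,4) by (cases "\<phi> j w = \<phi> j v") auto
qed

lemma phi_continuous: "j \<in> {1..N} \<Longrightarrow> continuous_on {0..B} (\<phi> j)"
proof -
  assume j: "j \<in> {1..N}"
  have "continuous_on (poly P ` {b (j - 1)..b j}) (\<phi> j)"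
    by (rule continuous_on_inv) (use phi_eq[OF j] in \<open>auto intro!: continuous_intros\<close>)
  moreover have "{0..B} \<subseteq> poly P ` {b (j - 1)..b j}"
    using j unfolding I0_eq[symmetric] I0_def deg piece_eq rmap_eq by blast
  ultimately show ?thesis by (rule continuous_on_subset)
qed

text \<open>By the definition of B each piece reaches the value B, so the critical values avoid all
  of (0, B) and not just (0, \<beta>). Over this interval the N preimages are distinct.\<close>

lemma crit_value_outside:
  assumes "0 < j" "j < N" shows "poly P (b j) \<le> 0 \<or> B \<le> poly P (b j)"
proof (cases "increasing_piece (j - 1)")
  case True
  have "\<phi> j B \<le> b j" "poly P (\<phi> j B) = B" "b (j - 1) \<le> \<phi> j B" using phi_mem[of j B] assms B_pos by auto
  moreover have "j - 1 < N" using assms by simp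
  ultimately show ?thesis using increasing_strict[of "j - 1" "\<phi> j B" "b j"] True assms
    by (cases "\<phi> j B = b j") auto
next
  case False
  thus ?thesis using piece_right_end(2)[of "j - 1"] assms by simp
qed

lemma phi_strict_order:
  assumes "i \<in> {1..N}" "j \<in> {1..N}" "i < j" "0 < w" "w < B"
  shows "\<phi> i w < \<phi> j w"
proof -
  have 1: "\<phi> i w \<le> b i" "poly P (\<phi> i w) = w" using phi_mem[of i w] assms by auto
  moreover have "b i \<le> b (j - 1)" using b_le[of i "j - 1"] assms by auto
  moreover have "b (j - 1) \<le> \<phi> j w" using phi_mem[of j w] assms by auto
  moreover have "\<phi> i w \<noteq> b i" using crit_value_outside[of i] assms 1 by auto
  ultimately show ?thesis by linarith
qed

lemma inj_phi_index: "0 < w \<Longrightarrow> w < B \<Longrightarrow> inj_on (\<lambda>j. \<phi> j w) {1..N}"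
proof (rule inj_onI)
  fix i j assume w: "0 < w" "w < B" and ij: "i \<in> {1..N}" "j \<in> {1..N}" "\<phi> i w = \<phi> j w"
  show "i = j"
    using phi_strict_order[OF ij(1,2) _ w] phi_strict_order[OF ij(2,1) _ w] ij(3)
    by (cases i j rule: linorder_cases) auto
qed

lemma poly_factor_aux:
  assumes "0 < w" "w < B"
  shows "poly R z - of_real w = lead_coeff R * (\<Prod>j\<in>{1..N}. z - of_real (\<phi> j w))"
proof -
  define A where "A = (\<lambda>j. complex_of_real (\<phi> j w)) ` {1..N}"
  have inj: "inj_on (\<lambda>j. complex_of_real (\<phi> j w)) {1..N}"
    by (rule inj_onI) (use inj_onD[OF inj_phi_index[OF assms]] in \<open>simp only: of_real_eq_iff\<close>)
  have degp: "degree (\<Prod>j\<in>{1..N}. [:- complex_of_real (\<phi> j w), 1:]) = N"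
    by (subst degree_prod_sum_eq) auto
  have "R - [:of_real w:] = smult (lead_coeff R) (\<Prod>j\<in>{1..N}. [:- of_real (\<phi> j w), 1:])"
  proof (rule poly_eqI_degree_lead_coeff[of _ N _ A])
    have "coeff (\<Prod>j\<in>{1..N}. [:- complex_of_real (\<phi> j w), 1:]) N = lead_coeff (\<Prod>j\<in>{1..N}. [:- complex_of_real (\<phi> j w), 1:])"
      using degp by simp
    also have "\<dots> = 1" by (simp add: lead_coeff_prod)
    finally show "coeff (R - [:of_real w:]) N = coeff (smult (lead_coeff R) (\<Prod>j\<in>{1..N}. [:- of_real (\<phi> j w), 1:])) N"
      using N2 by (simp add: deg coeff_pCons split: nat.splits)
    show "card A \<ge> N" using inj by (simp add: A_def card_image)
    show "degree (R - [:of_real w:]) \<le> N" by (rule degree_diff_le) (use deg in auto)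
    show "degree (smult (lead_coeff R) (\<Prod>j\<in>{1..N}. [:- of_real (\<phi> j w), 1:])) \<le> N"
      using degp by (intro order.trans[OF degree_smult_le]) simp
    fix z assume "z \<in> A"
    then obtain j where j: "j \<in> {1..N}" "z = of_real (\<phi> j w)" by (auto simp: A_def)
    hence "(\<Prod>j\<in>{1..N}. z - complex_of_real (\<phi> j w)) = 0" by (intro prod_zero) auto
    moreover have "poly R z = of_real w" using phi_mem(3)[of j w] j assms by (simp add: poly_P)
    ultimately show "poly (R - [:of_real w:]) z = poly (smult (lead_coeff R) (\<Prod>j\<in>{1..N}. [:- of_real (\<phi> j w), 1:])) z"
      by (simp add: poly_prod)
  qed
  hence "poly (R - [:of_real w:]) z = poly (smult (lead_coeff R) (\<Prod>j\<in>{1..N}. [:- of_real (\<phi> j w), 1:])) z" by simp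
  thus ?thesis by (simp add: poly_prod)
qed

text \<open>Multiple preimages only occur over the end points of \<open>I0 R\<close>, which are reached by continuity.\<close>

lemma poly_factor:
  assumes "0 \<le> w" "w \<le> B"
  shows "poly R z - of_real w = lead_coeff R * (\<Prod>j\<in>{1..N}. z - of_real (\<phi> j w))"
proof -
  define f where "f w = poly R z - of_real w - lead_coeff R * (\<Prod>j\<in>{1..N}. z - of_real (\<phi> j w))" for w
  have cl: "closure {0<..<B} = {0..B}" using B_pos by simp
  have "continuous_on {0..B} f" unfolding f_def
    by (intro continuous_intros phi_continuous) auto
  hence "f w = 0"
    using continuous_constant_on_closure[of "{0<..<B}" f 0 w] poly_factor_aux assms
    unfolding cl by (auto simp: f_def)
  thus ?thesis by (simp add: f_def)
qed

text \<open>\<open>logderiv_sign\<close> applied to P', all of whose roots lie to the right of x: P'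
  and P'' have opposite signs there. The resulting concavity of P on the first piece is the source
  of the linear bounds for S and of the convexity of \<K>.\<close>

lemma pderiv_factor_0: "poly (pderiv P) x > 0 \<Longrightarrow> x < b 1 \<Longrightarrow> poly (pderiv (pderiv P)) x < 0"
proof -
  assume x: "poly (pderiv P) x > 0" "x < b 1"
  define q where "q = (\<Prod>a\<in>#mset_set crit. [:- a, 1:])"
  define k where "k = of_nat N * lead_coeff P"
  have P': "pderiv P = smult k q" unfolding k_def q_def
    by (subst pderiv_P_factor) (simp add: prod_unfold_prod_mset)
  hence P'': "pderiv (pderiv P) = smult k (pderiv q)" by (simp add: pderiv_smult)
  have "x \<le> a" if "a \<in># mset_set crit" for a
  proof -
    obtain j where "0 < j" "j < N" "a = b j" using crit_b[of a] \<open>a \<in># mset_set crit\<close> finite_crit by auto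
    thus ?thesis using b_le[of 1 j] x by simp
  qed
  moreover have "crit \<noteq> {}" using card_crit N2 by auto
  ultimately have "poly (pderiv q) x * poly q x < 0"
    using logderiv_sign(2)[of "mset_set crit" x] x(1) P' finite_crit unfolding q_def
    by (auto simp: mset_set_empty_iff)
  moreover have "k \<noteq> 0" using N2 P_nz by (simp add: k_def)
  ultimately have "k ^ 2 * (poly (pderiv q) x * poly q x) < 0" by (simp add: mult_less_0_iff)
  hence "poly (pderiv P) x * poly (pderiv (pderiv P)) x < 0"
    unfolding P'' unfolding P' by (simp add: power2_eq_square mult_ac)
  thus ?thesis using x by (simp add: mult_less_0_iff)
qed

lemma P'_pos: "0 \<le> x \<Longrightarrow> x < b 1 \<Longrightarrow> poly (pderiv P) x > 0"
  using increasing_piece_0 b_0 P'0 c1 by (cases "x = 0") (auto simp: increasing_piece_def)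

lemma P_concave: "convex_on {0..b 1} (\<lambda>x. - poly P x)"
proof (rule f''_ge0_imp_convex)
  fix x assume x: "x \<in> {0..b 1}"
  show "((\<lambda>x. - poly P x) has_real_derivative - poly (pderiv P) x) (at x)"
    by (intro derivative_intros poly_DERIV)
  show "((\<lambda>x. - poly (pderiv P) x) has_real_derivative - poly (pderiv (pderiv P)) x) (at x)"
    by (intro derivative_intros poly_DERIV)
  show "0 \<le> - poly (pderiv (pderiv P)) x"
  proof (cases "x = b 1")
    case False
    thus ?thesis using pderiv_factor_0[of x] P'_pos[of x] x by force
  next
    \<comment> \<open>At the right end P' vanishes; there the sign of P'' comes from the critical
      value, which is positive.\<close>
    case True
    have cr: "b 1 \<in> crit" using b_crit N2 by simp
    have "\<beta> \<le> poly P (b 1)" using piece_right_end(1)[of 0] increasing_piece_0 N2 by simp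
    thus ?thesis using crit_value(2)[OF cr] beta_pos True by force
  qed
qed simp

lemma b1_pos: "0 < b 1" using b_less[of 0 1] b_0 N2 by simp
lemma b1_less: "b 1 < \<beta>" using b_less[of 1 N] b_N N2 by simp

lemma P_le_linear: "0 \<le> x \<Longrightarrow> x \<le> b 1 \<Longrightarrow> poly P x \<le> c * x"
proof -
  assume x: "0 \<le> x" "x \<le> b 1"
  show ?thesis
  proof (cases "x = 0")
    case False
    then obtain u where u: "0 < u" "u < x" "poly P x - poly P 0 = (x - 0) * poly (pderiv P) u"
      using poly_MVT[of 0 x P] x by auto
    obtain v where v: "0 < v" "v < u" "poly (pderiv P) u - poly (pderiv P) 0 = (u - 0) * poly (pderiv (pderiv P)) v"
      using poly_MVT[of 0 u "pderiv P"] u by auto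
    have "poly (pderiv (pderiv P)) v < 0" using pderiv_factor_0 P'_pos u v x by simp
    hence "poly (pderiv P) u \<le> c" using v u P'0 by (smt (verit) mult_pos_neg)
    hence "x * poly (pderiv P) u \<le> x * c" using x by (intro mult_left_mono) auto
    thus ?thesis using u by (simp add: P0 mult_ac)
  qed (simp add: P0)
qed

text \<open>Concavity puts P above the chord from the origin to (b 1, P(b 1)), whose slope is at
  least \<beta> / b 1 > 1; so S contracts towards 0 with the factor b 1 / \<beta>.\<close>

lemma P_ge_linear: "0 \<le> x \<Longrightarrow> x \<le> b 1 \<Longrightarrow> (\<beta> / b 1) * x \<le> poly P x"
proof -
  assume x: "0 \<le> x" "x \<le> b 1"
  define t where "t = x / b 1"
  have t: "0 \<le> t" "t \<le> 1" "x = t * b 1" using x b1_pos by (auto simp: t_def)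
  have "- poly P ((1 - t) *\<^sub>R 0 + t *\<^sub>R b 1) \<le> (1 - t) * (- poly P 0) + t * (- poly P (b 1))"
    using b1_pos t by (intro convex_onD[OF P_concave]) auto
  hence "t * poly P (b 1) \<le> poly P x" using t by (simp add: P0)
  moreover have "t * \<beta> \<le> t * poly P (b 1)"
    using piece_right_end(1)[of 0] increasing_piece_0 N2 t by (intro mult_left_mono) auto
  ultimately show ?thesis by (simp add: t_def mult.commute)
qed

abbreviation S :: "real \<Rightarrow> real" where "S \<equiv> \<phi> (Suc 0)"

lemma S_mem: assumes "0 \<le> w" "w \<le> B" shows "0 \<le> S w" "S w \<le> b 1" "poly P (S w) = w" "S w \<le> B"
  using phi_mem[of 1 w] phi_range[of 1 w] assms N2 b_0 by auto

lemma S_lower: "0 \<le> w \<Longrightarrow> w \<le> B \<Longrightarrow> w \<le> c * S w"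
  using P_le_linear[of "S w"] S_mem[of w] by simp

lemma S_upper: "0 \<le> w \<Longrightarrow> w \<le> B \<Longrightarrow> S w \<le> (b 1 / \<beta>) * w"
  using P_ge_linear[of "S w"] S_mem[of w] b1_pos beta_pos by (simp add: field_simps)

lemma S_mono: "0 \<le> v \<Longrightarrow> v \<le> w \<Longrightarrow> w \<le> B \<Longrightarrow> S v \<le> S w"
  using phi_increasing[of 1 v w] increasing_piece_0 N2 by (cases "v = w") auto

text \<open>S is the inverse of an increasing concave function. Convexity passes to \<K> and later
  provides a Lipschitz bound for it away from the right end of the hull.\<close>

lemma S_convex: "convex_on {0..B} S"
proof (rule convex_onI)
  fix t u v :: real assume t: "0 < t" "t < 1" and uv: "u \<in> {0..B}" "v \<in> {0..B}"
  have w: "(1 - t) * u + t * v \<in> {0..B}"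
    using convexD_alt[of "{0..B}" u v t] t uv by simp
  have s: "(1 - t) * S u + t * S v \<in> {0..b 1}"
    using convexD_alt[of "{0..b 1}" "S u" "S v" t] t uv S_mem[of u] S_mem[of v] by simp
  have "- poly P ((1 - t) *\<^sub>R S u + t *\<^sub>R S v) \<le> (1 - t) * (- poly P (S u)) + t * (- poly P (S v))"
    using t uv S_mem[of u] S_mem[of v] by (intro convex_onD[OF P_concave]) auto
  hence le: "poly P (S ((1 - t) * u + t * v)) \<le> poly P ((1 - t) * S u + t * S v)"
    using uv w S_mem by simp
  show "S ((1 - t) *\<^sub>R u + t *\<^sub>R v) \<le> (1 - t) * S u + t * S v"
  proof (rule ccontr)
    assume "\<not> ?thesis"
    hence "poly P ((1 - t) * S u + t * S v) < poly P (S ((1 - t) * u + t * v))"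
      using s w S_mem[of "(1 - t) * u + t * v"] N2 increasing_piece_0 b_0
      by (intro increasing_strict[of 0]) auto
    thus False using le by simp
  qed
qed simp

lemma quad_bound: "\<exists>K\<ge>0. \<forall>z. norm z \<le> r \<longrightarrow> norm (poly R z - of_real c * z) \<le> K * norm z ^ 2"
proof -
  obtain Q where Q: "R = pCons 0 Q" using R0 by (cases R) auto
  obtain c' T where T: "Q = pCons c' T" by (cases Q)
  have c': "c' = of_real c" using R'0 by (simp add: Q T pderiv_pCons)
  have "compact (poly T ` cball 0 r)" by (intro compact_continuous_image continuous_intros) auto
  then obtain K where K: "K > 0" "\<And>z. norm z \<le> r \<Longrightarrow> norm (poly T z) \<le> K"
    using compact_imp_bounded bounded_pos by (metis (no_types, lifting) imageI mem_cball_0)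
  have "norm (poly R z - of_real c * z) \<le> K * norm z ^ 2" if "norm z \<le> r" for z
  proof -
    have "poly R z - of_real c * z = poly T z * z ^ 2"
      by (simp add: Q T c' algebra_simps power2_eq_square)
    thus ?thesis using K(2)[OF that] by (simp add: norm_mult norm_power mult_right_mono)
  qed
  thus ?thesis using K(1) by (intro exI[of _ K]) auto
qed

section \<open>Koenigs approximants and their limit\<close>

definition Kn :: "nat \<Rightarrow> real \<Rightarrow> real" where "Kn n x = c ^ n * (S ^^ n) x"

lemma S_pow_mem: "0 \<le> w \<Longrightarrow> w \<le> B \<Longrightarrow> 0 \<le> (S ^^ n) w \<and> (S ^^ n) w \<le> B"
  by (induction n) (auto simp: S_mem)

lemma koenigs_constants:
  obtains E where "E \<ge> 1" "\<And>n x. 0 \<le> x \<Longrightarrow> x \<le> B \<Longrightarrow> Kn n x \<le> x * E"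
    "\<And>x. 0 \<le> x \<Longrightarrow> x \<le> B \<Longrightarrow> convergent (\<lambda>n. Kn n x)"
proof -
  obtain K where K: "K \<ge> 0" "\<And>z. norm z \<le> B \<Longrightarrow> norm (poly R z - of_real c * z) \<le> K * norm z ^ 2"
    using quad_bound[of B] by blast
  define \<rho> where "\<rho> = b 1 / \<beta>"
  have \<rho>: "0 \<le> \<rho>" "\<rho> < 1" using b1_pos b1_less beta_pos by (auto simp: \<rho>_def)
  define E where "E = exp (K * B / (1 - \<rho>))"
  have *: "Kn n x \<le> x * E \<and> convergent (\<lambda>n. Kn n x)" if x: "0 \<le> x" "x \<le> B" for n x
  proof -
    have contr: "norm ((S ^^ Suc n) x) \<le> \<rho> * norm ((S ^^ n) x)" for n
      using S_upper[of "(S ^^ n) x"] S_pow_mem[OF x, of n] S_pow_mem[OF x, of "Suc n"] by (simp add: \<rho>_def)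
    have quad: "norm (of_real c * (S ^^ Suc n) x - (S ^^ n) x) \<le> K * norm ((S ^^ n) x) ^ 2" for n
    proof -
      define y where "y = (S ^^ n) x"
      have y: "0 \<le> y" "y \<le> B" using S_pow_mem[OF x] by (auto simp: y_def)
      have "norm (poly R (of_real (S y)) - of_real c * of_real (S y)) \<le> K * norm (complex_of_real (S y)) ^ 2"
        using S_mem[OF y] by (intro K) auto
      moreover have "poly R (of_real (S y)) - of_real c * of_real (S y) = of_real (y - c * S y)"
        using S_mem[OF y] by (simp add: poly_P)
      ultimately have "\<bar>y - c * S y\<bar> \<le> K * \<bar>S y\<bar> ^ 2" by (simp only: norm_of_real)
      also have "\<dots> \<le> K * \<bar>y\<bar> ^ 2"
      proof -
        have "S y \<le> \<rho> * y" using S_upper[OF y] by (simp add: \<rho>_def)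
        also have "\<dots> \<le> y" using \<rho> y by (simp add: mult_left_le_one_le)
        finally show ?thesis using K(1) S_mem[OF y] by (intro mult_left_mono power_mono) auto
      qed
      finally show ?thesis by (simp add: y_def abs_minus_commute)
    qed
    have "norm (of_real c ^ n * (S ^^ n) x) \<le> norm ((S ^^ 0) x) * E"
      unfolding E_def by (rule koenigs_sequence(1)[where z="\<lambda>n. (S ^^ n) x", OF c1 \<rho> K(1) _ contr quad]) (use x in auto)
    moreover have "convergent (\<lambda>n. of_real c ^ n * (S ^^ n) x)"
      by (rule koenigs_sequence(3)[where z="\<lambda>n. (S ^^ n) x" and B=B, OF c1 \<rho> K(1) _ contr quad]) (use x in auto)
    ultimately show ?thesis using x by (simp add: Kn_def)
  qed
  have "E \<ge> 1" unfolding E_def using K(1) \<rho> B_pos by simp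
  thus ?thesis using that * by blast
qed

definition E :: real where
  "E = (SOME E. E \<ge> 1 \<and> (\<forall>n x. 0 \<le> x \<longrightarrow> x \<le> B \<longrightarrow> Kn n x \<le> x * E))"

lemma E: "E \<ge> 1" and Kn_upper: "0 \<le> x \<Longrightarrow> x \<le> B \<Longrightarrow> Kn n x \<le> x * E"
proof -
  have "\<exists>E. E \<ge> 1 \<and> (\<forall>n x. 0 \<le> x \<longrightarrow> x \<le> B \<longrightarrow> Kn n x \<le> x * E)" using koenigs_constants by metis
  from someI_ex[OF this] show "E \<ge> 1" "0 \<le> x \<Longrightarrow> x \<le> B \<Longrightarrow> Kn n x \<le> x * E" unfolding E_def by auto
qed

lemma Kn_lower: "0 \<le> x \<Longrightarrow> x \<le> B \<Longrightarrow> x \<le> Kn n x"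
proof (induction n)
  case (Suc n)
  have "(S ^^ n) x \<le> c * S ((S ^^ n) x)" using S_lower S_pow_mem Suc.prems by simp
  hence "c ^ n * (S ^^ n) x \<le> c ^ n * (c * S ((S ^^ n) x))" using c1 by (intro mult_left_mono) auto
  thus ?case using Suc by (simp add: Kn_def mult_ac)
qed (simp add: Kn_def)

lemma Kn_mono: "0 \<le> x \<Longrightarrow> x \<le> y \<Longrightarrow> y \<le> B \<Longrightarrow> Kn n x \<le> Kn n y"
proof -
  assume xy: "0 \<le> x" "x \<le> y" "y \<le> B"
  have "(S ^^ n) x \<le> (S ^^ n) y"
  proof (induction n)
    case (Suc n)
    thus ?case using S_mono S_pow_mem[of x n] S_pow_mem[of y n] xy by simp
  qed (use xy in auto)
  thus ?thesis using c1 by (simp add: Kn_def)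
qed

lemma Kn_convex: "convex_on {0..B} (Kn n)"
proof -
  have "convex_on {0..B} (S ^^ n)"
  proof (induction n)
    case 0
    thus ?case by (simp add: convex_on_def)
  next
    case (Suc n)
    show ?case
    proof (rule convex_onI)
      fix t u v :: real assume t: "0 < t" "t < 1" and uv: "u \<in> {0..B}" "v \<in> {0..B}"
      have w: "(1 - t) *\<^sub>R u + t *\<^sub>R v \<in> {0..B}" using convexD_alt[of "{0..B}" u v t] t uv by simp
      have m: "(S ^^ n) u \<in> {0..B}" "(S ^^ n) v \<in> {0..B}" "(S ^^ n) ((1 - t) *\<^sub>R u + t *\<^sub>R v) \<in> {0..B}"
        using S_pow_mem uv w by auto
      have w': "(1 - t) *\<^sub>R (S ^^ n) u + t *\<^sub>R (S ^^ n) v \<in> {0..B}"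
        using convexD_alt[of "{0..B}" "(S ^^ n) u" "(S ^^ n) v" t] t m by simp
      have "S ((S ^^ n) ((1 - t) *\<^sub>R u + t *\<^sub>R v)) \<le> S ((1 - t) *\<^sub>R (S ^^ n) u + t *\<^sub>R (S ^^ n) v)"
        using m w' convex_onD[OF Suc, of t u v] t uv by (intro S_mono) auto
      also have "\<dots> \<le> (1 - t) * S ((S ^^ n) u) + t * S ((S ^^ n) v)"
        using m t by (intro convex_onD[OF S_convex]) auto
      finally show "(S ^^ Suc n) ((1 - t) *\<^sub>R u + t *\<^sub>R v) \<le> (1 - t) * (S ^^ Suc n) u + t * (S ^^ Suc n) v"
        by simp
    qed simp
  qed
  thus ?thesis unfolding Kn_def using c1 by (intro convex_on_cmul) auto
qed

abbreviation \<K> :: "real \<Rightarrow> real" where "\<K> \<equiv> koenigs R"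

lemma Kn_tendsto: assumes "0 \<le> x" "x \<le> B" shows "(\<lambda>n. Kn n x) \<longlonglongrightarrow> \<K> x"
proof -
  have "convergent (\<lambda>n. Kn n x)" using koenigs_constants assms by metis
  thus ?thesis by (simp add: koenigs_def multiplier_eq Kn_def convergent_LIMSEQ_iff)
qed

lemma koenigs_lower: "0 \<le> x \<Longrightarrow> x \<le> B \<Longrightarrow> x \<le> \<K> x"
  by (rule LIMSEQ_le_const[OF Kn_tendsto]) (auto intro: Kn_lower)

lemma koenigs_upper: "0 \<le> x \<Longrightarrow> x \<le> B \<Longrightarrow> \<K> x \<le> x * E"
  by (rule LIMSEQ_le_const2[OF Kn_tendsto]) (auto intro: Kn_upper)

lemma koenigs_mono: "0 \<le> x \<Longrightarrow> x \<le> y \<Longrightarrow> y \<le> B \<Longrightarrow> \<K> x \<le> \<K> y"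
  by (rule LIMSEQ_le[OF Kn_tendsto Kn_tendsto]) (auto intro: Kn_mono)

lemma koenigs_0: "\<K> 0 = 0"
  using koenigs_lower[of 0] koenigs_upper[of 0] B_pos by simp

lemma koenigs_convex: "convex_on {0..B} \<K>"
proof (rule convex_onI)
  fix t u v :: real assume t: "0 < t" "t < 1" and uv: "u \<in> {0..B}" "v \<in> {0..B}"
  have w: "(1 - t) *\<^sub>R u + t *\<^sub>R v \<in> {0..B}" using convexD_alt[of "{0..B}" u v t] t uv by simp
  show "\<K> ((1 - t) *\<^sub>R u + t *\<^sub>R v) \<le> (1 - t) * \<K> u + t * \<K> v"
  proof (rule LIMSEQ_le)
    show "(\<lambda>n. Kn n ((1 - t) *\<^sub>R u + t *\<^sub>R v)) \<longlonglongrightarrow> \<K> ((1 - t) *\<^sub>R u + t *\<^sub>R v)"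
      using w by (intro Kn_tendsto) auto
    show "(\<lambda>n. (1 - t) * Kn n u + t * Kn n v) \<longlonglongrightarrow> (1 - t) * \<K> u + t * \<K> v"
      using uv by (intro tendsto_intros Kn_tendsto) auto
    show "\<exists>N. \<forall>n\<ge>N. Kn n ((1 - t) *\<^sub>R u + t *\<^sub>R v) \<le> (1 - t) * Kn n u + t * Kn n v"
      using convex_onD[OF Kn_convex] t uv by auto
  qed
qed simp

lemma koenigs_S: "0 \<le> x \<Longrightarrow> x \<le> B \<Longrightarrow> \<K> x = c * \<K> (S x)"
proof -
  assume x: "0 \<le> x" "x \<le> B"
  have "(\<lambda>n. Kn (Suc n) x) \<longlonglongrightarrow> \<K> x" using Kn_tendsto[OF x] by (rule LIMSEQ_Suc)
  moreover have "Kn (Suc n) x = c * Kn n (S x)" for n by (simp add: Kn_def funpow_swap1)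
  moreover have "(\<lambda>n. c * Kn n (S x)) \<longlonglongrightarrow> c * \<K> (S x)"
    using S_mem[OF x] by (intro tendsto_intros Kn_tendsto) auto
  ultimately show ?thesis using LIMSEQ_unique by auto
qed

section \<open>The zeta function as a series over word sums\<close>

text \<open>The m-th power of the transfer operator that sends h to the sum of all h o \<phi> j; the
  recursion peels off the letter applied to y first.\<close>

primrec wsum :: "nat \<Rightarrow> (real \<Rightarrow> complex) \<Rightarrow> real \<Rightarrow> complex" where
  "wsum 0 h y = h y"
| "wsum (Suc m) h y = (\<Sum>j=1..N. wsum m h (\<phi> j y))"

text \<open>Every interval [0, e] with \<beta> \<le> e \<le> B is invariant under the branches. Both
  extremes occur: e = B for the series at z0, e = \<beta> where functions are controlled on the hull
  only.\<close>

lemma phi_interval: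
  assumes "\<beta> \<le> e" "e \<le> B" "j \<in> {1..N}" "0 \<le> x" "x \<le> e"
  shows "0 \<le> \<phi> j x \<and> \<phi> j x \<le> e"
  using phi_range[of j x] assms by (auto intro: order_trans)

lemma wsum_cong:
  assumes e: "\<beta> \<le> e" "e \<le> B"
    and h: "\<And>x. 0 \<le> x \<Longrightarrow> x \<le> e \<Longrightarrow> h x = h' x" and y: "0 \<le> y" "y \<le> e"
  shows "wsum m h y = wsum m h' y"
  using y
proof (induction m arbitrary: y)
  case (Suc m)
  have "wsum m h (\<phi> j y) = wsum m h' (\<phi> j y)" if "j \<in> {1..N}" for j
    using Suc phi_interval[OF e that, of y] by auto
  thus ?case by simp
qed (use h in auto)

text \<open>The other recursion, at the letter applied last, so that an induction can vary h instead
  of y.\<close>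

lemma wsum_Suc_inner: "wsum (Suc m) h y = wsum m (\<lambda>x. \<Sum>j=1..N. h (\<phi> j x)) y"
proof (induction m arbitrary: y)
  case (Suc m)
  show ?case unfolding wsum.simps(2)[of "Suc m"] wsum.simps(2)[of m "\<lambda>x. \<Sum>j=1..N. h (\<phi> j x)"]
    by (intro sum.cong refl Suc)
qed simp

lemma wsum_add: "wsum m (\<lambda>x. h x + h' x) y = wsum m h y + wsum m h' y"
  by (induction m arbitrary: y) (auto simp: sum.distrib)

lemma wsum_mult: "wsum m (\<lambda>x. k * h x) y = k * wsum m h y"
  by (induction m arbitrary: y) (auto simp: sum_distrib_left)

lemma wsum_norm_le:
  assumes e: "\<beta> \<le> e" "e \<le> B"
    and h: "\<And>x. 0 \<le> x \<Longrightarrow> x \<le> e \<Longrightarrow> norm (h x) \<le> M" and y: "0 \<le> y" "y \<le> e"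
  shows "norm (wsum m h y) \<le> real N ^ m * M"
  using y
proof (induction m arbitrary: y)
  case (Suc m)
  have "norm (wsum (Suc m) h y) \<le> (\<Sum>j=1..N. norm (wsum m h (\<phi> j y)))"
    by (simp add: sum_norm_le)
  also have "\<dots> \<le> (\<Sum>j=1..N. real N ^ m * M)"
    using Suc phi_interval[OF e, of _ y] by (intro sum_mono) auto
  finally show ?case by (simp add: mult_ac)
qed (use h in auto)

lemma wsum_tendsto:
  assumes "\<And>x. 0 \<le> x \<Longrightarrow> x \<le> B \<Longrightarrow> ((\<lambda>n. h n x) \<longlongrightarrow> h' x) F" "0 \<le> y" "y \<le> B"
  shows "((\<lambda>n. wsum m (h n) y) \<longlongrightarrow> wsum m h' y) F"
  using assms(2,3)
proof (induction m arbitrary: y)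
  case (Suc m)
  show ?case unfolding wsum.simps
    by (intro tendsto_sum Suc.IH) (use phi_range[of _ y] Suc in auto)
qed (use assms(1) in auto)

lemma wsum_holomorphic:
  assumes e: "\<beta> \<le> e" "e \<le> B"
    and h: "\<And>x. 0 \<le> x \<Longrightarrow> x \<le> e \<Longrightarrow> (\<lambda>s. h s x) holomorphic_on A" and y: "0 \<le> y" "y \<le> e"
  shows "(\<lambda>s. wsum m (h s) y) holomorphic_on A"
  using y
proof (induction m arbitrary: y)
  case (Suc m)
  show ?case unfolding wsum.simps
    by (intro holomorphic_on_sum Suc.IH) (use phi_interval[OF e, of _ y] Suc in auto)
qed (use h in auto)

lemma degree_iter_poly: "degree (iter_poly R n) = N ^ n"
  by (induction n) (auto simp: iter_poly_def degree_pcompose deg)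

lemma iter_poly_minus_nz: "iter_poly R n - [:v:] \<noteq> 0"
proof
  assume "iter_poly R n - [:v:] = 0"
  hence "degree (iter_poly R n) = 0" by simp
  thus False using N2 by (simp add: degree_iter_poly)
qed

text \<open>R^(n+1) - w is, up to a constant, the product over the branches of R^n - \<phi> j w.
  \<open>proots\<close> turns the product into a sum, so multiplicities agree with the counting of
  words.\<close>

lemma sum_proots_iter:
  assumes "0 \<le> w" "w \<le> B"
  shows "(\<Sum>z\<in>#proots (iter_poly R n - [:of_real w:]). f z) = wsum n (\<lambda>x. f (of_real x)) w"
  using assms
proof (induction n arbitrary: w)
  case 0
  have "iter_poly R 0 - [:of_real w:] = [:- of_real w, 1:]" by (simp add: iter_poly_def)
  thus ?case by simp
next
  case (Suc n)
  have "iter_poly R (Suc n) - [:of_real w:] =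
      smult (lead_coeff R) (\<Prod>j\<in>{1..N}. (iter_poly R n - [:of_real (\<phi> j w):]))"
  proof (rule poly_eq_poly_eq_iff[THEN iffD1, OF ext])
    fix x
    have "poly (iter_poly R (Suc n) - [:of_real w:]) x = poly R (poly (iter_poly R n) x) - of_real w"
      by (simp add: iter_poly_def poly_pcompose)
    also have "\<dots> = lead_coeff R * (\<Prod>j\<in>{1..N}. poly (iter_poly R n) x - of_real (\<phi> j w))"
      by (rule poly_factor) (use Suc in auto)
    finally show "poly (iter_poly R (Suc n) - [:of_real w:]) x =
      poly (smult (lead_coeff R) (\<Prod>j\<in>{1..N}. (iter_poly R n - [:of_real (\<phi> j w):]))) x"
      by (simp add: poly_prod)
  qed
  hence "proots (iter_poly R (Suc n) - [:of_real w:]) = (\<Sum>j\<in>{1..N}. proots (iter_poly R n - [:of_real (\<phi> j w):]))"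
    using R_nz iter_poly_minus_nz by (simp add: proots_prod)
  moreover have "(\<Sum>z\<in>#(\<Sum>j\<in>J. p j). f z) = (\<Sum>j\<in>J. \<Sum>z\<in>#p j. f z)" if "finite J"
    for J :: "nat set" and p
    using that by (induction J) auto
  ultimately show ?case using Suc phi_range[of _ w] by simp
qed

text \<open>The outermost letter 1 is left out, so h is evaluated only in [b 1, \<beta>], away from
  the zero of \<K> at 0.\<close>

definition outer :: "(real \<Rightarrow> complex) \<Rightarrow> real \<Rightarrow> complex" where
  "outer h x = (\<Sum>j=2..N. h (\<phi> j x))"

lemma zeta_partial_wsum:
  assumes "0 \<le> z0" "z0 \<le> B"
  shows "zeta_partial R z0 n s = wsum n (\<lambda>x. of_real (c ^ n * x) powr (- s / 2)) z0"
proof -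
  define f where "f z = (complex_of_real (c ^ n) * z) powr (- s / 2)" for z
  \<comment> \<open>Since \<open>0 powr _\<close> is 0, the removed root 0 contributes nothing, and
    the sum extends over all words.\<close>
  have f0: "f 0 = 0" by (simp add: f_def)
  have "(\<Sum>z\<in>#filter_mset (\<lambda>z. z \<noteq> 0) A. f z) = (\<Sum>z\<in>#A. f z)" for A
    by (induction A) (auto simp: f0)
  hence "zeta_partial R z0 n s = (\<Sum>z\<in>#proots (iter_poly R n - [:of_real z0:]). f z)"
    unfolding zeta_partial_def multiplier_eq f_def by simp
  also have "\<dots> = wsum n (\<lambda>x. f (of_real x)) z0" by (rule sum_proots_iter[OF assms])
  finally show ?thesis by (simp add: f_def)
qed

text \<open>Words are sorted by the number of leading letters 1.\<close>

lemma wsum_leading_ones: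
  "wsum n f y = (\<Sum>k<n. wsum (n - 1 - k) (outer (\<lambda>x. f ((S ^^ k) x))) y) + f ((S ^^ n) y)"
proof (induction n arbitrary: f)
  case (Suc n)
  have split: "(\<Sum>j=1..N. f (\<phi> j x)) = f (S x) + outer f x" for x
    using N2 by (simp add: sum.atLeast_Suc_atMost outer_def numeral_2_eq_2)
  have "wsum (Suc n) f y = wsum n (\<lambda>x. f (S x)) y + wsum n (outer f) y"
    unfolding wsum_Suc_inner split wsum_add ..
  also have "wsum n (\<lambda>x. f (S x)) y = (\<Sum>k<n. wsum (n - 1 - k) (outer (\<lambda>x. f (S ((S ^^ k) x)))) y) + f (S ((S ^^ n) y))"
    by (rule Suc)
  also have "\<dots> + wsum n (outer f) y =
      (\<Sum>k<Suc n. wsum (Suc n - 1 - k) (outer (\<lambda>x. f ((S ^^ k) x))) y) + f ((S ^^ Suc n) y)"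
    unfolding sum.lessThan_Suc_shift by simp
  finally show ?case .
qed simp

definition g :: "complex \<Rightarrow> real \<Rightarrow> complex" where "g s x = of_real (\<K> x) powr (- s / 2)"

text \<open>With the denominator N^(m+1), each word of length m + 1 whose outermost letter is not 1
  has the weight that \<kappa> gives to its cylinder; so the limit is the integral
  \<open>xi_fun R s\<close> itself.\<close>

definition av :: "nat \<Rightarrow> complex \<Rightarrow> real \<Rightarrow> complex" where
  "av m s y = wsum m (outer (g s)) y / of_nat (N ^ Suc m)"

definition q :: "complex \<Rightarrow> complex" where "q s = of_nat N * of_real c powr (- s / 2)"

lemma norm_q: "norm (q s) = N * c powr (- Re s / 2)"
  using c1 by (simp add: q_def norm_mult norm_powr_real_powr)

lemma outer_range:
  assumes "j \<in> {2..N}" "0 \<le> x" "x \<le> B"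
  shows "b 1 \<le> \<phi> j x" "\<phi> j x \<le> \<beta>" "\<phi> j x \<le> B" "0 < \<phi> j x"
proof -
  have "b 1 \<le> b (j - 1)" using b_le[of 1 "j - 1"] assms by auto
  thus "b 1 \<le> \<phi> j x" "\<phi> j x \<le> \<beta>" "\<phi> j x \<le> B" "0 < \<phi> j x"
    using phi_mem[of j x] phi_range[of j x] assms b1_pos by auto
qed

lemma g_holomorphic: "0 < x \<Longrightarrow> x \<le> B \<Longrightarrow> (\<lambda>s. g s x) holomorphic_on A"
  unfolding g_def using koenigs_lower[of x] by (intro holomorphic_intros) (auto simp: complex_nonpos_Reals_iff)

lemma outer_holomorphic: "0 \<le> x \<Longrightarrow> x \<le> B \<Longrightarrow> (\<lambda>s. outer (g s) x) holomorphic_on A"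
  unfolding outer_def using outer_range[of _ x] by (intro holomorphic_on_sum g_holomorphic) auto

lemma av_holomorphic: "0 \<le> y \<Longrightarrow> y \<le> B \<Longrightarrow> (\<lambda>s. av m s y) holomorphic_on A"
  unfolding av_def using N2
  by (intro holomorphic_on_divide wsum_holomorphic[OF beta_le_B order_refl] outer_holomorphic holomorphic_intros) auto

lemma powr_tendsto_positive:
  fixes f :: "nat \<Rightarrow> real"
  assumes "f \<longlonglongrightarrow> l" "l > 0"
  shows "(\<lambda>n. complex_of_real (f n) powr w) \<longlonglongrightarrow> of_real l powr w"
  by (intro tendsto_powr_complex tendsto_of_real tendsto_const assms)
     (use assms in \<open>auto simp: complex_nonpos_Reals_iff\<close>)

text \<open>Dominated convergence for series. For words with m letters after the first letter other
  than 1, c^n splits into c^(m+1), which yields q^(m+1) together with the normalisation of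
  \<open>av\<close>, and c^(n-1-m), which turns S^(n-1-m) into a Koenigs approximant. The domination
  rests on \<open>Kn k x\<close> \<ge> x \<ge> b 1 and Re s > 0.\<close>

lemma zeta_series:
  assumes z0: "0 \<le> z0" "z0 \<le> B" and s: "norm (q s) < 1" "Re s > 0"
  shows "summable (\<lambda>m. q s ^ Suc m * av m s z0)"
    and "zeta_fun R z0 s = g s z0 + (\<Sum>m. q s ^ Suc m * av m s z0)"
proof -
  \<comment> \<open>Extended by 0 to m \<ge> n, so that all n share one index set.\<close>
  define t where "t n m = (if m < n then wsum m (outer (\<lambda>x. of_real (c ^ n * (S ^^ (n - 1 - m)) x) powr (- s / 2))) z0 else 0)" for n m
  have cpos: "c powr (- Re s / 2) \<ge> 0" by simp
  have part: "zeta_partial R z0 n s = (\<Sum>m. t n m) + of_real (Kn n z0) powr (- s / 2)" for n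
  proof -
    have "(\<Sum>m. t n m) = (\<Sum>m<n. t n m)"
      by (rule suminf_finite) (auto simp: t_def)
    also have "\<dots> = (\<Sum>k<n. t n (n - 1 - k))"
      by (rule sum.reindex_bij_witness[of _ "\<lambda>k. n - 1 - k" "\<lambda>k. n - 1 - k"]) auto
    also have "\<dots> = (\<Sum>k<n. wsum (n - 1 - k) (outer (\<lambda>x. of_real (c ^ n * (S ^^ k) x) powr (- s / 2))) z0)"
      by (intro sum.cong refl) (auto simp: t_def)
    finally show ?thesis
      unfolding zeta_partial_wsum[OF z0] by (subst wsum_leading_ones) (simp add: Kn_def)
  qed
  have t_eq: "t n m = (of_real c powr (- s / 2)) ^ Suc m * wsum m (outer (\<lambda>x. of_real (Kn (n - 1 - m) x) powr (- s / 2))) z0"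
    if "m < n" for n m
  proof -
    have "n = Suc m + (n - 1 - m)" using that by simp
    hence "c ^ n = c ^ Suc m * c ^ (n - 1 - m)" by (metis power_add)
    hence cn: "c ^ n * y = c ^ Suc m * (c ^ (n - 1 - m) * y)" for y by (simp add: mult.assoc)
    have pw: "of_real (c ^ n * (S ^^ (n - 1 - m)) x) powr (- s / 2) =
        (of_real c powr (- s / 2)) ^ Suc m * of_real (Kn (n - 1 - m) x) powr (- s / 2)"
      if "0 \<le> x" "x \<le> B" for x
    proof -
      have "Kn (n - 1 - m) x \<ge> 0" using Kn_lower[OF that, of "n - 1 - m"] that by linarith
      hence "of_real (c ^ Suc m * Kn (n - 1 - m) x) powr (- s / 2) =
          of_real (c ^ Suc m) powr (- s / 2) * complex_of_real (Kn (n - 1 - m) x) powr (- s / 2)"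
        using c1 by (subst of_real_mult, subst powr_times_real) auto
      moreover have "complex_of_real (c ^ k) powr (- s / 2) = (of_real c powr (- s / 2)) ^ k" for k
        using c1 by (induction k) (auto simp: powr_times_real simp del: of_real_power)
      ultimately show ?thesis unfolding cn Kn_def[symmetric] by (simp only:)
    qed
    have "wsum m (outer (\<lambda>x. of_real (c ^ n * (S ^^ (n - 1 - m)) x) powr (- s / 2))) z0 =
       wsum m (\<lambda>x. (of_real c powr (- s / 2)) ^ Suc m * outer (\<lambda>x. of_real (Kn (n - 1 - m) x) powr (- s / 2)) x) z0"
    proof (intro wsum_cong[OF beta_le_B order_refl] z0)
      fix x assume x: "0 \<le> x" "x \<le> B"
      show "outer (\<lambda>x. of_real (c ^ n * (S ^^ (n - 1 - m)) x) powr (- s / 2)) x =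
          (of_real c powr (- s / 2)) ^ Suc m * outer (\<lambda>x. of_real (Kn (n - 1 - m) x) powr (- s / 2)) x"
        unfolding outer_def sum_distrib_left
        by (intro sum.cong refl pw) (use outer_range[OF _ x] in \<open>auto intro: less_imp_le\<close>)
    qed
    thus ?thesis using that by (simp add: t_def wsum_mult)
  qed
  define M where "M = b 1 powr (- Re s / 2)"
  have bound: "norm (t n m) \<le> M * norm (q s) ^ Suc m" for n m
  proof (cases "m < n")
    case True
    have "norm (outer (\<lambda>x. of_real (Kn (n - 1 - m) x) powr (- s / 2)) x) \<le> N * M" if x: "0 \<le> x" "x \<le> B" for x
    proof -
      have "norm (outer (\<lambda>x. of_real (Kn (n - 1 - m) x) powr (- s / 2)) x) \<le> (\<Sum>j=2..N. M)"
        unfolding outer_def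
      proof (intro sum_norm_le)
        fix j assume "j \<in> {2..N}"
        from outer_range[OF this x] have y: "b 1 \<le> \<phi> j x" "\<phi> j x \<le> B" "0 < \<phi> j x" by auto
        have k: "b 1 \<le> Kn (n - 1 - m) (\<phi> j x)" using Kn_lower[of "\<phi> j x" "n - 1 - m"] y by simp
        hence "norm (complex_of_real (Kn (n - 1 - m) (\<phi> j x)) powr (- s / 2)) = Kn (n - 1 - m) (\<phi> j x) powr (- Re s / 2)"
          using b1_pos by (subst norm_powr_real_powr) auto
        also have "\<dots> \<le> M" unfolding M_def using k b1_pos s by (intro powr_mono2') auto
        finally show "norm (complex_of_real (Kn (n - 1 - m) (\<phi> j x)) powr (- s / 2)) \<le> M" .
      qed
      also have "\<dots> \<le> N * M" by (simp add: M_def mult_right_mono)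
      finally show ?thesis .
    qed
    hence "norm (wsum m (outer (\<lambda>x. of_real (Kn (n - 1 - m) x) powr (- s / 2))) z0) \<le> real N ^ m * (N * M)"
      by (intro wsum_norm_le[OF beta_le_B order_refl] z0)
    hence "norm (t n m) \<le> norm (complex_of_real c powr (- s / 2)) ^ Suc m * (real N ^ m * (N * M))"
      unfolding t_eq[OF True] norm_mult norm_power by (intro mult_left_mono) auto
    also have "\<dots> = M * norm (q s) ^ Suc m"
      by (simp add: q_def norm_mult power_mult_distrib mult_ac)
    finally show ?thesis .
  qed (auto simp: t_def M_def)
  have "((\<lambda>n. \<Sum>m. t n m) \<longlongrightarrow> (\<Sum>m. q s ^ Suc m * av m s z0)) sequentially
      \<and> summable (\<lambda>m. norm (q s ^ Suc m * av m s z0))"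
  proof -
    have lim: "(\<lambda>n. t n m) \<longlonglongrightarrow> q s ^ Suc m * av m s z0" for m
    proof -
      have "(\<lambda>n. (of_real c powr (- s / 2)) ^ Suc m * wsum m (outer (\<lambda>x. of_real (Kn n x) powr (- s / 2))) z0)
         \<longlonglongrightarrow> (of_real c powr (- s / 2)) ^ Suc m * wsum m (outer (g s)) z0"
      proof (intro tendsto_mult tendsto_const wsum_tendsto z0)
        fix x assume x: "0 \<le> x" "x \<le> B"
        show "(\<lambda>n. outer (\<lambda>x. of_real (Kn n x) powr (- s / 2)) x) \<longlonglongrightarrow> outer (g s) x"
          unfolding outer_def g_def
        proof (intro tendsto_sum powr_tendsto_positive Kn_tendsto)
          fix j assume "j \<in> {2..N}"
          from outer_range[OF this x] show "0 \<le> \<phi> j x" "\<phi> j x \<le> B" "0 < \<K> (\<phi> j x)"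
            using koenigs_lower[of "\<phi> j x"] by auto
        qed
      qed
      hence "(\<lambda>n. t (n + Suc m) m) \<longlonglongrightarrow> (of_real c powr (- s / 2)) ^ Suc m * wsum m (outer (g s)) z0"
        by (simp add: t_eq)
      also have "(of_real c powr (- s / 2)) ^ Suc m * wsum m (outer (g s)) z0 = q s ^ Suc m * av m s z0"
        using N2 by (simp add: q_def av_def power_mult_distrib field_simps)
      finally show ?thesis by (rule LIMSEQ_offset)
    qed
    have sm: "summable (\<lambda>m. M * norm (q s) ^ Suc m)"
      unfolding power_Suc using s by (intro summable_mult summable_geometric) auto
    have ev: "\<forall>\<^sub>F (m, n) in at_top \<times>\<^sub>F sequentially. norm (t n m) \<le> M * norm (q s) ^ Suc m"
      by (rule always_eventually) (use bound in auto)
    show ?thesis using tannerys_theorem[of "\<lambda>m n. t n m", OF lim ev sm sequentially_bot] by blast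
  qed
  hence lim: "(\<lambda>n. \<Sum>m. t n m) \<longlonglongrightarrow> (\<Sum>m. q s ^ Suc m * av m s z0)"
    and sum: "summable (\<lambda>m. norm (q s ^ Suc m * av m s z0))" by auto
  \<comment> \<open>The term of the all-ones word. For z0 = 0 it belongs to the root 0 that was
    removed, and both sides vanish.\<close>
  have g: "(\<lambda>n. complex_of_real (Kn n z0) powr (- s / 2)) \<longlonglongrightarrow> g s z0"
  proof (cases "z0 = 0")
    case True
    have "Kn n 0 = 0" for n using Kn_lower[of 0 n] Kn_upper[of 0 n] B_pos by simp
    thus ?thesis using True by (simp add: g_def koenigs_0)
  next
    case False
    thus ?thesis unfolding g_def using z0 koenigs_lower[OF z0]
      by (intro powr_tendsto_positive Kn_tendsto) auto
  qed
  show "summable (\<lambda>m. q s ^ Suc m * av m s z0)" using sum by (rule summable_norm_cancel)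
  have "(\<lambda>n. zeta_partial R z0 n s) \<longlonglongrightarrow> g s z0 + (\<Sum>m. q s ^ Suc m * av m s z0)"
    unfolding part using tendsto_add[OF lim g] by (simp add: add.commute)
  thus "zeta_fun R z0 s = g s z0 + (\<Sum>m. q s ^ Suc m * av m s z0)"
    unfolding zeta_fun_def by (rule limI)
qed

section \<open>Dependence of word sums on the base point\<close>

primrec dsum :: "nat \<Rightarrow> (real \<Rightarrow> real \<Rightarrow> real) \<Rightarrow> real \<Rightarrow> real \<Rightarrow> real" where
  "dsum 0 D u v = D u v"
| "dsum (Suc m) D u v = (\<Sum>j=1..N. dsum m D (\<phi> j u) (\<phi> j v))"

lemma dsum_Suc_inner: "dsum (Suc m) D u v = dsum m (\<lambda>x y. \<Sum>j=1..N. D (\<phi> j x) (\<phi> j y)) u v"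
proof (induction m arbitrary: u v)
  case (Suc m)
  show ?case unfolding dsum.simps(2)[of "Suc m"] dsum.simps(2)[of m "\<lambda>x y. \<Sum>j=1..N. D (\<phi> j x) (\<phi> j y)"]
    by (intro sum.cong refl Suc)
qed simp

lemma dsum_mono:
  assumes e: "\<beta> \<le> e" "e \<le> B"
    and D: "\<And>x y. 0 \<le> x \<Longrightarrow> x \<le> e \<Longrightarrow> 0 \<le> y \<Longrightarrow> y \<le> e \<Longrightarrow> D x y \<le> D' x y"
    and uv: "0 \<le> u" "u \<le> e" "0 \<le> v" "v \<le> e"
  shows "dsum m D u v \<le> dsum m D' u v"
  using uv
proof (induction m arbitrary: u v)
  case (Suc m)
  show ?case unfolding dsum.simps
    by (intro sum_mono Suc.IH) (use phi_interval[OF e, of _ u] phi_interval[OF e, of _ v] Suc in auto)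
qed (use D in auto)

lemma dsum_mult: "dsum m (\<lambda>x y. k * D x y) u v = k * dsum m D u v"
  by (induction m arbitrary: u v) (auto simp: sum_distrib_left)

lemma dsum_sum: "dsum m (\<lambda>x y. \<Sum>j\<in>J. D j x y) u v = (\<Sum>j\<in>J. dsum m (D j) u v)"
proof (induction m arbitrary: u v)
  case (Suc m)
  show ?case unfolding dsum.simps Suc by (rule sum.swap)
qed simp

lemma wsum_diff_le: "norm (wsum m h u - wsum m h v) \<le> dsum m (\<lambda>x y. norm (h x - h y)) u v"
proof (induction m arbitrary: u v)
  case (Suc m)
  show ?case unfolding wsum.simps dsum.simps sum_subtractf[symmetric]
    by (intro sum_norm_le Suc)
qed simp

text \<open>Total variation: the images of [0, B] under the words of length m lie side by side, so
  the oscillations of a monotone F over them add up to at most F B - F 0. In the induction each F o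
  \<phi> j is monotone up to sign, and the bounds over the pieces telescope along the break
  points.\<close>

lemma dsum_monotone_le:
  assumes "\<And>x y. 0 \<le> x \<Longrightarrow> x \<le> y \<Longrightarrow> y \<le> B \<Longrightarrow> F x \<le> F y"
    and "0 \<le> u" "u \<le> B" "0 \<le> v" "v \<le> B"
  shows "dsum m (\<lambda>x y. \<bar>F x - F y\<bar>) u v \<le> F B - F 0"
  using assms
proof (induction m arbitrary: F)
  case 0
  have "F 0 \<le> F u" "F u \<le> F B" "F 0 \<le> F v" "F v \<le> F B" using 0 by auto
  thus ?case by simp
next
  case (Suc m)
  have *: "dsum m (\<lambda>x y. \<bar>F (\<phi> j x) - F (\<phi> j y)\<bar>) u v \<le> F (b j) - F (b (j - 1))" if j: "j \<in> {1..N}" for j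
  proof -
    have "j - 1 \<le> N" "j \<le> N" using j by auto
    hence bj: "0 \<le> b (j - 1)" "b (j - 1) \<le> B" "0 \<le> b j" "b j \<le> B"
      using b_nonneg[of j] b_nonneg[of "j - 1"] beta_le_B by auto
    have ends: "b (j - 1) \<le> \<phi> j 0" "\<phi> j 0 \<le> b j" "b (j - 1) \<le> \<phi> j B" "\<phi> j B \<le> b j"
      using phi_mem[OF j, of 0] phi_mem[OF j, of B] B_pos by auto
    have F: "F (b (j - 1)) \<le> F (\<phi> j 0)" "F (\<phi> j 0) \<le> F (b j)"
            "F (b (j - 1)) \<le> F (\<phi> j B)" "F (\<phi> j B) \<le> F (b j)"
      using ends bj by (auto intro!: Suc.prems(1))
    show ?thesis
    proof (cases "increasing_piece (j - 1)")
      case True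
      have "F (\<phi> j x) \<le> F (\<phi> j y)" if "0 \<le> x" "x \<le> y" "y \<le> B" for x y
        using phi_increasing[OF j True, of x y] phi_range[OF j, of x] phi_range[OF j, of y] that
        by (cases "x = y") (auto intro!: Suc.prems(1))
      from Suc.IH[of "\<lambda>x. F (\<phi> j x)", OF this Suc.prems(2-)]
      have "dsum m (\<lambda>x y. \<bar>F (\<phi> j x) - F (\<phi> j y)\<bar>) u v \<le> F (\<phi> j B) - F (\<phi> j 0)" by simp
      thus ?thesis using F by linarith
    next
      case False
      have "- F (\<phi> j x) \<le> - F (\<phi> j y)" if "0 \<le> x" "x \<le> y" "y \<le> B" for x y
        using phi_decreasing[OF j False, of x y] phi_range[OF j, of x] phi_range[OF j, of y] that
        by (cases "x = y") (auto intro!: Suc.prems(1))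
      from Suc.IH[of "\<lambda>x. - F (\<phi> j x)", OF this Suc.prems(2-)]
      have "dsum m (\<lambda>x y. \<bar>- F (\<phi> j x) - - F (\<phi> j y)\<bar>) u v \<le> - F (\<phi> j B) - - F (\<phi> j 0)" by simp
      moreover have "\<bar>- F (\<phi> j x) - - F (\<phi> j y)\<bar> = \<bar>F (\<phi> j x) - F (\<phi> j y)\<bar>" for x y by simp
      ultimately have "dsum m (\<lambda>x y. \<bar>F (\<phi> j x) - F (\<phi> j y)\<bar>) u v \<le> - F (\<phi> j B) - - F (\<phi> j 0)" by simp
      thus ?thesis using F by linarith
    qed
  qed
  have "dsum (Suc m) (\<lambda>x y. \<bar>F x - F y\<bar>) u v = (\<Sum>j=1..N. dsum m (\<lambda>x y. \<bar>F (\<phi> j x) - F (\<phi> j y)\<bar>) u v)"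
    unfolding dsum_Suc_inner dsum_sum ..
  also have "\<dots> \<le> (\<Sum>j=1..N. F (b j) - F (b (j - 1)))" by (intro sum_mono *)
  also have "\<dots> = (\<Sum>j<N. F (b (Suc j)) - F (b j))"
    by (rule sum.reindex_bij_witness[of _ Suc "\<lambda>j. j - 1"]) auto
  also have "\<dots> = F (b N) - F (b 0)" by (rule sum_lessThan_telescope)
  also have "\<dots> \<le> F B - F 0" using Suc.prems(1)[of \<beta> B] beta_pos beta_le_B by (simp add: b_N b_0)
  finally show ?case .
qed

text \<open>Bounds the derivative of t powr (-s/2), of modulus |s/2| t^(-Re s/2 - 1), for t in
  [b 1, \<beta> E] and |s| \<le> r; the two logarithms bound |ln t| on this interval.\<close>

definition lip :: "real \<Rightarrow> real" where
  "lip r = (r / 2) * exp ((r / 2 + 1) * (\<bar>ln (b 1)\<bar> + \<bar>ln (\<beta> * E)\<bar>))"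

lemma powr_lipschitz:
  fixes s :: complex and u v :: real
  assumes s: "norm s \<le> r" and "u \<in> {b 1..\<beta> * E}" "v \<in> {b 1..\<beta> * E}"
  shows "norm (of_real u powr (- s / 2) - of_real v powr (- s / 2)) \<le> lip r * \<bar>u - v\<bar>"
proof -
  define T where "T = closed_segment (complex_of_real u) (of_real v)"
  have T: "\<exists>t. z = of_real t \<and> b 1 \<le> t \<and> t \<le> \<beta> * E" if z: "z \<in> T" for z
  proof -
    obtain t where "z = of_real t" "t \<in> closed_segment u v"
      using z unfolding T_def closed_segment_of_real by blast
    thus ?thesis using assms(2,3) by (auto simp: closed_segment_eq_real_ivl split: if_splits)
  qed
  have "norm ((\<lambda>z. z powr (- s / 2)) (of_real u) - (\<lambda>z. z powr (- s / 2)) (of_real v)) \<le>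
      lip r * norm (complex_of_real u - of_real v)"
  proof (rule field_differentiable_bound[of T _ "\<lambda>z. (- s / 2) * z powr (- s / 2 - 1)"])
    fix z assume "z \<in> T"
    then obtain t where t: "z = of_real t" "b 1 \<le> t" "t \<le> \<beta> * E" using T by blast
    have t0: "t > 0" using t b1_pos by linarith
    show "((\<lambda>z. z powr (- s / 2)) has_field_derivative (- s / 2) * z powr (- s / 2 - 1)) (at z within T)"
      using t0 t(1) by (auto intro!: derivative_eq_intros simp: complex_nonpos_Reals_iff)
    have "\<bar>ln t\<bar> \<le> \<bar>ln (b 1)\<bar> + \<bar>ln (\<beta> * E)\<bar>"
    proof -
      have "ln (b 1) \<le> ln t" "ln t \<le> ln (\<beta> * E)" using t t0 b1_pos by auto
      thus ?thesis by linarith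
    qed
    moreover have "\<bar>Re (- s / 2 - 1)\<bar> \<le> r / 2 + 1" using s abs_Re_le_cmod[of s] by simp
    ultimately have "Re (- s / 2 - 1) * ln t \<le> (r / 2 + 1) * (\<bar>ln (b 1)\<bar> + \<bar>ln (\<beta> * E)\<bar>)"
      by (meson abs_ge_self abs_ge_zero abs_mult_pos' mult_mono order_trans abs_mult[THEN eq_refl])
    hence "norm (z powr (- s / 2 - 1)) \<le> exp ((r / 2 + 1) * (\<bar>ln (b 1)\<bar> + \<bar>ln (\<beta> * E)\<bar>))"
      using t0 t(1) by (subst norm_powr_real_powr) (auto simp: powr_def)
    moreover have "norm (- s / 2) \<le> r / 2" using s by (simp add: norm_divide)
    moreover have "r \<ge> 0" using s norm_ge_zero order.trans by blast
    ultimately show "norm ((- s / 2) * z powr (- s / 2 - 1)) \<le> lip r"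
      unfolding norm_mult lip_def by (intro mult_mono) auto
  qed (auto simp: T_def)
  also have "norm (complex_of_real u - of_real v) = \<bar>u - v\<bar>"
    by (metis norm_of_real of_real_diff)
  finally show ?thesis .
qed

lemma koenigs_outer_range:
  assumes "b 1 \<le> x" "x \<le> \<beta>" shows "\<K> x \<in> {b 1..\<beta> * E}"
proof -
  have "x \<le> \<K> x" "\<K> x \<le> x * E" using koenigs_lower[of x] koenigs_upper[of x] assms b1_pos beta_le_B by auto
  moreover have "x * E \<le> \<beta> * E" using assms E by (intro mult_right_mono) auto
  ultimately show ?thesis using assms by auto
qed

lemma lip_nonneg: "r \<ge> 0 \<Longrightarrow> lip r \<ge> 0" by (simp add: lip_def)

lemma av_diff_le:
  assumes s: "norm s \<le> r" and uv: "0 \<le> u" "u \<le> B" "0 \<le> v" "v \<le> B"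
  shows "norm (av m s u - av m s v) \<le> lip r * dsum (Suc m) (\<lambda>x y. \<bar>\<K> x - \<K> y\<bar>) u v / real N ^ Suc m"
proof -
  have r: "r \<ge> 0" using s norm_ge_zero order.trans by blast
  have *: "norm (outer (g s) x - outer (g s) y) \<le> lip r * (\<Sum>j=1..N. \<bar>\<K> (\<phi> j x) - \<K> (\<phi> j y)\<bar>)"
    if xy: "0 \<le> x" "x \<le> B" "0 \<le> y" "y \<le> B" for x y
  proof -
    have "norm (outer (g s) x - outer (g s) y) \<le> (\<Sum>j=2..N. lip r * \<bar>\<K> (\<phi> j x) - \<K> (\<phi> j y)\<bar>)"
      unfolding outer_def sum_subtractf[symmetric] g_def
    proof (intro sum_norm_le powr_lipschitz s koenigs_outer_range)
      fix j assume j: "j \<in> {2..N}"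
      show "b 1 \<le> \<phi> j x" "\<phi> j x \<le> \<beta>" "b 1 \<le> \<phi> j y" "\<phi> j y \<le> \<beta>"
        using outer_range[OF j, of x] outer_range[OF j, of y] xy by auto
    qed
    \<comment> \<open>Adding j = 1 turns the inner sum into one more level of
      \<open>dsum\<close>.\<close>
    also have "\<dots> \<le> (\<Sum>j=1..N. lip r * \<bar>\<K> (\<phi> j x) - \<K> (\<phi> j y)\<bar>)"
      using lip_nonneg[OF r] by (intro sum_mono2) auto
    finally show ?thesis by (simp add: sum_distrib_left)
  qed
  have "norm (av m s u - av m s v) = norm (wsum m (outer (g s)) u - wsum m (outer (g s)) v) / real N ^ Suc m"
    by (simp add: av_def diff_divide_distrib[symmetric] norm_divide norm_mult norm_power)
  also have "norm (wsum m (outer (g s)) u - wsum m (outer (g s)) v) \<le>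
      dsum m (\<lambda>x y. norm (outer (g s) x - outer (g s) y)) u v" by (rule wsum_diff_le)
  also have "\<dots> \<le> dsum m (\<lambda>x y. lip r * (\<Sum>j=1..N. \<bar>\<K> (\<phi> j x) - \<K> (\<phi> j y)\<bar>)) u v"
    by (rule dsum_mono[OF beta_le_B order_refl *]) (use uv in auto)
  also have "\<dots> = lip r * dsum (Suc m) (\<lambda>x y. \<bar>\<K> x - \<K> y\<bar>) u v"
    unfolding dsum_mult dsum_Suc_inner ..
  finally show ?thesis using N2 by (simp add: divide_right_mono)
qed

lemma av_diff_le_variation:
  assumes s: "norm s \<le> r" and uv: "0 \<le> u" "u \<le> B" "0 \<le> v" "v \<le> B"
  shows "norm (av m s u - av m s v) \<le> lip r * \<K> B / real N ^ Suc m"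
proof -
  have r: "r \<ge> 0" using s norm_ge_zero order.trans by blast
  have "dsum (Suc m) (\<lambda>x y. \<bar>\<K> x - \<K> y\<bar>) u v \<le> \<K> B - \<K> 0"
    by (rule dsum_monotone_le) (use koenigs_mono uv in auto)
  hence "lip r * dsum (Suc m) (\<lambda>x y. \<bar>\<K> x - \<K> y\<bar>) u v / real N ^ Suc m \<le> lip r * \<K> B / real N ^ Suc m"
    using lip_nonneg[OF r] by (intro divide_right_mono mult_left_mono) (auto simp: koenigs_0)
  thus ?thesis using av_diff_le[OF assms, of m] by linarith
qed

section \<open>The balanced measure\<close>

definition words :: "nat \<Rightarrow> nat list set" where
  "words m = {js. set js \<subseteq> {1..N} \<and> length js = m}"

text \<open>The head of the list is the letter applied last, as in \<open>cylinder\<close>;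
  shortening a word at its end enlarges the cylinder.\<close>

definition \<phi>s :: "nat list \<Rightarrow> real \<Rightarrow> real" where "\<phi>s js x = foldr \<phi> js x"

lemma phis_simps [simp]: "\<phi>s [] x = x" "\<phi>s (j # js) x = \<phi> j (\<phi>s js x)"
  by (auto simp: \<phi>s_def)

lemma finite_words [simp]: "finite (words m)"
  unfolding words_def using finite_lists_length_eq[of "{1..N}" m] by simp

lemma words_0: "words 0 = {[]}" by (auto simp: words_def)

lemma words_Suc: "words (Suc m) = (\<lambda>(j, js). j # js) ` ({1..N} \<times> words m)"
  by (auto simp: words_def length_Suc_conv image_iff)

lemma words_Cons [simp]: "j # js \<in> words (Suc m) \<longleftrightarrow> j \<in> {1..N} \<and> js \<in> words m"
  by (auto simp: words_def)

lemma words_SucE: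
  assumes "js \<in> words (Suc m)"
  obtains j ks where "js = j # ks" "j \<in> {1..N}" "ks \<in> words m"
  using assms unfolding words_Suc by auto

lemma card_words: "card (words m) = N ^ m"
  unfolding words_def using card_lists_length_eq[of "{1..N}" m] by simp

lemma sum_words_Suc: "(\<Sum>js\<in>words (Suc m). f js) = (\<Sum>js\<in>words m. \<Sum>j=1..N. f (j # js))"
proof -
  have "(\<Sum>js\<in>words (Suc m). f js) = (\<Sum>(j, js)\<in>{1..N} \<times> words m. f (j # js))"
    unfolding words_Suc by (subst sum.reindex) (auto simp: inj_on_def case_prod_unfold)
  also have "\<dots> = (\<Sum>js\<in>words m. \<Sum>j=1..N. f (j # js))"
    unfolding sum.cartesian_product[symmetric] by (rule sum.swap)
  finally show ?thesis .
qed

lemma wsum_words: "wsum m h y = (\<Sum>js\<in>words m. h (\<phi>s js y))"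
proof (induction m arbitrary: h)
  case (Suc m)
  show ?case unfolding wsum_Suc_inner Suc sum_words_Suc by simp
qed (simp add: words_0)

lemma dsum_words: "dsum m D u v = (\<Sum>js\<in>words m. D (\<phi>s js u) (\<phi>s js v))"
proof (induction m arbitrary: D)
  case (Suc m)
  show ?case unfolding dsum_Suc_inner Suc sum_words_Suc by simp
qed (simp add: words_0)

lemma phis_range: "js \<in> words m \<Longrightarrow> 0 \<le> x \<Longrightarrow> x \<le> B \<Longrightarrow> 0 \<le> \<phi>s js x \<and> \<phi>s js x \<le> B"
proof (induction js arbitrary: m)
  case (Cons j js)
  then obtain m' where "m = Suc m'" by (auto simp: words_def)
  thus ?case using Cons phi_range[of j "\<phi>s js x"] by auto
qed auto

lemma phis_monotone:
  assumes "js \<in> words m"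
  shows "(\<forall>x y. 0 \<le> x \<longrightarrow> x \<le> y \<longrightarrow> y \<le> B \<longrightarrow> \<phi>s js x \<le> \<phi>s js y) \<or>
         (\<forall>x y. 0 \<le> x \<longrightarrow> x \<le> y \<longrightarrow> y \<le> B \<longrightarrow> \<phi>s js y \<le> \<phi>s js x)"
  using assms
proof (induction js arbitrary: m)
  case (Cons j js)
  then obtain m' where m: "m = Suc m'" by (auto simp: words_def)
  hence j: "j \<in> {1..N}" and js: "js \<in> words m'" using Cons by auto
  have r: "0 \<le> \<phi>s js x \<and> \<phi>s js x \<le> B" if "0 \<le> x" "x \<le> B" for x using phis_range[OF js] that by blast
  have "(\<forall>x y. 0 \<le> x \<longrightarrow> x \<le> y \<longrightarrow> y \<le> B \<longrightarrow> \<phi> j x \<le> \<phi> j y) \<or>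
         (\<forall>x y. 0 \<le> x \<longrightarrow> x \<le> y \<longrightarrow> y \<le> B \<longrightarrow> \<phi> j y \<le> \<phi> j x)"
    using phi_increasing[OF j] phi_decreasing[OF j] by (metis le_less)
  thus ?case using Cons.IH[OF js] r by (smt (verit) phis_simps(2))
qed auto

lemma cylinder_eq: "cylinder R js = \<phi>s js ` {0..\<beta>}"
proof -
  have "foldr (\<lambda>j A. inv_branch R j ` A) js {0..\<beta>} = \<phi>s js ` {0..\<beta>}"
    by (induction js) (auto simp: image_image)
  thus ?thesis by (simp add: cylinder_def hull_eq)
qed

lemma cylinder_Cons: "cylinder R (j # js) = \<phi> j ` cylinder R js"
  by (auto simp: cylinder_eq image_image)

lemma cylinder_range: "js \<in> words m \<Longrightarrow> cylinder R js \<subseteq> {0..\<beta>}"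
proof (cases js)
  case (Cons j js')
  assume js: "js \<in> words m"
  then obtain m' where "m = Suc m'" using Cons by (auto simp: words_def)
  hence j: "j \<in> {1..N}" and js': "js' \<in> words m'" using js Cons by auto
  show ?thesis unfolding Cons cylinder_eq
    using phi_range[OF j] phis_range[OF js'] beta_le_B by force
qed (auto simp: cylinder_eq)

lemma cylinder_compact: "js \<in> words m \<Longrightarrow> compact (cylinder R js)"
proof (induction js arbitrary: m)
  case Nil
  show ?case by (simp add: cylinder_eq)
next
  case (Cons j js)
  then obtain m' where "m = Suc m'" by (auto simp: words_def)
  hence j: "j \<in> {1..N}" and js': "js \<in> words m'" using Cons by auto
  have "cylinder R js \<subseteq> {0..B}" using cylinder_range[OF js'] beta_le_B by auto
  thus ?case unfolding cylinder_Cons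
    by (intro compact_continuous_image Cons.IH[OF js'] continuous_on_subset[OF phi_continuous[OF j]])
qed

lemma phi_rjulia: "j \<in> {1..N} \<Longrightarrow> x \<in> rjulia R \<Longrightarrow> \<phi> j x \<in> rjulia R"
  using rjulia_invariant[of "\<phi> j x"] phi_mem(3)[of j x] rjulia_nonneg[of x] rjulia_le[of x] beta_le_B by simp

lemma phis_rjulia: "js \<in> words m \<Longrightarrow> x \<in> rjulia R \<Longrightarrow> \<phi>s js x \<in> rjulia R"
proof (induction js arbitrary: m)
  case (Cons j js)
  then obtain m' where "m = Suc m'" by (auto simp: words_def)
  thus ?case using Cons phi_rjulia[of j "\<phi>s js x"] by auto
qed auto

lemma cylinder_append_subset: "set js' \<subseteq> {1..N} \<Longrightarrow> cylinder R (js @ js') \<subseteq> cylinder R js"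
proof (induction js)
  case Nil
  thus ?case using cylinder_range[of js' "length js'"] by (simp add: words_def cylinder_eq[of "[]"])
next
  case (Cons j js)
  thus ?case by (auto simp: cylinder_Cons)
qed

lemma cylinder_julia_nonempty: "js \<in> words m \<Longrightarrow> \<phi>s js 0 \<in> cylinder R js \<inter> rjulia R"
  using phis_rjulia zero_rjulia beta_pos by (auto simp: cylinder_eq)

lemma phi_preimage:
  assumes "x \<in> rjulia R"
  obtains j where "j \<in> {1..N}" "x = \<phi> j (poly P x)" "poly P x \<in> rjulia R"
proof -
  obtain j where j: "j < N" "b j \<le> x" "x \<le> b (Suc j)"
    using pieces_cover rjulia_nonneg rjulia_le assms by metis
  have "\<phi> (Suc j) (poly P x) = x" using j by (intro phi_eq) auto
  thus ?thesis using that[of "Suc j"] j assms rjulia_invariant by auto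
qed

lemma rjulia_cylinders:
  assumes "x \<in> rjulia R" shows "\<exists>js\<in>words m. x \<in> cylinder R js"
  using assms
proof (induction m arbitrary: x)
  case 0
  thus ?case using rjulia_nonneg rjulia_le by (auto simp: words_0 cylinder_eq)
next
  case (Suc m)
  obtain j where j: "j \<in> {1..N}" "x = \<phi> j (poly P x)" "poly P x \<in> rjulia R"
    using phi_preimage[OF Suc.prems] .
  obtain js where "js \<in> words m" "poly P x \<in> cylinder R js" using Suc.IH[OF j(3)] by blast
  thus ?case using j by (intro bexI[of _ "j # js"]) (auto simp: cylinder_Cons)
qed

lemma mem_cylinder_Cons:
  assumes "j \<in> {1..N}" "js \<in> words m" "x \<in> cylinder R (j # js)"
  shows "b (j - 1) \<le> x" "x \<le> b j" "poly P x \<in> cylinder R js"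
proof -
  obtain y where y: "y \<in> cylinder R js" "x = \<phi> j y" using assms by (auto simp: cylinder_Cons)
  have "0 \<le> y" "y \<le> B" using cylinder_range[OF assms(2)] y beta_le_B by auto
  thus "b (j - 1) \<le> x" "x \<le> b j" "poly P x \<in> cylinder R js"
    using phi_mem[OF assms(1), of y] y by auto
qed

lemma pieces_common_point:
  assumes "i \<in> {1..N}" "j \<in> {1..N}" "i < j" "b (i - 1) \<le> x" "x \<le> b i" "b (j - 1) \<le> x" "x \<le> b j"
  shows "j = Suc i \<and> x = b i"
proof -
  have "b i \<le> b (j - 1)" using b_le[of i "j - 1"] assms by auto
  hence x: "x = b i" "b i = b (j - 1)" using assms by linarith+
  have "j - 1 \<le> N" using assms by simp
  hence "i = j - 1" using b_less[of i "j - 1"] x(2) assms by (cases "i < j - 1") auto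
  with x show ?thesis using assms by auto
qed

text \<open>Cylinders with different first letters meet at most in a shared break point; a common
  first letter is stripped off by P, which is injective on the piece.\<close>

lemma cylinders_overlap_finite:
  assumes "js \<in> words m" "js' \<in> words m" "js \<noteq> js'"
  shows "finite (cylinder R js \<inter> cylinder R js')"
  using assms
proof (induction m arbitrary: js js')
  case (Suc m)
  obtain j ks where j: "js = j # ks" "j \<in> {1..N}" "ks \<in> words m" using Suc.prems(1) by (rule words_SucE)
  obtain i ls where i: "js' = i # ls" "i \<in> {1..N}" "ls \<in> words m" using Suc.prems(2) by (rule words_SucE)
  note js = j(1) i(1) j(2) i(2) j(3) i(3)
  show ?case
  proof (cases "i = j")
    case True
    hence "ks \<noteq> ls" using Suc.prems js by auto
    from Suc.IH[OF js(5,6) this] have fin: "finite (\<phi> j ` (cylinder R ks \<inter> cylinder R ls))" by blast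
    have "x \<in> \<phi> j ` (cylinder R ks \<inter> cylinder R ls)" if x: "x \<in> cylinder R js \<inter> cylinder R js'" for x
    proof -
      have "poly P x \<in> cylinder R ks" "poly P x \<in> cylinder R ls" "b (j - 1) \<le> x" "x \<le> b j"
        using mem_cylinder_Cons[of j ks m x] mem_cylinder_Cons[of j ls m x] x js True by auto
      thus ?thesis using phi_eq[OF js(3), of x] by (metis IntI imageI)
    qed
    thus ?thesis using fin by (meson finite_subset subsetI)
  next
    case False
    have "x \<in> {b i, b j}" if x: "x \<in> cylinder R js \<inter> cylinder R js'" for x
    proof -
      have "b (j - 1) \<le> x" "x \<le> b j" "b (i - 1) \<le> x" "x \<le> b i"
        using mem_cylinder_Cons[of j ks m x] mem_cylinder_Cons[of i ls m x] x js by auto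
      thus ?thesis
        using pieces_common_point[OF js(3,4), of x] pieces_common_point[OF js(4,3), of x] False
        by (cases i j rule: linorder_cases) auto
    qed
    hence "cylinder R js \<inter> cylinder R js' \<subseteq> {b i, b j}" by blast
    thus ?thesis by (rule finite_subset) auto
  qed
qed (simp add: words_0)

lemma end_points_invariant: "poly P \<beta> \<in> {0, \<beta>}"
proof -
  have 1: "poly P \<beta> \<in> rjulia R" using rjulia_invariant beta_rjulia by simp
  have "Suc (N - 1) = N" using N2 by simp
  thus ?thesis using piece_right_end[of "N - 1"] N2 rjulia_nonneg[OF 1] rjulia_le[OF 1] b_N by force
qed

section \<open>Cylinders through a given point\<close>

definition covering :: "nat \<Rightarrow> real \<Rightarrow> nat list set" where
  "covering m x = {js \<in> words m. x \<in> cylinder R js}"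

lemma finite_covering [simp]: "finite (covering m x)" by (simp add: covering_def)

lemma covering_Suc_subset:
  "covering (Suc m) x \<subseteq> (\<lambda>(j, js). j # js) ` ({j\<in>{1..N}. b (j - 1) \<le> x \<and> x \<le> b j} \<times> covering m (poly P x))"
proof
  fix js assume "js \<in> covering (Suc m) x"
  then obtain j ks where "js = j # ks" "j \<in> {1..N}" "ks \<in> words m" "x \<in> cylinder R (j # ks)"
    unfolding covering_def words_Suc by auto
  thus "js \<in> (\<lambda>(j, js). j # js) ` ({j\<in>{1..N}. b (j - 1) \<le> x \<and> x \<le> b j} \<times> covering m (poly P x))"
    using mem_cylinder_Cons[of j ks m x] by (auto simp: covering_def)
qed

lemma card_covering_Suc:
  "card (covering (Suc m) x) \<le> card {j\<in>{1..N}. b (j - 1) \<le> x \<and> x \<le> b j} * card (covering m (poly P x))"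
proof -
  have "card (covering (Suc m) x) \<le> card ({j\<in>{1..N}. b (j - 1) \<le> x \<and> x \<le> b j} \<times> covering m (poly P x))"
    by (rule order.trans[OF card_mono[OF _ covering_Suc_subset] card_image_le]) auto
  thus ?thesis by (simp add: card_cartesian_product)
qed

text \<open>The point 0 lies only in the first piece and \<beta> only in the last, and P maps both
  into {0, \<beta>}, so a choice of letter never arises.\<close>

lemma card_covering_end: "x \<in> {0, \<beta>} \<Longrightarrow> card (covering m x) \<le> 1"
proof (induction m arbitrary: x)
  case 0
  have "covering 0 x \<subseteq> {[]}" by (auto simp: covering_def words_0)
  from card_mono[OF _ this] show ?case by simp
next
  case (Suc m)
  have "{j\<in>{1..N}. b (j - 1) \<le> x \<and> x \<le> b j} \<subseteq> {if x = 0 then 1 else N}"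
  proof
    fix j assume j: "j \<in> {j\<in>{1..N}. b (j - 1) \<le> x \<and> x \<le> b j}"
    show "j \<in> {if x = 0 then 1 else N}"
    proof (cases "x = 0")
      case True
      have "j - 1 \<le> N" using j by auto
      thus ?thesis using b_less[of 0 "j - 1"] j b_0 True by (cases "j = 1") auto
    next
      case False
      thus ?thesis using b_less[of j N] j b_N Suc.prems by (cases "j = N") auto
    qed
  qed
  from card_mono[OF _ this] have "card {j\<in>{1..N}. b (j - 1) \<le> x \<and> x \<le> b j} \<le> 1" by simp
  moreover have "card (covering m (poly P x)) \<le> 1"
    using Suc.prems end_points_invariant P0 by (intro Suc.IH) auto
  ultimately have "card {j\<in>{1..N}. b (j - 1) \<le> x \<and> x \<le> b j} * card (covering m (poly P x)) \<le> 1 * 1"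
    by (intro mult_mono) auto
  thus ?case using card_covering_Suc[of m x] by simp
qed

lemma card_pieces_le_2:
  fixes x :: real
  defines "J \<equiv> {j\<in>{1..N}. b (j - 1) \<le> x \<and> x \<le> b j}"
  shows "card J \<le> 2" and "card J > 1 \<Longrightarrow> x \<in> crit"
proof -
  have fin: "finite J" by (simp add: J_def)
  have main: "card J \<le> 2 \<and> (card J > 1 \<longrightarrow> x \<in> crit)"
  proof (cases "card J > 1")
    case True
    hence ne: "J \<noteq> {}" by auto
    define i where "i = Min J"
    have i: "i \<in> J" "\<And>j. j \<in> J \<Longrightarrow> i \<le> j" using fin ne by (auto simp: i_def)
    have *: "j = Suc i \<and> x = b i" if "j \<in> J" "j \<noteq> i" for j
      using pieces_common_point[of i j x] i(1) i(2)[OF that(1)] that by (auto simp: J_def)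
    hence "J \<subseteq> {i, Suc i}" by blast
    from card_mono[OF _ this] have "card J \<le> 2" by (simp add: card_insert_if)
    moreover obtain j where j: "j \<in> J" "j \<noteq> i"
    proof -
      have "\<not> J \<subseteq> {i}" using True card_mono[of "{i}" J] by auto
      thus ?thesis using that by blast
    qed
    hence "x = b i" "Suc i \<le> N" "0 < i" using *[OF j] i(1) by (auto simp: J_def)
    hence "x \<in> crit" using b_crit[of i] by simp
    ultimately show ?thesis by blast
  qed auto
  show "card J \<le> 2" "card J > 1 \<Longrightarrow> x \<in> crit" using main by auto
qed

text \<open>Two letters are possible only at a critical point, and its image is 0 or \<beta>, with
  at most one word, or lies outside the hull, with none. So the number of words doubles at most once
  along an orbit.\<close>

lemma card_covering: "card (covering m x) \<le> 2"
proof (induction m arbitrary: x)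
  case 0
  have "covering 0 x \<subseteq> {[]}" by (auto simp: covering_def words_0)
  from card_mono[OF _ this] show ?case by simp
next
  case (Suc m)
  define J where "J = {j\<in>{1..N}. b (j - 1) \<le> x \<and> x \<le> b j}"
  show ?case
  proof (cases "card J > 1")
    case True
    hence x: "x \<in> crit" using card_pieces_le_2(2)[of x] by (simp add: J_def)
    have "card (covering m (poly P x)) \<le> 1"
    proof (cases "poly P x \<in> {0..\<beta>}")
      case True
      hence "poly P x \<in> {0, \<beta>}" using crit_value[OF x] by force
      thus ?thesis by (rule card_covering_end)
    next
      case False
      hence "covering m (poly P x) = {}" using cylinder_range[of _ m] unfolding covering_def by blast
      thus ?thesis by simp
    qed
    hence "card J * card (covering m (poly P x)) \<le> 2 * 1"
      using card_pieces_le_2(1)[of x] by (intro mult_mono) (auto simp: J_def)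
    thus ?thesis using card_covering_Suc[of m x] by (simp add: J_def)
  next
    case False
    hence "card J * card (covering m (poly P x)) \<le> 1 * 2"
      using Suc.IH by (intro mult_mono) auto
    thus ?thesis using card_covering_Suc[of m x] by (simp add: J_def)
  qed
qed

section \<open>Random words and their coding\<close>

definition letter :: "nat \<Rightarrow> nat" where "letter i = (if i \<in> {1..N} then i else 1)"

definition coin :: "nat pmf" where "coin = pmf_of_set {1..N}"

definition seqs :: "nat stream measure" where "seqs = stream_space (measure_pmf coin)"

text \<open>\<open>letter\<close> maps symbols outside {1..N}, which have probability 0, to 1. Then
  every stream yields words, and the facts below hold pointwise.\<close>

definition prefix_word :: "nat \<Rightarrow> nat stream \<Rightarrow> nat list" where
  "prefix_word m \<omega> = map letter (stake m \<omega>)"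

lemma prefix_word_mem: "prefix_word m \<omega> \<in> words m"
  using N2 by (auto simp: prefix_word_def words_def letter_def)

lemma prefix_word_add: "\<exists>ks. prefix_word (m + n) \<omega> = prefix_word m \<omega> @ ks \<and> set ks \<subseteq> {1..N}"
proof (intro exI conjI)
  show "prefix_word (m + n) \<omega> = prefix_word m \<omega> @ map letter (stake n (sdrop m \<omega>))"
    unfolding prefix_word_def map_append[symmetric] stake_add ..
  show "set (map letter (stake n (sdrop m \<omega>))) \<subseteq> {1..N}" using N2 by (auto simp: letter_def)
qed

lemma space_seqs [simp]: "space seqs = UNIV"
  by (simp add: seqs_def space_stream_space)

interpretation seqs: prob_space seqs
  unfolding seqs_def by (intro prob_space.prob_space_stream_space prob_space_measure_pmf)

lemma stake_measurable [measurable]: "stake m \<in> measurable seqs (count_space UNIV)"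
proof -
  have "sets seqs = sets (stream_space (count_space UNIV))"
    unfolding seqs_def by (intro sets_stream_space_cong) simp
  from measurable_cong_sets[OF this refl] show ?thesis using measurable_stake[of m] by blast
qed

lemma prefix_word_measurable [measurable]: "prefix_word m \<in> measurable seqs (count_space UNIV)"
  unfolding prefix_word_def[abs_def] by (rule measurable_compose[OF stake_measurable]) simp

lemma emeasure_stake: "set js \<subseteq> {1..N} \<Longrightarrow> emeasure seqs {\<omega>. stake (length js) \<omega> = js} = ennreal ((1 / N) ^ length js)"
proof (induction js)
  case Nil
  thus ?case using seqs.emeasure_space_1 by simp
next
  case (Cons j js)
  have sets: "{\<omega>. stake m \<omega> = ks} \<in> sets seqs" for m ks
    using measurable_sets[OF stake_measurable[of m], of "{ks}"] by (simp add: vimage_def)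
  have "emeasure seqs {\<omega>. stake (length (j # js)) \<omega> = j # js} =
      (\<integral>\<^sup>+t. emeasure seqs {x. t ## x \<in> {\<omega>. stake (length (j # js)) \<omega> = j # js}} \<partial>measure_pmf coin)"
    using prob_space.emeasure_stream_space[OF prob_space_measure_pmf, of "{\<omega>. stake (length (j # js)) \<omega> = j # js}" coin]
      sets[of "length (j # js)" "j # js"] by (simp add: seqs_def space_stream_space)
  also have "\<dots> = (\<integral>\<^sup>+t. ennreal ((1 / N) ^ length js) * indicator {j} t \<partial>measure_pmf coin)"
    by (intro nn_integral_cong) (use Cons in \<open>auto split: split_indicator\<close>)
  also have "\<dots> = ennreal ((1 / N) ^ length js) * emeasure (measure_pmf coin) {j}"
    by (subst nn_integral_cmult_indicator) auto
  also have "emeasure (measure_pmf coin) {j} = ennreal (1 / N)"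
    using Cons.prems N2 by (simp add: emeasure_pmf_single coin_def)
  finally show ?case by (simp add: ennreal_mult[symmetric] mult_ac)
qed

lemma prob_prefix_word: "js \<in> words m \<Longrightarrow> seqs.prob {\<omega>. prefix_word m \<omega> = js} = (1 / N) ^ m"
proof -
  assume js: "js \<in> words m"
  have sets: "{\<omega>. prefix_word m \<omega> = ks} \<in> sets seqs" for ks
    using measurable_sets[OF prefix_word_measurable[of m], of "{ks}"] by (simp add: vimage_def)
  \<comment> \<open>Clipping by \<open>letter\<close> can only enlarge the event, which gives one
    inequality; since the N^m events have total mass 1, equality follows.\<close>
  have ge: "seqs.prob {\<omega>. prefix_word m \<omega> = ks} \<ge> (1 / N) ^ m" if ks: "ks \<in> words m" for ks
  proof -
    have "map letter ks = ks" using ks by (intro map_idI) (auto simp: words_def letter_def)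
    hence "{\<omega>. stake m \<omega> = ks} \<subseteq> {\<omega>. prefix_word m \<omega> = ks}" by (auto simp: prefix_word_def)
    moreover have "seqs.prob {\<omega>. stake m \<omega> = ks} = (1 / N) ^ m"
      using emeasure_stake[of ks] ks by (simp add: words_def measure_def)
    ultimately show ?thesis using seqs.finite_measure_mono[OF _ sets[of ks], of "{\<omega>. stake m \<omega> = ks}"] by simp
  qed
  have "(\<Sum>ks\<in>words m. seqs.prob {\<omega>. prefix_word m \<omega> = ks}) = seqs.prob (\<Union>ks\<in>words m. {\<omega>. prefix_word m \<omega> = ks})"
    by (rule seqs.finite_measure_finite_Union[symmetric]) (auto simp: disjoint_family_on_def sets)
  also have "(\<Union>ks\<in>words m. {\<omega>. prefix_word m \<omega> = ks}) = space seqs" using prefix_word_mem by auto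
  finally have sum1: "(\<Sum>ks\<in>words m. seqs.prob {\<omega>. prefix_word m \<omega> = ks}) = 1" unfolding seqs.prob_space .
  have "(\<Sum>ks\<in>words m. seqs.prob {\<omega>. prefix_word m \<omega> = ks} - (1 / N) ^ m) = 0"
    unfolding sum_subtractf sum1 using N2 by (simp add: card_words power_one_over)
  hence "\<forall>ks\<in>words m. seqs.prob {\<omega>. prefix_word m \<omega> = ks} - (1 / N) ^ m = 0"
    using ge by (subst (asm) sum_nonneg_eq_0_iff) auto
  thus ?thesis using js by auto
qed

definition left_end :: "nat list \<Rightarrow> real" where "left_end js = Inf (cylinder R js \<inter> rjulia R)"

text \<open>The left ends of the Julia parts of nested cylinders increase along the stream, so the
  limit exists by monotonicity; each approximant depends on a finite prefix, which makes the limit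
  measurable.\<close>

definition coding :: "nat stream \<Rightarrow> real" where
  "coding \<omega> = lim (\<lambda>n. left_end (prefix_word n \<omega>))"

lemma left_end_mem: "js \<in> words m \<Longrightarrow> left_end js \<in> cylinder R js \<inter> rjulia R"
proof -
  assume js: "js \<in> words m"
  have "compact (cylinder R js \<inter> rjulia R)" using cylinder_compact[OF js] rjulia_compact by (intro compact_Int)
  thus ?thesis unfolding left_end_def using cylinder_julia_nonempty[OF js]
    by (intro closed_contains_Inf bounded_imp_bdd_below compact_imp_bounded compact_imp_closed) auto
qed

lemma left_end_prefix_mem: "m \<le> n \<Longrightarrow> left_end (prefix_word n \<omega>) \<in> cylinder R (prefix_word m \<omega>) \<inter> rjulia R"
  using left_end_mem[OF prefix_word_mem[of n \<omega>]] prefix_word_add[of m "n - m" \<omega>] cylinder_append_subset by fastforce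

lemma coding_tendsto: "(\<lambda>n. left_end (prefix_word n \<omega>)) \<longlonglongrightarrow> coding \<omega>"
proof -
  have "incseq (\<lambda>n. left_end (prefix_word n \<omega>))"
  proof (rule incseq_SucI)
    fix n
    have "left_end (prefix_word (Suc n) \<omega>) \<in> cylinder R (prefix_word n \<omega>) \<inter> rjulia R"
      by (rule left_end_prefix_mem) simp
    moreover have "bdd_below (cylinder R (prefix_word n \<omega>) \<inter> rjulia R)"
      by (rule bdd_belowI[of _ 0]) (use rjulia_nonneg in auto)
    ultimately show "left_end (prefix_word n \<omega>) \<le> left_end (prefix_word (Suc n) \<omega>)"
      unfolding left_end_def[of "prefix_word n \<omega>"] by (rule cInf_lower)
  qed
  moreover have "left_end (prefix_word n \<omega>) \<le> \<beta>" for n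
    using left_end_mem[OF prefix_word_mem[of n \<omega>]] rjulia_le by blast
  ultimately obtain l where "(\<lambda>n. left_end (prefix_word n \<omega>)) \<longlonglongrightarrow> l"
    using incseq_convergent[of "\<lambda>n. left_end (prefix_word n \<omega>)" \<beta>] by blast
  thus ?thesis unfolding coding_def by (simp add: limI)
qed

lemma coding_mem: "coding \<omega> \<in> cylinder R (prefix_word m \<omega>)" and coding_rjulia: "coding \<omega> \<in> rjulia R"
proof -
  have cl: "closed (cylinder R (prefix_word m \<omega>) \<inter> rjulia R)"
    using cylinder_compact[OF prefix_word_mem] rjulia_compact by (intro closed_Int compact_imp_closed)
  have "coding \<omega> \<in> cylinder R (prefix_word m \<omega>) \<inter> rjulia R"
    by (rule Lim_in_closed_set[OF cl _ sequentially_bot coding_tendsto])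
       (use left_end_prefix_mem in \<open>auto intro!: eventually_sequentiallyI[of m]\<close>)
  thus "coding \<omega> \<in> cylinder R (prefix_word m \<omega>)" "coding \<omega> \<in> rjulia R" by auto
qed

lemma coding_measurable [measurable]: "coding \<in> borel_measurable seqs"
proof (rule borel_measurable_LIMSEQ_real[OF coding_tendsto])
  show "(\<lambda>\<omega>. left_end (prefix_word n \<omega>)) \<in> borel_measurable seqs" for n
    by (rule measurable_compose[OF prefix_word_measurable]) simp
qed

lemma coding_atom: "seqs.prob {\<omega>. coding \<omega> = x} = 0"
proof -
  have sets: "{\<omega>. prefix_word m \<omega> = ks} \<in> sets seqs" for m ks
    using measurable_sets[OF prefix_word_measurable[of m], of "{ks}"] by (simp add: vimage_def)
  have "seqs.prob {\<omega>. coding \<omega> = x} \<le> 2 * (1 / N) ^ m" for m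
  proof -
    have "{\<omega>. coding \<omega> = x} \<subseteq> (\<Union>js\<in>covering m x. {\<omega>. prefix_word m \<omega> = js})"
      using coding_mem[of _ m] prefix_word_mem by (auto simp: covering_def)
    hence "seqs.prob {\<omega>. coding \<omega> = x} \<le> seqs.prob (\<Union>js\<in>covering m x. {\<omega>. prefix_word m \<omega> = js})"
      by (intro seqs.finite_measure_mono) (auto intro!: sets.finite_UN sets)
    also have "\<dots> \<le> (\<Sum>js\<in>covering m x. seqs.prob {\<omega>. prefix_word m \<omega> = js})"
      by (intro seqs.finite_measure_subadditive_finite) (auto simp: sets)
    also have "\<dots> = (\<Sum>js\<in>covering m x. (1 / N) ^ m)"
      by (intro sum.cong refl prob_prefix_word) (auto simp: covering_def)
    also have "\<dots> \<le> 2 * (1 / N) ^ m" using card_covering[of m x] by (simp add: mult_right_mono)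
    finally show ?thesis .
  qed
  moreover have "(\<lambda>m. 2 * (1 / real N) ^ m) \<longlonglongrightarrow> 2 * 0"
    using N2 by (intro tendsto_mult tendsto_const LIMSEQ_power_zero) auto
  ultimately have "seqs.prob {\<omega>. coding \<omega> = x} \<le> 0"
    by (intro LIMSEQ_le_const[of "\<lambda>m. 2 * (1 / real N) ^ m"]) auto
  thus ?thesis using measure_nonneg[of seqs] by (simp add: order_antisym)
qed

text \<open>Having prefix js implies being coded into the cylinder of js, and the converse fails
  only for streams coded into its overlaps with other cylinders of the same level. These overlaps
  are finite, hence null by \<open>coding_atom\<close>.\<close>

lemma coding_cylinder: "js \<in> words m \<Longrightarrow> seqs.prob {\<omega>. coding \<omega> \<in> cylinder R js} = (1 / N) ^ m"
proof -
  assume js: "js \<in> words m"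
  have sets: "{\<omega>. prefix_word m \<omega> = ks} \<in> sets seqs" for m ks
    using measurable_sets[OF prefix_word_measurable[of m], of "{ks}"] by (simp add: vimage_def)
  have csets: "{\<omega>. coding \<omega> \<in> A} \<in> sets seqs" if "A \<in> sets borel" for A
    using measurable_sets[OF coding_measurable that] by (simp add: vimage_def)
  have null: "seqs.prob {\<omega>. coding \<omega> \<in> A} = 0" if "finite A" for A
    using that
  proof (induction A)
    case (insert x A)
    have "seqs.prob {\<omega>. coding \<omega> \<in> insert x A} = seqs.prob ({\<omega>. coding \<omega> = x} \<union> {\<omega>. coding \<omega> \<in> A})"
      by (rule arg_cong[where f=seqs.prob]) auto
    also have "\<dots> \<le> seqs.prob {\<omega>. coding \<omega> = x} + seqs.prob {\<omega>. coding \<omega> \<in> A}"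
      using csets[of "{x}"] csets[of A] insert by (intro measure_Un_le) (auto simp: finite_imp_closed borel_closed)
    finally show ?case using insert coding_atom measure_nonneg[of seqs] by (simp add: order_antisym)
  qed simp
  define D where "D = (\<Union>js'\<in>words m - {js}. cylinder R js \<inter> cylinder R js')"
  have D: "finite D" unfolding D_def
    by (intro finite_UN_I finite_Diff finite_words cylinders_overlap_finite[OF js]) auto
  have "{\<omega>. coding \<omega> \<in> cylinder R js} \<subseteq> {\<omega>. prefix_word m \<omega> = js} \<union> {\<omega>. coding \<omega> \<in> D}"
    using coding_mem[of _ m] prefix_word_mem[of m] by (auto simp: D_def)
  hence "seqs.prob {\<omega>. coding \<omega> \<in> cylinder R js} \<le> seqs.prob ({\<omega>. prefix_word m \<omega> = js} \<union> {\<omega>. coding \<omega> \<in> D})"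
    using D by (intro seqs.finite_measure_mono sets.Un sets csets borel_closed finite_imp_closed)
  also have "\<dots> \<le> seqs.prob {\<omega>. prefix_word m \<omega> = js} + seqs.prob {\<omega>. coding \<omega> \<in> D}"
    using D by (intro measure_Un_le sets csets borel_closed finite_imp_closed)
  also have "\<dots> = (1 / N) ^ m" using null[OF D] prob_prefix_word[OF js] by simp
  finally have 1: "seqs.prob {\<omega>. coding \<omega> \<in> cylinder R js} \<le> (1 / N) ^ m" .
  have "seqs.prob {\<omega>. prefix_word m \<omega> = js} \<le> seqs.prob {\<omega>. coding \<omega> \<in> cylinder R js}"
    by (intro seqs.finite_measure_mono csets borel_closed compact_imp_closed cylinder_compact[OF js])
       (use coding_mem in auto)
  thus ?thesis using 1 prob_prefix_word[OF js] by simp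
qed

lemma balanced_measure_exists: "is_balanced_measure R (distr seqs borel coding)"
  unfolding is_balanced_measure_def deg
proof (intro conjI allI impI)
  show "prob_space (distr seqs borel coding)" by (rule seqs.prob_space_distr) measurable
  show "measure (distr seqs borel coding) (rjulia R) = 1"
    using rjulia_compact coding_rjulia seqs.prob_space
    by (subst measure_distr) (auto intro!: borel_closed compact_imp_closed simp: vimage_def)
  fix js assume "set js \<subseteq> {1..N}"
  hence js: "js \<in> words (length js)" by (simp add: words_def)
  have "measure (distr seqs borel coding) (cylinder R js) = seqs.prob {\<omega>. coding \<omega> \<in> cylinder R js}"
    using cylinder_compact[OF js]
    by (subst measure_distr) (auto intro!: borel_closed compact_imp_closed simp: vimage_def)
  thus "measure (distr seqs borel coding) (cylinder R js) = 1 / real N ^ length js"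
    using coding_cylinder[OF js] by (simp add: power_one_over)
qed simp

abbreviation \<kappa> :: "real measure" where "\<kappa> \<equiv> balanced_measure R"

text \<open>Existence makes the choice in \<open>balanced_measure\<close> meaningful; every later
  fact about \<kappa> is read off from the defining property.\<close>

lemma kappa_balanced: "is_balanced_measure R \<kappa>"
  unfolding balanced_measure_def using balanced_measure_exists by (rule someI)

section \<open>The meromorphic continuation\<close>

lemma kappa_prob: "prob_space \<kappa>" and sets_kappa [measurable_cong]: "sets \<kappa> = sets borel"
  and kappa_rjulia: "measure \<kappa> (rjulia R) = 1"
  using kappa_balanced by (auto simp: is_balanced_measure_def)

lemma kappa_cylinder: "js \<in> words m \<Longrightarrow> measure \<kappa> (cylinder R js) = 1 / real N ^ m"
  using kappa_balanced by (auto simp: is_balanced_measure_def deg words_def)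

lemma cylinder_sets [measurable]: "js \<in> words m \<Longrightarrow> cylinder R js \<in> sets borel"
  by (intro borel_closed compact_imp_closed cylinder_compact)

lemma AE_rjulia: "AE x in \<kappa>. x \<in> rjulia R"
proof -
  interpret prob_space \<kappa> by (rule kappa_prob)
  show ?thesis using kappa_rjulia by (rule AE_prob_1)
qed

text \<open>The number of cylinders of level m containing x is at least 1 on the Julia set and has
  integral N^m N^(-m) = 1, so it equals 1 almost everywhere.\<close>

lemma AE_unique_cylinder: "AE x in \<kappa>. (\<Sum>js\<in>words m. indicator (cylinder R js) x :: real) = 1"
proof -
  interpret prob_space \<kappa> by (rule kappa_prob)
  define n where "n x = (\<Sum>js\<in>words m. indicator (cylinder R js) x :: real)" for x
  have int: "integrable \<kappa> (\<lambda>x. indicator (cylinder R js) x :: real)" if "js \<in> words m" for js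
    using cylinder_sets[OF that] by (intro integrable_real_indicator) (auto simp: sets_kappa emeasure_eq_measure)
  have intn: "integrable \<kappa> n" unfolding n_def using int by (intro Bochner_Integration.integrable_sum) auto
  have "integral\<^sup>L \<kappa> n = (\<Sum>js\<in>words m. measure \<kappa> (cylinder R js))"
    unfolding n_def using int cylinder_sets sets_eq_imp_space_eq[OF sets_kappa]
    by (subst Bochner_Integration.integral_sum) (auto intro!: sum.cong)
  also have "\<dots> = 1" using N2 by (simp add: kappa_cylinder card_words)
  finally have "(\<integral>x. n x - 1 \<partial>\<kappa>) = 0" using intn by (subst Bochner_Integration.integral_diff) (auto simp: prob_space)
  moreover have "AE x in \<kappa>. 0 \<le> n x - 1"
    using AE_rjulia
  proof eventually_elim
    case (elim x)
    obtain js where js: "js \<in> words m" "x \<in> cylinder R js" using rjulia_cylinders[OF elim] by blast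
    have "1 = (indicator (cylinder R js) x :: real)" using js by simp
    also have "\<dots> \<le> n x" unfolding n_def by (rule member_le_sum[OF js(1)]) auto
    finally show ?case by simp
  qed
  ultimately have "AE x in \<kappa>. n x - 1 = 0"
    using integral_nonneg_eq_0_iff_AE[of \<kappa> "\<lambda>x. n x - 1"] intn by auto
  thus ?thesis by eventually_elim (simp add: n_def)
qed

text \<open>Almost every Julia point lies in exactly one cylinder of level m + 1; it belongs to
  \<open>julia_plus R\<close> exactly when the first letter of that cylinder is not 1.\<close>

lemma AE_julia_plus: "AE x in \<kappa>. indicator (julia_plus R) x =
    (\<Sum>ks\<in>words m. \<Sum>j=2..N. indicator (cylinder R (j # ks)) x :: real)"
  using AE_rjulia AE_unique_cylinder[of "Suc m"]
proof eventually_elim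
  case (elim x)
  define f where "f j ks = (indicator (cylinder R (j # ks)) x :: real)" for j ks
  have le: "(\<Sum>j=2..N. f j ks) \<le> (\<Sum>j=1..N. f j ks)" for ks
    by (rule sum_mono2) (auto simp: f_def)
  have "(\<Sum>ks\<in>words m. \<Sum>j=2..N. f j ks) \<le> (\<Sum>ks\<in>words m. \<Sum>j=1..N. f j ks)" by (intro sum_mono le)
  also have "\<dots> = 1" using elim(2) by (simp add: sum_words_Suc f_def)
  finally have le1: "(\<Sum>ks\<in>words m. \<Sum>j=2..N. f j ks) \<le> 1" .
  show ?case unfolding f_def[symmetric]
  proof (cases "x \<in> julia_plus R")
    case True
    then obtain k y where k: "k \<in> {2..N}" "y \<in> rjulia R" "x = \<phi> k y" by (auto simp: julia_plus_def deg)
    obtain ls where ls: "ls \<in> words m" "y \<in> cylinder R ls" using rjulia_cylinders k(2) by blast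
    have "1 = f k ls" using k ls by (auto simp: f_def cylinder_Cons)
    also have "\<dots> \<le> (\<Sum>j=2..N. f j ls)" by (rule member_le_sum[OF k(1)]) (auto simp: f_def)
    also have "\<dots> \<le> (\<Sum>ks\<in>words m. \<Sum>j=2..N. f j ks)"
      by (rule member_le_sum[OF ls(1)]) (auto simp: f_def intro!: sum_nonneg)
    finally show "indicator (julia_plus R) x = (\<Sum>ks\<in>words m. \<Sum>j=2..N. f j ks)" using le1 True by simp
  next
    case False
    have "f j ks = 0" if "j \<in> {2..N}" "ks \<in> words m" for j ks
    proof (rule ccontr)
      assume "f j ks \<noteq> 0"
      hence x: "x \<in> cylinder R (j # ks)" by (auto simp: f_def indicator_def split: if_splits)
      have j: "j \<in> {1..N}" using that by auto
      have "\<phi> j (poly P x) = x" using mem_cylinder_Cons[OF j that(2) x] by (intro phi_eq[OF j]) auto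
      moreover have "poly P x \<in> rjulia R" using elim(1) rjulia_invariant by simp
      ultimately have "x \<in> julia_plus R" unfolding julia_plus_def deg using that(1) by force
      thus False using False by simp
    qed
    thus "indicator (julia_plus R) x = (\<Sum>ks\<in>words m. \<Sum>j=2..N. f j ks)" using False by simp
  qed
qed

lemma julia_plus_sets: "julia_plus R \<in> sets borel"
proof -
  have "rjulia R \<subseteq> {0..B}" using rjulia_nonneg rjulia_le beta_le_B by force
  hence "compact (\<phi> k ` rjulia R)" if "k \<in> {2..N}" for k
    using that by (intro compact_continuous_image continuous_on_subset[OF phi_continuous] rjulia_compact) auto
  hence "compact (julia_plus R)" unfolding julia_plus_def deg by (intro compact_UN) auto
  thus ?thesis by (intro borel_closed compact_imp_closed)
qed

lemma julia_plus_range: "julia_plus R \<subseteq> {b 1..\<beta>}"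
proof
  fix x assume "x \<in> julia_plus R"
  then obtain k y where k: "k \<in> {2..N}" "y \<in> rjulia R" "x = \<phi> k y" by (auto simp: julia_plus_def deg)
  thus "x \<in> {b 1..\<beta>}" using outer_range[of k y] rjulia_nonneg[of y] rjulia_le[of y] beta_le_B by auto
qed

lemma cylinder_outer_range: "j \<in> {2..N} \<Longrightarrow> ks \<in> words m \<Longrightarrow> cylinder R (j # ks) \<subseteq> {b 1..\<beta>}"
  using outer_range[of j] cylinder_range[of ks m] beta_le_B by (force simp: cylinder_Cons)

text \<open>\<K> is controlled only on \<open>I0 R\<close>. Clamping the argument to [b 1, \<beta>]
  yields a function that is monotone on the whole line, hence Borel, and bounded away from
  0.\<close>

definition clampK :: "real \<Rightarrow> real" where "clampK x = \<K> (max (b 1) (min x \<beta>))"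

definition gm :: "complex \<Rightarrow> real \<Rightarrow> complex" where "gm s x = exp (- s / 2 * of_real (ln (clampK x)))"

lemma clampK_range: "b 1 \<le> clampK x" "clampK x \<le> \<beta> * E"
  using koenigs_outer_range[of "max (b 1) (min x \<beta>)"] b1_less by (auto simp: clampK_def)

lemma gm_measurable [measurable]: "gm s \<in> borel_measurable borel"
proof -
  have "mono clampK" unfolding clampK_def
    by (intro monoI koenigs_mono) (use b1_pos b1_less beta_le_B in auto)
  hence [measurable]: "clampK \<in> borel_measurable borel" by (rule borel_measurable_mono)
  show ?thesis unfolding gm_def[abs_def] by measurable
qed

lemma gm_eq: "x \<in> {b 1..\<beta>} \<Longrightarrow> gm s x = g s x"
  using koenigs_outer_range[of x] b1_pos
  by (auto simp: gm_def g_def clampK_def powr_def Ln_of_real max_absorb2 min_absorb1)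

lemma gm_bound: "norm (gm s x) \<le> exp (norm s / 2 * (\<bar>ln (b 1)\<bar> + \<bar>ln (\<beta> * E)\<bar>))"
proof -
  have "\<bar>ln (clampK x)\<bar> \<le> \<bar>ln (b 1)\<bar> + \<bar>ln (\<beta> * E)\<bar>"
  proof -
    have "0 < clampK x" using clampK_range(1)[of x] b1_pos by linarith
    hence "ln (b 1) \<le> ln (clampK x)" "ln (clampK x) \<le> ln (\<beta> * E)" using clampK_range[of x] b1_pos by auto
    thus ?thesis by linarith
  qed
  hence "norm (- s / 2 * of_real (ln (clampK x))) \<le> norm s / 2 * (\<bar>ln (b 1)\<bar> + \<bar>ln (\<beta> * E)\<bar>)"
    by (simp add: norm_mult norm_divide mult_left_mono)
  hence "exp (Re (- s / 2 * of_real (ln (clampK x)))) \<le> exp (norm s / 2 * (\<bar>ln (b 1)\<bar> + \<bar>ln (\<beta> * E)\<bar>))"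
    using complex_Re_le_cmod order.trans by (simp only: exp_le_cancel_iff) blast
  thus ?thesis by (simp only: gm_def norm_exp_eq_Re)
qed

lemma integrable_gm: "A \<in> sets borel \<Longrightarrow> integrable \<kappa> (\<lambda>x. indicator A x *\<^sub>R gm s x)"
proof -
  assume [measurable]: "A \<in> sets borel"
  interpret prob_space \<kappa> by (rule kappa_prob)
  show ?thesis
  proof (rule integrable_const_bound)
    show "AE x in \<kappa>. norm (indicator A x *\<^sub>R gm s x) \<le> exp (norm s / 2 * (\<bar>ln (b 1)\<bar> + \<bar>ln (\<beta> * E)\<bar>))"
      using gm_bound by (intro AE_I2) (auto simp: indicator_def)
  qed measurable
qed

lemma xi_cylinders:
  "xi_fun R s = (\<Sum>ks\<in>words m. \<Sum>j=2..N. \<integral>x. indicator (cylinder R (j # ks)) x *\<^sub>R gm s x \<partial>\<kappa>)"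
proof -
  have cyl: "cylinder R (j # ks) \<in> sets borel" if "j \<in> {2..N}" "ks \<in> words m" for j ks
    using that by (intro cylinder_sets[of _ "Suc m"]) auto
  have "xi_fun R s = (\<integral>x. indicator (julia_plus R) x *\<^sub>R g s x \<partial>\<kappa>)"
    by (simp add: xi_fun_def set_lebesgue_integral_def g_def)
  also have "\<dots> = (\<integral>x. indicator (julia_plus R) x *\<^sub>R gm s x \<partial>\<kappa>)"
    using julia_plus_range gm_eq by (intro Bochner_Integration.integral_cong refl) (auto simp: indicator_def)
  also have "\<dots> = (\<integral>x. (\<Sum>ks\<in>words m. \<Sum>j=2..N. indicator (cylinder R (j # ks)) x *\<^sub>R gm s x) \<partial>\<kappa>)"
  proof (rule integral_cong_AE)
    show "(\<lambda>x. indicator (julia_plus R) x *\<^sub>R gm s x) \<in> borel_measurable \<kappa>"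
      using integrable_gm[OF julia_plus_sets] by (rule borel_measurable_integrable)
    show "(\<lambda>x. \<Sum>ks\<in>words m. \<Sum>j=2..N. indicator (cylinder R (j # ks)) x *\<^sub>R gm s x) \<in> borel_measurable \<kappa>"
      using integrable_gm[OF cyl] by (intro borel_measurable_sum borel_measurable_integrable) auto
    show "AE x in \<kappa>. indicator (julia_plus R) x *\<^sub>R gm s x =
        (\<Sum>ks\<in>words m. \<Sum>j=2..N. indicator (cylinder R (j # ks)) x *\<^sub>R gm s x)"
      using AE_julia_plus[of m] by eventually_elim (simp add: scaleR_left.sum)
  qed
  also have "\<dots> = (\<Sum>ks\<in>words m. \<Sum>j=2..N. \<integral>x. indicator (cylinder R (j # ks)) x *\<^sub>R gm s x \<partial>\<kappa>)"
  proof -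
    have "(\<integral>x. (\<Sum>ks\<in>words m. \<Sum>j=2..N. indicator (cylinder R (j # ks)) x *\<^sub>R gm s x) \<partial>\<kappa>) =
      (\<Sum>ks\<in>words m. \<integral>x. (\<Sum>j=2..N. indicator (cylinder R (j # ks)) x *\<^sub>R gm s x) \<partial>\<kappa>)"
      by (intro Bochner_Integration.integral_sum Bochner_Integration.integrable_sum integrable_gm cyl)
    also have "\<dots> = (\<Sum>ks\<in>words m. \<Sum>j=2..N. \<integral>x. indicator (cylinder R (j # ks)) x *\<^sub>R gm s x \<partial>\<kappa>)"
      by (intro sum.cong refl Bochner_Integration.integral_sum integrable_gm cyl)
    finally show ?thesis .
  qed
  finally show ?thesis .
qed

text \<open>The integral and the average are compared cylinder by cylinder: the masses agree, and on
  one cylinder the integrand varies by at most \<open>lip r\<close> times the oscillation of \<K>.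
  All these oscillations sum to at most \<open>\<K> B\<close> by
  \<open>dsum_monotone_le\<close>.\<close>

lemma xi_av_diff:
  assumes s: "norm s \<le> r" and y: "0 \<le> y" "y \<le> B"
  shows "norm (xi_fun R s - av m s y) \<le> lip r * \<K> B / real N ^ Suc m"
proof -
  interpret prob_space \<kappa> by (rule kappa_prob)
  have r: "r \<ge> 0" using s norm_ge_zero order.trans by blast
  have av: "av m s y = (\<Sum>ks\<in>words m. \<Sum>j=2..N. g s (\<phi> j (\<phi>s ks y)) / of_nat (N ^ Suc m))"
    by (simp add: av_def wsum_words outer_def sum_divide_distrib)
  have *: "norm ((\<integral>x. indicator (cylinder R (j # ks)) x *\<^sub>R gm s x \<partial>\<kappa>) - g s (\<phi> j (\<phi>s ks y)) / of_nat (N ^ Suc m))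
      \<le> lip r * \<bar>\<K> (\<phi>s (j # ks) B) - \<K> (\<phi>s (j # ks) 0)\<bar> / real N ^ Suc m"
    if j: "j \<in> {2..N}" and ks: "ks \<in> words m" for j ks
  proof -
    define C where "C = cylinder R (j # ks)"
    define p where "p = \<phi>s (j # ks) y"
    define D where "D = lip r * \<bar>\<K> (\<phi>s (j # ks) B) - \<K> (\<phi>s (j # ks) 0)\<bar>"
    have w: "j # ks \<in> words (Suc m)" using j ks by auto
    have C [measurable]: "C \<in> sets borel" unfolding C_def by (rule cylinder_sets[OF w])
    have mC: "measure \<kappa> C = 1 / real N ^ Suc m" unfolding C_def by (rule kappa_cylinder[OF w])
    have ir: "integrable \<kappa> (\<lambda>x. indicator C x :: real)"
      by (intro integrable_real_indicator) (auto simp: emeasure_eq_measure sets_kappa)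
    have p: "p \<in> {b 1..\<beta>}" using outer_range[OF j, of "\<phi>s ks y"] phis_range[OF ks y] by (auto simp: p_def)
    have osc: "norm (gm s x - gm s p) \<le> D" if "x \<in> C" for x
    proof -
      define F where "F = \<phi>s (j # ks)"
      have "x \<in> F ` {0..\<beta>}" using that by (simp only: C_def cylinder_eq F_def)
      then obtain x' where x': "0 \<le> x'" "x' \<le> B" "x = F x'" using beta_le_B by auto
      have xr: "x \<in> {b 1..\<beta>}" using that cylinder_outer_range[OF j ks] by (auto simp: C_def)
      have rng: "0 \<le> F t" "F t \<le> B" if "0 \<le> t" "t \<le> B" for t
        using phis_range[OF w that] by (auto simp only: F_def)
      have pF: "p = F y" by (simp only: p_def F_def)
      have "\<bar>\<K> x - \<K> p\<bar> \<le> \<bar>\<K> (F B) - \<K> (F 0)\<bar>"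
        using phis_monotone[OF w] unfolding F_def[symmetric]
      proof
        assume *: "\<forall>x y. 0 \<le> x \<longrightarrow> x \<le> y \<longrightarrow> y \<le> B \<longrightarrow> F x \<le> F y"
        have mono: "\<K> (F u) \<le> \<K> (F v)" if "0 \<le> u" "u \<le> v" "v \<le> B" for u v
          by (intro koenigs_mono) (use * rng[of u] rng[of v] that in auto)
        show ?thesis
          using mono[OF order.refl x'(1,2)] mono[OF x'(1,2) order.refl] mono[OF order.refl y] mono[OF y order.refl]
          unfolding pF x'(3) by linarith
      next
        assume *: "\<forall>x y. 0 \<le> x \<longrightarrow> x \<le> y \<longrightarrow> y \<le> B \<longrightarrow> F y \<le> F x"
        have mono: "\<K> (F v) \<le> \<K> (F u)" if "0 \<le> u" "u \<le> v" "v \<le> B" for u v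
          by (intro koenigs_mono) (use * rng[of u] rng[of v] that in auto)
        show ?thesis
          using mono[OF order.refl x'(1,2)] mono[OF x'(1,2) order.refl] mono[OF order.refl y] mono[OF y order.refl]
          unfolding pF x'(3) by linarith
      qed
      hence "lip r * \<bar>\<K> x - \<K> p\<bar> \<le> D" unfolding D_def F_def using lip_nonneg[OF r] by (intro mult_left_mono) auto
      moreover have "norm (gm s x - gm s p) \<le> lip r * \<bar>\<K> x - \<K> p\<bar>"
        unfolding gm_eq[OF xr] gm_eq[OF p] g_def
        using xr p by (intro powr_lipschitz s koenigs_outer_range) auto
      ultimately show ?thesis by linarith
    qed
    have "(\<integral>x. indicator C x *\<^sub>R gm s p \<partial>\<kappa>) = measure \<kappa> C *\<^sub>R gm s p"
      using ir C sets_eq_imp_space_eq[OF sets_kappa] by (subst integral_scaleR_left) auto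
    hence "g s (\<phi> j (\<phi>s ks y)) / of_nat (N ^ Suc m) = (\<integral>x. indicator C x *\<^sub>R gm s p \<partial>\<kappa>)"
      using gm_eq[OF p] by (simp add: mC scaleR_conv_of_real p_def)
    hence "(\<integral>x. indicator C x *\<^sub>R gm s x \<partial>\<kappa>) - g s (\<phi> j (\<phi>s ks y)) / of_nat (N ^ Suc m) =
        (\<integral>x. indicator C x *\<^sub>R gm s x - indicator C x *\<^sub>R gm s p \<partial>\<kappa>)"
      using integrable_gm[OF C, of s] ir by (subst Bochner_Integration.integral_diff) auto
    also have "norm \<dots> \<le> (\<integral>x. indicator C x * D \<partial>\<kappa>)"
      using integrable_gm[OF C, of s] ir osc
      by (intro Bochner_Integration.integral_norm_bound_integral Bochner_Integration.integrable_diff integrable_scaleR_left integrable_mult_left)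
         (auto simp: indicator_def)
    also have "\<dots> = measure \<kappa> C * D"
      using ir C sets_eq_imp_space_eq[OF sets_kappa] by (subst integral_mult_left_zero) auto
    also have "\<dots> = D / real N ^ Suc m" unfolding mC by simp
    finally show ?thesis unfolding C_def D_def .
  qed
  have "xi_fun R s - av m s y = (\<Sum>ks\<in>words m. \<Sum>j=2..N. (\<integral>x. indicator (cylinder R (j # ks)) x *\<^sub>R gm s x \<partial>\<kappa>) - g s (\<phi> j (\<phi>s ks y)) / of_nat (N ^ Suc m))"
    unfolding xi_cylinders[of s m] av sum_subtractf ..
  also have "norm \<dots> \<le> (\<Sum>ks\<in>words m. \<Sum>j=2..N. lip r * \<bar>\<K> (\<phi>s (j # ks) B) - \<K> (\<phi>s (j # ks) 0)\<bar> / real N ^ Suc m)"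
    by (intro sum_norm_le *)
  also have "\<dots> \<le> (\<Sum>ks\<in>words m. \<Sum>j=1..N. lip r * \<bar>\<K> (\<phi>s (j # ks) B) - \<K> (\<phi>s (j # ks) 0)\<bar> / real N ^ Suc m)"
    using lip_nonneg[OF r] by (intro sum_mono sum_mono2) auto
  also have "\<dots> = lip r / real N ^ Suc m * dsum (Suc m) (\<lambda>x y. \<bar>\<K> x - \<K> y\<bar>) B 0"
    unfolding dsum_words sum_words_Suc by (simp add: sum_distrib_left)
  also have "\<dots> \<le> lip r / real N ^ Suc m * (\<K> B - \<K> 0)"
    using lip_nonneg[OF r] koenigs_mono B_pos by (intro mult_left_mono dsum_monotone_le) auto
  finally show ?thesis by (simp add: koenigs_0)
qed

lemma av_tendsto_xi:
  assumes "0 \<le> y" "y \<le> B" shows "(\<lambda>m. av m s y) \<longlonglongrightarrow> xi_fun R s"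
proof -
  have "(\<lambda>m. lip (norm s) * \<K> B * (1 / real N) ^ Suc m) \<longlonglongrightarrow> lip (norm s) * \<K> B * 0"
    using N2 by (intro tendsto_intros LIMSEQ_Suc LIMSEQ_power_zero) auto
  hence lim: "(\<lambda>m. lip (norm s) * \<K> B / real N ^ Suc m) \<longlonglongrightarrow> 0" by (simp add: power_one_over)
  have "norm (av m s y - xi_fun R s) \<le> lip (norm s) * \<K> B / real N ^ Suc m" for m
    using xi_av_diff[of s "norm s" y m] assms by (simp add: norm_minus_commute)
  hence "(\<lambda>m. av m s y - xi_fun R s) \<longlonglongrightarrow> 0"
    by (intro Lim_null_comparison[OF _ lim] always_eventually) auto
  thus ?thesis by (simp add: LIM_zero_iff)
qed

lemma av_Suc: "av (Suc m) s y = (\<Sum>j=1..N. av m s (\<phi> j y)) / of_nat N"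
  using N2 by (simp add: av_def sum_divide_distrib field_simps)

lemma norm_average_le:
  fixes a :: complex
  assumes "\<And>j. j \<in> {1..N} \<Longrightarrow> norm (a - f j) \<le> e"
  shows "norm (a - (\<Sum>j=1..N. f j) / of_nat N) \<le> e"
proof -
  have "a - (\<Sum>j=1..N. f j) / of_nat N = (\<Sum>j=1..N. a - f j) / of_nat N"
    using N2 by (simp add: sum_subtractf diff_divide_distrib)
  also have "norm \<dots> = norm (\<Sum>j=1..N. a - f j) / real N"
    by (simp add: norm_divide)
  also have "\<dots> \<le> (\<Sum>j=1..N. e) / real N" using assms by (intro divide_right_mono sum_norm_le) auto
  finally show ?thesis using N2 by simp
qed

text \<open>\<open>av (m + l) s v\<close> averages \<open>av m s\<close> over the images of v under
  words of length l, so the bound e persists as l tends to infinity and compares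
  \<open>av m s\<close> with \<open>xi_fun R s\<close>. The hypothesis covers the hull only; a base
  point beyond \<beta> enters it after one letter, hence \<open>Suc m\<close>.\<close>

lemma av_xi_of_oscillation:
  assumes "\<And>u v. 0 \<le> u \<Longrightarrow> u \<le> \<beta> \<Longrightarrow> 0 \<le> v \<Longrightarrow> v \<le> \<beta> \<Longrightarrow> norm (av m s u - av m s v) \<le> e"
    and "0 \<le> z0" "z0 \<le> B"
  shows "norm (av (Suc m) s z0 - xi_fun R s) \<le> e"
proof -
  have 1: "norm (av m s u - av (m + l) s v) \<le> e" if "0 \<le> u" "u \<le> \<beta>" "0 \<le> v" "v \<le> \<beta>" for u v l
    using that
  proof (induction l arbitrary: v)
    case (Suc l)
    show ?case unfolding add_Suc_right av_Suc
      by (intro norm_average_le Suc.IH) (use phi_range[of _ v] Suc.prems beta_le_B in auto)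
  qed (use assms in auto)
  have 2: "norm (xi_fun R s - av m s u) \<le> e" if "0 \<le> u" "u \<le> \<beta>" for u
  proof -
    have "(\<lambda>l. av m s u - av (m + l) s 0) \<longlonglongrightarrow> av m s u - xi_fun R s"
      using LIMSEQ_ignore_initial_segment[OF av_tendsto_xi[of 0 s], of m] B_pos
      by (intro tendsto_intros) (simp add: add.commute)
    hence "norm (av m s u - xi_fun R s) \<le> e"
      by (intro Lim_bounded[OF tendsto_norm, of _ _ 0]) (use 1[OF that, of 0] beta_pos in auto)
    thus ?thesis by (simp add: norm_minus_commute)
  qed
  have "norm (xi_fun R s - av (Suc m) s z0) \<le> e" unfolding av_Suc
    by (intro norm_average_le 2) (use phi_range[of _ z0] assms in auto)
  thus ?thesis by (simp add: norm_minus_commute)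
qed

lemma xi_holomorphic: "xi_fun R holomorphic_on UNIV"
proof (rule holomorphic_uniform_sequence)
  show "(\<lambda>s. av m s 0) holomorphic_on UNIV" for m using B_pos by (intro av_holomorphic) auto
  fix x :: complex
  have "uniform_limit (cball x 1) (\<lambda>m s. av m s 0) (xi_fun R) sequentially"
  proof (rule uniform_limitI)
    fix e :: real assume e: "e > 0"
    define r where "r = norm x + 1"
    have "(\<lambda>m. lip r * \<K> B * (1 / real N) ^ Suc m) \<longlonglongrightarrow> lip r * \<K> B * 0"
      using N2 by (intro tendsto_intros LIMSEQ_Suc LIMSEQ_power_zero) auto
    hence "(\<lambda>m. lip r * \<K> B / real N ^ Suc m) \<longlonglongrightarrow> 0" by (simp add: power_one_over)
    hence "\<forall>\<^sub>F m in sequentially. lip r * \<K> B / real N ^ Suc m < e" using e by (rule order_tendstoD)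
    thus "\<forall>\<^sub>F m in sequentially. \<forall>s\<in>cball x 1. dist (av m s 0) (xi_fun R s) < e"
    proof eventually_elim
      case (elim m)
      show ?case
      proof
        fix s assume "s \<in> cball x 1"
        hence "norm s \<le> r" using norm_triangle_ineq2[of s x] by (simp add: r_def dist_norm norm_minus_commute)
        from xi_av_diff[OF this, of 0 m] B_pos elim
        show "dist (av m s 0) (xi_fun R s) < e" by (simp add: dist_norm norm_minus_commute)
      qed
    qed
  qed
  thus "\<exists>d>0. cball x d \<subseteq> UNIV \<and> uniform_limit (cball x d) (\<lambda>m s. av m s 0) (xi_fun R) sequentially"
    by (intro exI[of _ 1]) auto
qed auto

text \<open>What remains of the series after splitting off \<open>xi_fun R s\<close> times a
  geometric series. Since the exponents start at 1, that series is 1/(1 - q) - 1, which accounts for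
  the isolated term \<open>- xi_fun R s\<close>.\<close>

definition psi :: "real \<Rightarrow> complex \<Rightarrow> complex" where
  "psi z0 s = g s z0 - xi_fun R s + (\<Sum>m. q s ^ Suc m * (av m s z0 - xi_fun R s))"

lemma q_holomorphic: "q holomorphic_on A"
  unfolding q_def using c1 by (intro holomorphic_intros) (auto simp: complex_nonpos_Reals_iff)

text \<open>The terms are bounded by C |q|^(m+1) \<delta>^m with |q| = N c^(-Re s/2), and the
  condition on \<sigma> ensures \<delta> |q| < 1 strictly to the right of \<sigma>.\<close>

lemma psi_holomorphic:
  assumes z0: "0 \<le> z0" "z0 \<le> B" and \<delta>: "\<delta> > 0"
    and bound: "\<And>r. \<exists>C. \<forall>s m. norm s \<le> r \<longrightarrow> norm (av m s z0 - xi_fun R s) \<le> C * \<delta> ^ m"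
    and \<sigma>: "\<delta> * (N * c powr (- \<sigma> / 2)) \<le> 1"
  shows "psi z0 holomorphic_on {s. Re s > \<sigma>}"
proof -
  have "(\<lambda>s. \<Sum>m. q s ^ Suc m * (av m s z0 - xi_fun R s)) holomorphic_on {s. Re s > \<sigma>}"
  proof (rule holomorphic_uniform_sequence)
    show "open {s. Re s > \<sigma>}" by (rule open_halfspace_Re_gt)
    show "(\<lambda>s. \<Sum>m<n. q s ^ Suc m * (av m s z0 - xi_fun R s)) holomorphic_on {s. Re s > \<sigma>}" for n
      using z0 by (intro holomorphic_intros q_holomorphic av_holomorphic holomorphic_on_subset[OF xi_holomorphic]) auto
    fix x assume x: "x \<in> {s. Re s > \<sigma>}"
    define d where "d = (Re x - \<sigma>) / 2"
    have d: "d > 0" using x by (simp add: d_def)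
    define Q where "Q = N * c powr (- (Re x - d) / 2)"
    have Re: "Re s \<ge> Re x - d" if "s \<in> cball x d" for s
      using that abs_Re_le_cmod[of "x - s"] by (simp add: dist_norm)
    have sub: "cball x d \<subseteq> {s. Re s > \<sigma>}"
    proof
      fix s assume "s \<in> cball x d"
      from Re[OF this] x show "s \<in> {s. Re s > \<sigma>}" by (simp add: d_def field_simps)
    qed
    have "Q < N * c powr (- \<sigma> / 2)"
      unfolding Q_def using c1 x N2 by (intro mult_strict_left_mono powr_less_mono) (auto simp: d_def field_simps)
    hence "\<delta> * Q < \<delta> * (N * c powr (- \<sigma> / 2))" using \<delta> by (intro mult_strict_left_mono)
    hence Q: "\<delta> * Q < 1" "Q \<ge> 0" using \<sigma> by (auto simp: Q_def)
    obtain C where C: "\<And>s m. norm s \<le> norm x + d \<Longrightarrow> norm (av m s z0 - xi_fun R s) \<le> C * \<delta> ^ m"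
      using bound[of "norm x + d"] by blast
    have "uniform_limit (cball x d) (\<lambda>n s. \<Sum>m<n. q s ^ Suc m * (av m s z0 - xi_fun R s))
       (\<lambda>s. \<Sum>m. q s ^ Suc m * (av m s z0 - xi_fun R s)) sequentially"
    proof (rule Weierstrass_m_test)
      fix m s assume s: "s \<in> cball x d"
      have "norm s \<le> norm x + d" using s norm_triangle_ineq2[of s x] by (simp add: dist_norm norm_minus_commute)
      hence av: "norm (av m s z0 - xi_fun R s) \<le> C * \<delta> ^ m" by (rule C)
      have "norm (q s) \<le> Q" unfolding norm_q Q_def using Re[OF s] c1
        by (intro mult_left_mono powr_mono) auto
      hence "norm (q s) ^ Suc m \<le> Q ^ Suc m" by (intro power_mono) auto
      hence "norm (q s) ^ Suc m * norm (av m s z0 - xi_fun R s) \<le> Q ^ Suc m * (C * \<delta> ^ m)"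
        using av Q by (intro mult_mono) auto
      thus "norm (q s ^ Suc m * (av m s z0 - xi_fun R s)) \<le> C * Q * (\<delta> * Q) ^ m"
        by (simp add: norm_mult norm_power power_mult_distrib mult_ac)
    next
      show "summable (\<lambda>m. C * Q * (\<delta> * Q) ^ m)" using Q \<delta> by (intro summable_mult summable_geometric) auto
    qed
    thus "\<exists>d>0. cball x d \<subseteq> {s. Re s > \<sigma>} \<and> uniform_limit (cball x d)
       (\<lambda>n s. \<Sum>m<n. q s ^ Suc m * (av m s z0 - xi_fun R s))
       (\<lambda>s. \<Sum>m. q s ^ Suc m * (av m s z0 - xi_fun R s)) sequentially"
      using d sub by blast
  qed
  moreover have "(\<lambda>s. g s z0) holomorphic_on {s. Re s > \<sigma>}"
  proof (cases "z0 = 0")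
    case True
    thus ?thesis by (simp add: g_def koenigs_0)
  qed (use z0 g_holomorphic in auto)
  ultimately show ?thesis unfolding psi_def
    by (intro holomorphic_intros holomorphic_on_subset[OF xi_holomorphic]) auto
qed

lemma psi_holomorphic_right:
  assumes z0: "0 \<le> z0" "z0 \<le> B"
  shows "psi z0 holomorphic_on {s. Re s > 0}"
proof (rule psi_holomorphic[OF z0, of "1 / N"])
  fix r
  have "norm (av m s z0 - xi_fun R s) \<le> (lip r * \<K> B / N) * (1 / N) ^ m" if "norm s \<le> r" for s m
    using xi_av_diff[OF that z0, of m] by (simp add: norm_minus_commute power_one_over field_simps)
  thus "\<exists>C. \<forall>s m. norm s \<le> r \<longrightarrow> norm (av m s z0 - xi_fun R s) \<le> C * (1 / N) ^ m" by blast
qed (use N2 c1 in auto)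

lemma Re_wsum_ge:
  assumes "\<And>x. 0 \<le> x \<Longrightarrow> x \<le> B \<Longrightarrow> M \<le> Re (h x)" "0 \<le> y" "y \<le> B"
  shows "real N ^ m * M \<le> Re (wsum m h y)"
  using assms(2,3)
proof (induction m arbitrary: y)
  case (Suc m)
  have "real N ^ Suc m * M = (\<Sum>j=1..N. real N ^ m * M)" by simp
  also have "\<dots> \<le> (\<Sum>j=1..N. Re (wsum m h (\<phi> j y)))"
    using Suc phi_range[of _ y] by (intro sum_mono) auto
  finally show ?case by simp
qed (use assms(1) in auto)

text \<open>For real s the integrand is positive. To make positivity survive the limit, the averages
  are bounded below uniformly; M is a minimum over both ends of [b 1, \<beta> E] because t may have
  either sign.\<close>

lemma xi_real_nonzero: "xi_fun R (of_real t) \<noteq> 0"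
proof -
  define M where "M = min (b 1 powr (- t / 2)) ((\<beta> * E) powr (- t / 2))"
  have bE: "b 1 \<le> \<beta> * E" using koenigs_outer_range[of "b 1"] b1_less by auto
  have M: "M > 0" using b1_pos bE by (auto simp: M_def)
  have outer: "real (N - 1) * M \<le> Re (outer (g (of_real t)) x)" if x: "0 \<le> x" "x \<le> B" for x
  proof -
    have "(\<Sum>j=2..N. M) \<le> (\<Sum>j=2..N. Re (g (of_real t) (\<phi> j x)))"
    proof (rule sum_mono)
      fix j assume "j \<in> {2..N}"
      from outer_range[OF this x] have k: "\<K> (\<phi> j x) \<in> {b 1..\<beta> * E}" using koenigs_outer_range by auto
      define u where "u = \<K> (\<phi> j x)"
      have u: "b 1 \<le> u" "u \<le> \<beta> * E" "0 < u" using k b1_pos by (auto simp: u_def)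
      have "- of_real t / 2 = complex_of_real (- t / 2)" by simp
      hence "g (of_real t) (\<phi> j x) = of_real (u powr (- t / 2))"
        unfolding g_def u_def[symmetric] using u by (simp only: powr_of_real)
      moreover have "M \<le> u powr (- t / 2)"
      proof (cases "t \<ge> 0")
        case True
        hence "(\<beta> * E) powr (- t / 2) \<le> u powr (- t / 2)" using u by (intro powr_mono2') auto
        thus ?thesis by (simp add: M_def)
      next
        case False
        hence "b 1 powr (- t / 2) \<le> u powr (- t / 2)" using u b1_pos by (intro powr_mono2) auto
        thus ?thesis by (simp add: M_def)
      qed
      ultimately show "M \<le> Re (g (of_real t) (\<phi> j x))" by simp
    qed
    thus ?thesis by (simp add: outer_def)
  qed
  have "real (N - 1) * M / N \<le> Re (av m (of_real t) 0)" for m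
  proof -
    have "real N ^ m * (real (N - 1) * M) \<le> Re (wsum m (outer (g (of_real t))) 0)"
      using B_pos by (intro Re_wsum_ge outer) auto
    hence "real N ^ m * (real (N - 1) * M) / real N ^ Suc m \<le> Re (wsum m (outer (g (of_real t))) 0) / real N ^ Suc m"
      by (intro divide_right_mono) auto
    moreover have "Re (av m (of_real t) 0) = Re (wsum m (outer (g (of_real t))) 0) / real N ^ Suc m"
      unfolding av_def by (metis Re_divide_of_nat of_nat_power)
    moreover have "real N ^ m * X / real N ^ Suc m = X / N" for X using N2 by simp
    ultimately show ?thesis by (simp only:)
  qed
  moreover have "(\<lambda>m. Re (av m (of_real t) 0)) \<longlonglongrightarrow> Re (xi_fun R (of_real t))"
    using B_pos by (intro tendsto_Re av_tendsto_xi) auto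
  ultimately have "real (N - 1) * M / N \<le> Re (xi_fun R (of_real t))"
    by (intro LIMSEQ_le_const[of "\<lambda>m. Re (av m (of_real t) 0)"]) auto
  moreover have "real (N - 1) * M / N > 0" using M N2 by simp
  ultimately have "Re (xi_fun R (of_real t)) > 0" by linarith
  thus ?thesis by auto
qed

section \<open>Zeros of 1 - q and the poles\<close>

definition dR :: real where "dR = 2 * ln (real N) / ln c"

lemma q_eq_1: "q s = 1 \<longleftrightarrow> (\<exists>n::int. s = of_real dR + 4 * \<i> * of_int n * of_real pi / of_real (ln c))"
proof -
  have lc: "ln c > 0" using c1 by simp
  have "q s = exp (of_real (ln (real N)) - s / 2 * of_real (ln c))"
  proof -
    have "complex_of_real c powr (- s / 2) = exp (- s / 2 * of_real (ln c))"
      using c1 by (simp add: powr_def Ln_of_real)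
    moreover have "of_nat N = exp (complex_of_real (ln (real N)))"
      using N2 by (simp add: exp_of_real)
    ultimately show ?thesis unfolding q_def by (simp only: mult_exp_exp) simp
  qed
  hence "q s = 1 \<longleftrightarrow> Re (of_real (ln (real N)) - s / 2 * of_real (ln c)) = 0 \<and>
      (\<exists>n::int. Im (of_real (ln (real N)) - s / 2 * of_real (ln c)) = of_int (2 * n) * pi)"
    by (simp only: exp_eq_1)
  also have "\<dots> \<longleftrightarrow> Re s = dR \<and> (\<exists>n::int. Im s = 4 * (- of_int n) * pi / ln c)"
    using lc by (simp add: dR_def field_simps) (smt (verit))
  also have "\<dots> \<longleftrightarrow> Re s = dR \<and> (\<exists>n::int. Im s = 4 * of_int n * pi / ln c)"
    by (metis minus_minus of_int_minus)
  also have "\<dots> \<longleftrightarrow> (\<exists>n::int. s = of_real dR + 4 * \<i> * of_int n * of_real pi / of_real (ln c))"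
    by (auto simp: complex_eq_iff)
  finally show ?thesis .
qed

lemma dR_pos: "dR > 0" using c1 N2 by (simp add: dR_def)

lemma norm_q_less_1: "Re s > dR \<Longrightarrow> norm (q s) < 1"
proof -
  assume "Re s > dR"
  hence "ln (real N) < Re s / 2 * ln c" using c1 by (simp add: dR_def field_simps)
  hence "real N < exp (Re s / 2 * ln c)" using N2 by (metis exp_less_mono exp_ln of_nat_0_less_iff pos2 order_less_le_trans)
  thus ?thesis unfolding norm_q using c1 by (simp add: powr_def exp_minus field_simps)
qed

definition Z :: "real \<Rightarrow> complex \<Rightarrow> complex" where
  "Z z0 s = xi_fun R s / (1 - of_nat N * complex_of_real c powr (- s / 2)) + psi z0 s"

lemma Z_eq: "Z z0 s = xi_fun R s / (1 - q s) + psi z0 s" by (simp add: Z_def q_def)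

lemma zeta_eq_Z:
  assumes z0: "0 \<le> z0" "z0 \<le> B" and s: "Re s > dR"
  shows "zeta_fun R z0 s = Z z0 s"
proof -
  have q1: "norm (q s) < 1" and Re: "Re s > 0" using norm_q_less_1[OF s] s dR_pos by auto
  have qn: "q s \<noteq> 1" using q1 by auto
  have geo: "(\<lambda>m. q s ^ Suc m * xi_fun R s) sums (q s * (1 / (1 - q s)) * xi_fun R s)"
    unfolding power_Suc by (intro sums_mult2 sums_mult geometric_sums q1)
  have sum: "summable (\<lambda>m. q s ^ Suc m * av m s z0)"
    and zeta: "zeta_fun R z0 s = g s z0 + (\<Sum>m. q s ^ Suc m * av m s z0)"
    using zeta_series[OF z0 q1 Re] by auto
  have "(\<Sum>m. q s ^ Suc m * (av m s z0 - xi_fun R s)) =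
      (\<Sum>m. q s ^ Suc m * av m s z0) - (\<Sum>m. q s ^ Suc m * xi_fun R s)"
    unfolding right_diff_distrib by (rule suminf_diff[symmetric, OF sum sums_summable[OF geo]])
  also have "(\<Sum>m. q s ^ Suc m * xi_fun R s) = q s * (1 / (1 - q s)) * xi_fun R s"
    using geo by (rule sums_unique[symmetric])
  finally have "psi z0 s = zeta_fun R z0 s - xi_fun R s - q s * (1 / (1 - q s)) * xi_fun R s"
    by (simp add: psi_def zeta)
  thus ?thesis using qn by (simp add: Z_eq field_simps)
qed

lemma Z_meromorphic:
  assumes "0 \<le> z0" "z0 \<le> B" shows "Z z0 meromorphic_on {s. Re s > 0}"
proof -
  have "psi z0 meromorphic_on {s. Re s > 0}"
    using psi_holomorphic_right[OF assms] open_halfspace_Re_gt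
    by (intro analytic_on_imp_meromorphic_on) (simp add: analytic_on_open)
  moreover have "xi_fun R meromorphic_on {s. Re s > 0}"
    using holomorphic_on_subset[OF xi_holomorphic subset_UNIV] open_halfspace_Re_gt
    by (intro analytic_on_imp_meromorphic_on) (simp add: analytic_on_open)
  moreover have "q meromorphic_on {s. Re s > 0}"
    using q_holomorphic open_halfspace_Re_gt
    by (intro analytic_on_imp_meromorphic_on) (simp add: analytic_on_open)
  ultimately show ?thesis unfolding Z_eq[abs_def]
    by (intro meromorphic_intros)
qed

lemma Z_poles:
  assumes z0: "0 \<le> z0" "z0 \<le> B" and s: "Re s > 0" "is_pole (Z z0) s"
  shows "q s = 1"
proof (rule ccontr)
  assume qs: "q s \<noteq> 1"
  have "open {w. q w \<noteq> 1}"
    using holomorphic_on_imp_continuous_on[OF q_holomorphic[of UNIV]]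
    by (intro open_Collect_neq continuous_intros) auto
  hence op: "open ({w. q w \<noteq> 1} \<inter> {w. Re w > 0})" using open_halfspace_Re_gt by (intro open_Int)
  have "Z z0 holomorphic_on ({w. q w \<noteq> 1} \<inter> {w. Re w > 0})"
    unfolding Z_eq[abs_def]
    by (intro holomorphic_intros holomorphic_on_subset[OF xi_holomorphic] q_holomorphic
          holomorphic_on_subset[OF psi_holomorphic_right[OF z0]]) auto
  from not_is_pole_holomorphic[OF op _ this, of s] show False using qs s by auto
qed

lemma Z_pole_dR:
  assumes z0: "0 \<le> z0" "z0 \<le> B"
  shows "is_pole (Z z0) (of_real dR)"
proof -
  have lc: "ln c > 0" using c1 by simp
  have "q (of_real dR) = 1" unfolding q_eq_1 by (intro exI[of _ 0]) simp
  moreover have "isCont q (of_real dR)"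
    using holomorphic_on_imp_continuous_on[OF q_holomorphic[of UNIV]] by (simp add: continuous_on_eq_continuous_at)
  ultimately have lim: "((\<lambda>s. 1 - q s) \<longlongrightarrow> 1 - 1) (at (of_real dR))"
    by (intro tendsto_intros) (simp add: isCont_def)
  \<comment> \<open>Neighbouring zeros of 1 - q are 4 pi / ln c apart, so this disc contains no
    other one.\<close>
  have "eventually (\<lambda>s. s \<in> ball (of_real dR) (4 * pi / ln c) - {of_real dR}) (at (complex_of_real dR))"
    using lc by (intro eventually_at_in_open) auto
  hence ev: "eventually (\<lambda>s. 1 - q s \<noteq> 0) (at (complex_of_real dR))"
  proof eventually_elim
    case (elim s)
    show ?case
    proof
      assume "1 - q s = 0"
      then obtain n :: int where n: "s = of_real dR + 4 * \<i> * of_int n * of_real pi / of_real (ln c)"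
        using q_eq_1[of s] by auto
      have "norm (s - of_real dR) = \<bar>real_of_int n\<bar> * (4 * pi / ln c)"
        unfolding n using lc by (simp add: norm_mult norm_divide)
      moreover have "norm (s - of_real dR) < 4 * pi / ln c" using elim by (simp add: dist_norm norm_minus_commute)
      ultimately have "\<bar>real_of_int n\<bar> < 1" using lc by (simp add: field_simps)
      hence "n = 0" by linarith
      thus False using n elim by simp
    qed
  qed
  have "filterlim (\<lambda>s. 1 - q s) (at 0) (at (complex_of_real dR))"
    using lim ev by (simp add: filterlim_at)
  moreover have "(xi_fun R \<longlongrightarrow> xi_fun R (of_real dR)) (at (of_real dR))"
    using holomorphic_on_imp_continuous_on[OF xi_holomorphic] by (simp add: continuous_on_eq_continuous_at isCont_def)
  ultimately have 1: "filterlim (\<lambda>s. xi_fun R s / (1 - q s)) at_infinity (at (complex_of_real dR))"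
    using xi_real_nonzero by (intro filterlim_divide_at_infinity)
  have "isCont (psi z0) (of_real dR)"
    using holomorphic_on_imp_continuous_on[OF psi_holomorphic_right[OF z0]] dR_pos
    by (simp add: continuous_on_eq_continuous_at open_halfspace_Re_gt)
  hence 2: "(psi z0 \<longlongrightarrow> psi z0 (of_real dR)) (at (of_real dR))" by (simp add: isCont_def)
  show ?thesis unfolding is_pole_def Z_eq[abs_def]
    using tendsto_add_filterlim_at_infinity[OF 2 1] by (simp add: add.commute)
qed

section \<open>Gaps and the arcsine metric\<close>

text \<open>\<open>av_xi_of_oscillation\<close> loses one index, which costs the factor 1 /
  \<delta>; the missing case m = 0 is covered by \<open>xi_av_diff\<close>. Hence the two summands
  of the constant.\<close>

lemma psi_holomorphic_of_oscillation:
  assumes z0: "0 \<le> z0" "z0 \<le> B" and \<delta>: "\<delta> > 0"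
    and osc: "\<And>r. \<exists>C. \<forall>s m u v. norm s \<le> r \<longrightarrow> 0 \<le> u \<longrightarrow> u \<le> \<beta> \<longrightarrow> 0 \<le> v \<longrightarrow> v \<le> \<beta> \<longrightarrow>
        norm (av m s u - av m s v) \<le> C * \<delta> ^ m"
    and \<sigma>: "\<delta> * (N * c powr (- \<sigma> / 2)) \<le> 1"
  shows "psi z0 holomorphic_on {s. Re s > \<sigma>}"
proof (rule psi_holomorphic[OF z0 \<delta> _ \<sigma>])
  fix r
  obtain C where C: "\<And>s m u v. norm s \<le> r \<Longrightarrow> 0 \<le> u \<Longrightarrow> u \<le> \<beta> \<Longrightarrow> 0 \<le> v \<Longrightarrow> v \<le> \<beta> \<Longrightarrow>
        norm (av m s u - av m s v) \<le> C * \<delta> ^ m" using osc[of r] by blast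
  have "norm (av m s z0 - xi_fun R s) \<le> (\<bar>lip r * \<K> B\<bar> + \<bar>C\<bar> / \<delta>) * \<delta> ^ m" if s: "norm s \<le> r" for s m
  proof (cases m)
    case 0
    have "norm (xi_fun R s - av 0 s z0) \<le> lip r * \<K> B / real N ^ Suc 0" by (rule xi_av_diff[OF s z0])
    also have "\<dots> \<le> \<bar>lip r * \<K> B\<bar> / real N" by (simp add: divide_right_mono)
    also have "\<dots> \<le> \<bar>lip r * \<K> B\<bar> / 1" using N2 by (intro divide_left_mono) auto
    also have "\<dots> \<le> \<bar>lip r * \<K> B\<bar> + \<bar>C\<bar> / \<delta>" using \<delta> by simp
    finally show ?thesis using 0 by (simp add: norm_minus_commute)
  next
    case (Suc l)
    have "norm (av (Suc l) s z0 - xi_fun R s) \<le> C * \<delta> ^ l"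
      by (rule av_xi_of_oscillation[OF C[OF s] z0])
    also have "\<dots> \<le> (\<bar>C\<bar> / \<delta>) * \<delta> ^ Suc l" using \<delta> by (simp add: mult_right_mono)
    also have "\<dots> \<le> (\<bar>lip r * \<K> B\<bar> + \<bar>C\<bar> / \<delta>) * \<delta> ^ Suc l" using \<delta> by (intro mult_right_mono) auto
    finally show ?thesis using Suc by simp
  qed
  thus "\<exists>C. \<forall>s m. norm s \<le> r \<longrightarrow> norm (av m s z0 - xi_fun R s) \<le> C * \<delta> ^ m" by blast
qed

text \<open>\<open>lo j\<close> and \<open>hi j\<close> are the ends of the image of the hull under
  \<open>\<phi> j\<close>, the j-th band of the preimage of [0, \<beta>]; min and max absorb the
  orientation of the branch.\<close>

definition lo :: "nat \<Rightarrow> real" where "lo j = min (\<phi> j 0) (\<phi> j \<beta>)"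
definition hi :: "nat \<Rightarrow> real" where "hi j = max (\<phi> j 0) (\<phi> j \<beta>)"

lemma lo_hi: assumes "j \<in> {1..N}" shows "b (j - 1) \<le> lo j" "lo j \<le> hi j" "hi j \<le> b j" "0 \<le> lo j" "hi j \<le> \<beta>"
  using phi_mem[OF assms, of 0] phi_mem[OF assms, of \<beta>] phi_range[OF assms, of 0] phi_range[OF assms, of \<beta>]
    beta_pos beta_le_B B_pos by (auto simp: lo_def hi_def)

lemma phi_between: assumes "j \<in> {1..N}" "0 < x" "x < \<beta>" shows "lo j < \<phi> j x" "\<phi> j x < hi j"
proof -
  have "\<phi> j 0 < \<phi> j x \<and> \<phi> j x < \<phi> j \<beta> \<or> \<phi> j \<beta> < \<phi> j x \<and> \<phi> j x < \<phi> j 0"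
    using phi_increasing[OF assms(1), of 0 x] phi_increasing[OF assms(1), of x \<beta>]
      phi_decreasing[OF assms(1), of 0 x] phi_decreasing[OF assms(1), of x \<beta>] assms beta_le_B by auto
  thus "lo j < \<phi> j x" "\<phi> j x < hi j" by (auto simp: lo_def hi_def)
qed

lemma hi_le_lo: "i \<in> {1..N} \<Longrightarrow> j \<in> {1..N} \<Longrightarrow> i < j \<Longrightarrow> hi i \<le> lo j"
  using lo_hi[of i] lo_hi[of j] b_le[of i "j - 1"] by force

lemma lo_1: "lo (Suc 0) = 0"
proof -
  have "S 0 = 0" using phi_eq[of 1 0] P0 b_0 b1_pos N2 by simp
  thus ?thesis using lo_hi(4)[of "Suc 0"] N2 by (simp add: lo_def)
qed

lemma hi_N: "hi N = \<beta>"
proof -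
  have N: "N \<in> {1..N}" using N2 by auto
  have "\<phi> N (poly P \<beta>) = \<beta>" using phi_eq[OF N, of \<beta>] b_N b_nonneg[of "N - 1"] by simp
  hence "\<phi> N 0 = \<beta> \<or> \<phi> N \<beta> = \<beta>" using end_points_invariant by auto
  thus ?thesis using lo_hi(5)[OF N] by (auto simp: hi_def)
qed

lemma poly_factor_real:
  assumes "0 \<le> w" "w \<le> B"
  shows "poly P y - w = lead_coeff P * (\<Prod>j\<in>{1..N}. y - \<phi> j w)"
proof -
  have "complex_of_real (poly P y - w) = poly R (of_real y) - of_real w" by (simp add: poly_P)
  also have "\<dots> = lead_coeff R * (\<Prod>j\<in>{1..N}. of_real y - of_real (\<phi> j w))" by (rule poly_factor[OF assms])
  also have "lead_coeff R = of_real (lead_coeff P)" by (simp add: deg deg_P coeff_P)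
  also have "of_real (lead_coeff P) * (\<Prod>j\<in>{1..N}. complex_of_real y - of_real (\<phi> j w)) =
      of_real (lead_coeff P * (\<Prod>j\<in>{1..N}. y - \<phi> j w))" by simp
  finally show ?thesis by (simp only: of_real_eq_iff)
qed

text \<open>A Pell-type identity like 1 - T^2 = (1 - x^2) U^2 for Chebyshev polynomials. The zeros
  of P and of \<beta> - P are the ends of the bands; the outermost ones are 0 and \<beta>, the
  others are paired across the gaps.\<close>

lemma end_point_factor:
  "poly P y * (\<beta> - poly P y) = lead_coeff P ^ 2 * (y * (\<beta> - y)) * (\<Prod>i\<in>{1..<N}. (y - hi i) * (y - lo (Suc i)))"
proof -
  have "(y - \<phi> j 0) * (y - \<phi> j \<beta>) = (y - lo j) * (y - hi j)" for j
    by (auto simp: lo_def hi_def min_def max_def)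
  hence "(\<Prod>j\<in>{1..N}. y - \<phi> j 0) * (\<Prod>j\<in>{1..N}. y - \<phi> j \<beta>) = (\<Prod>j\<in>{1..N}. y - lo j) * (\<Prod>j\<in>{1..N}. y - hi j)"
    by (simp flip: prod.distrib)
  also have "(\<Prod>j\<in>{1..N}. y - lo j) = (y - lo (Suc 0)) * (\<Prod>i\<in>{1..<N}. y - lo (Suc i))"
  proof -
    have eq: "{1..N} = insert (Suc 0) (Suc ` {1..<N})" using N2 by (auto simp: image_iff)
    have "(\<Prod>j\<in>{1..N}. y - lo j) = (y - lo (Suc 0)) * (\<Prod>j\<in>Suc ` {1..<N}. y - lo j)"
      unfolding eq by (rule prod.insert) auto
    also have "(\<Prod>j\<in>Suc ` {1..<N}. y - lo j) = (\<Prod>i\<in>{1..<N}. y - lo (Suc i))"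
      by (subst prod.reindex) (auto simp only: o_def inj_on_def Suc_inject)
    finally show ?thesis .
  qed
  also have "(\<Prod>j\<in>{1..N}. y - hi j) = (y - hi N) * (\<Prod>i\<in>{1..<N}. y - hi i)"
  proof -
    have "{1..N} = insert N {1..<N}" using N2 by auto
    thus ?thesis by simp
  qed
  finally have "(\<Prod>j\<in>{1..N}. y - \<phi> j 0) * (\<Prod>j\<in>{1..N}. y - \<phi> j \<beta>) =
      y * (y - \<beta>) * (\<Prod>i\<in>{1..<N}. (y - hi i) * (y - lo (Suc i)))"
    unfolding lo_1 hi_N prod.distrib by (simp add: mult_ac)
  moreover have "poly P y * (poly P y - \<beta>) =
      lead_coeff P ^ 2 * ((\<Prod>j\<in>{1..N}. y - \<phi> j 0) * (\<Prod>j\<in>{1..N}. y - \<phi> j \<beta>))"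
    using poly_factor_real[of 0 y] poly_factor_real[of \<beta> y] beta_pos beta_le_B B_pos
    by (simp add: power2_eq_square mult_ac)
  ultimately have "poly P y * (poly P y - \<beta>) = lead_coeff P ^ 2 * (y * (y - \<beta>) * (\<Prod>i\<in>{1..<N}. (y - hi i) * (y - lo (Suc i))))"
    by simp
  thus ?thesis by (simp add: algebra_simps)
qed

text \<open>Centre and half the length of the gap between the bands i and i + 1, so that (y - hi
  i)(y - lo (i + 1)) = (y - mid i)^2 - (gap i)^2.\<close>

definition mid :: "nat \<Rightarrow> real" where "mid i = (hi i + lo (Suc i)) / 2"
definition gap :: "nat \<Rightarrow> real" where "gap i = (lo (Suc i) - hi i) / 2"

lemma gap_nonneg: "i \<in> {1..<N} \<Longrightarrow> 0 \<le> gap i"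
  using hi_le_lo[of i "Suc i"] by (auto simp: gap_def)

text \<open>For \<open>0 < x < \<beta>\<close> this is the factor by which the branch \<open>\<phi> j\<close> contracts the metric
  \<open>dx / sqrt (x (\<beta> - x))\<close>, the equilibrium measure of the interval; see \<open>Lam_DERIV\<close>.\<close>

definition contr :: "nat \<Rightarrow> real \<Rightarrow> real" where
  "contr j x = sqrt (x * (\<beta> - x)) / (sqrt (\<phi> j x * (\<beta> - \<phi> j x)) * \<bar>poly (pderiv P) (\<phi> j x)\<bar>)"

lemma phi_inner: assumes "j \<in> {1..N}" "0 < x" "x < \<beta>"
  shows "0 < \<phi> j x" "\<phi> j x < \<beta>" "poly P (\<phi> j x) = x" "poly (pderiv P) (\<phi> j x) \<noteq> 0"
proof -
  show "0 < \<phi> j x" "\<phi> j x < \<beta>" using phi_between[OF assms] lo_hi[OF assms(1)] by linarith+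
  show P: "poly P (\<phi> j x) = x" using phi_mem(3)[OF assms(1), of x] assms beta_le_B by simp
  show "poly (pderiv P) (\<phi> j x) \<noteq> 0"
  proof
    assume "poly (pderiv P) (\<phi> j x) = 0"
    hence "\<phi> j x \<in> crit" by (simp add: crit_def)
    thus False using crit_value[of "\<phi> j x"] P assms by (metis linorder_not_le nle_le)
  qed
qed

text \<open>\<open>end_point_factor\<close> at y = \<open>\<phi> j x\<close>, where P(y) = x: the
  factor y (\<beta> - y) cancels, and only the gaps remain.\<close>

lemma contr_eq:
  assumes "j \<in> {1..N}" "0 < x" "x < \<beta>"
  shows "contr j x = \<bar>lead_coeff P\<bar> * sqrt (\<Prod>i\<in>{1..<N}. (\<phi> j x - mid i) ^ 2 - gap i ^ 2) / \<bar>poly (pderiv P) (\<phi> j x)\<bar>"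
proof -
  define y where "y = \<phi> j x"
  have y: "0 < y" "y < \<beta>" "poly P y = x" using phi_inner[OF assms] by (auto simp: y_def)
  have "(y - hi i) * (y - lo (Suc i)) = (y - mid i) ^ 2 - gap i ^ 2" for i
    by (simp add: mid_def gap_def power2_eq_square field_simps)
  hence "x * (\<beta> - x) = lead_coeff P ^ 2 * (y * (\<beta> - y)) * (\<Prod>i\<in>{1..<N}. (y - mid i) ^ 2 - gap i ^ 2)"
    using end_point_factor[of y] y by simp
  hence "sqrt (x * (\<beta> - x)) = \<bar>lead_coeff P\<bar> * sqrt (y * (\<beta> - y)) * sqrt (\<Prod>i\<in>{1..<N}. (y - mid i) ^ 2 - gap i ^ 2)"
    by (simp add: real_sqrt_mult)
  moreover define r where "r = sqrt (y * (\<beta> - y))"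
  moreover have "r > 0" using y by (simp add: r_def)
  ultimately show ?thesis unfolding contr_def y_def[symmetric] r_def[symmetric] by simp
qed

lemma pderiv_at_branch:
  assumes "j \<in> {1..N}" "0 < x" "x < \<beta>"
  shows "poly (pderiv P) (\<phi> j x) = lead_coeff P * (\<Prod>k\<in>{1..N}-{j}. \<phi> j x - \<phi> k x)"
proof -
  define p where "p = (\<Prod>k\<in>{1..N}-{j}. [:- \<phi> k x, 1:])"
  have "P = smult (lead_coeff P) ([:- \<phi> j x, 1:] * p) + [:x:]"
  proof (rule poly_eq_poly_eq_iff[THEN iffD1, OF ext])
    fix y
    have "poly P y - x = lead_coeff P * ((y - \<phi> j x) * (\<Prod>k\<in>{1..N}-{j}. y - \<phi> k x))"
    proof -
      have "(\<Prod>k\<in>{1..N}. y - \<phi> k x) = (y - \<phi> j x) * (\<Prod>k\<in>{1..N}-{j}. y - \<phi> k x)"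
        by (rule prod.remove) (use assms in auto)
      moreover have "poly P y - x = lead_coeff P * (\<Prod>k\<in>{1..N}. y - \<phi> k x)"
        using assms beta_le_B by (intro poly_factor_real) auto
      ultimately show ?thesis by (simp only:)
    qed
    thus "poly P y = poly (smult (lead_coeff P) ([:- \<phi> j x, 1:] * p) + [:x:]) y"
      by (simp add: p_def poly_prod algebra_simps)
  qed
  hence "pderiv P = pderiv (smult (lead_coeff P) ([:- \<phi> j x, 1:] * p) + [:x:])" by (rule arg_cong)
  also have "\<dots> = smult (lead_coeff P) (p + [:- \<phi> j x, 1:] * pderiv p)"
    unfolding pderiv_add pderiv_smult pderiv_linear_mult by (simp add: pderiv_pCons)
  finally have "poly (pderiv P) (\<phi> j x) = lead_coeff P * poly p (\<phi> j x)" by simp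
  thus ?thesis by (simp add: p_def poly_prod)
qed

text \<open>For each i the midpoint of gap i and the point \<open>\<phi> (h i) x\<close> lie on the
  same side of \<open>\<phi> j x\<close>, so the factors can be matched with equal signs. The map h
  enumerates the bands other than j.\<close>

lemma mid_quotient_pos:
  assumes "j \<in> {1..N}" "0 < x" "x < \<beta>"
  shows "(\<Prod>i\<in>{1..<N}. \<phi> j x - mid i) / (\<Prod>k\<in>{1..N}-{j}. \<phi> j x - \<phi> k x) > 0"
proof -
  define h where "h i = (if i < j then i else Suc i)" for i
  have "(\<Prod>k\<in>{1..N}-{j}. \<phi> j x - \<phi> k x) = (\<Prod>i\<in>{1..<N}. \<phi> j x - \<phi> (h i) x)"
    by (rule prod.reindex_bij_witness[of _ h "\<lambda>k. if k < j then k else k - 1"])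
       (use assms in \<open>auto simp: h_def\<close>)
  hence "(\<Prod>i\<in>{1..<N}. \<phi> j x - mid i) / (\<Prod>k\<in>{1..N}-{j}. \<phi> j x - \<phi> k x) =
      (\<Prod>i\<in>{1..<N}. (\<phi> j x - mid i) / (\<phi> j x - \<phi> (h i) x))" by (simp add: prod_dividef)
  also have "\<dots> > 0"
  proof (rule prod_pos)
    fix i assume i: "i \<in> {1..<N}"
    have y: "lo j < \<phi> j x" "\<phi> j x < hi j" using phi_between[OF assms] by auto
    have hl: "hi i \<le> lo (Suc i)" using hi_le_lo[of i "Suc i"] i by auto
    show "0 < (\<phi> j x - mid i) / (\<phi> j x - \<phi> (h i) x)"
    proof (cases "i < j")
      case True
      have "lo (Suc i) \<le> lo j"
      proof (cases "Suc i = j")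
        case False
        thus ?thesis using hi_le_lo[of "Suc i" j] lo_hi(2)[of "Suc i"] assms i True by auto
      qed auto
      moreover have "\<phi> i x < hi i" using phi_between[of i x] assms i by auto
      ultimately show ?thesis using y hl True by (intro divide_pos_pos) (auto simp: mid_def h_def)
    next
      case False
      have "hi j \<le> hi i"
      proof (cases "i = j")
        case False
        thus ?thesis using hi_le_lo[of j i] lo_hi(2)[of i] assms i \<open>\<not> i < j\<close> by auto
      qed auto
      moreover have "lo (Suc i) < \<phi> (Suc i) x" using phi_between[of "Suc i" x] assms i by auto
      ultimately show ?thesis using y hl False by (intro divide_neg_neg) (auto simp: mid_def h_def)
    qed
  qed
  finally show ?thesis .
qed

text \<open>\<open>lagrange_leading_coeff\<close> for the monic polynomial of degree N - 1 that
  vanishes at the midpoints, with nodes \<open>\<phi> j x\<close>. The absolute values do no harm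
  since every quotient is positive.\<close>

lemma sum_mid_quotient:
  assumes "0 < x" "x < \<beta>"
  shows "(\<Sum>j\<in>{1..N}. \<bar>lead_coeff P\<bar> * \<bar>\<Prod>i\<in>{1..<N}. \<phi> j x - mid i\<bar> / \<bar>poly (pderiv P) (\<phi> j x)\<bar>) = 1"
proof -
  define V where "V = (\<Prod>i\<in>{1..<N}. [:- mid i, 1:])"
  have V: "lead_coeff V = 1" "Suc (degree V) = card {1..N}"
  proof -
    show "lead_coeff V = 1" by (simp add: V_def lead_coeff_prod)
    have "degree V = N - 1" unfolding V_def by (subst degree_prod_sum_eq) auto
    thus "Suc (degree V) = card {1..N}" using N2 by simp
  qed
  have "(\<Sum>j\<in>{1..N}. poly V (\<phi> j x) / (\<Prod>k\<in>{1..N}-{j}. \<phi> j x - \<phi> k x)) = 1"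
    using inj_phi_index[of x] assms beta_le_B by (intro lagrange_leading_coeff V) auto
  moreover have "\<bar>lead_coeff P\<bar> * \<bar>\<Prod>i\<in>{1..<N}. \<phi> j x - mid i\<bar> / \<bar>poly (pderiv P) (\<phi> j x)\<bar> =
      poly V (\<phi> j x) / (\<Prod>k\<in>{1..N}-{j}. \<phi> j x - \<phi> k x)" if j: "j \<in> {1..N}" for j
  proof -
    have "\<bar>lead_coeff P\<bar> * \<bar>\<Prod>i\<in>{1..<N}. \<phi> j x - mid i\<bar> / \<bar>poly (pderiv P) (\<phi> j x)\<bar> =
      \<bar>(\<Prod>i\<in>{1..<N}. \<phi> j x - mid i) / (\<Prod>k\<in>{1..N}-{j}. \<phi> j x - \<phi> k x)\<bar>"
      unfolding pderiv_at_branch[OF j assms] abs_mult abs_divide using lead_P_nz by simp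
    thus ?thesis unfolding abs_of_pos[OF mid_quotient_pos[OF j assms]] by (simp add: V_def poly_prod)
  qed
  ultimately show ?thesis by simp
qed

text \<open>As |y - mid i| \<le> \<beta> in the hull, (gap i)^2 is at least (gap i / \<beta>)^2 (y -
  mid i)^2; so (y - mid i)^2 - (gap i)^2 is at most \<open>\<gamma> i ^ 2\<close> times (y - mid
  i)^2.\<close>

definition \<gamma> :: "nat \<Rightarrow> real" where "\<gamma> i = sqrt (1 - (gap i / \<beta>) ^ 2)"

lemma gamma_range:
  assumes "i \<in> {1..<N}" "gap i > 0" shows "0 < \<gamma> i" "\<gamma> i < 1"
proof -
  have "gap i \<le> \<beta> / 2" using lo_hi[of i] lo_hi[of "Suc i"] assms by (auto simp: gap_def)
  hence "gap i / \<beta> < 1" "0 < gap i / \<beta>" using assms beta_pos by (auto simp: field_simps)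
  hence "0 < (gap i / \<beta>) ^ 2" "(gap i / \<beta>) ^ 2 < 1" by (auto simp: power_less_one_iff)
  thus "0 < \<gamma> i" "\<gamma> i < 1" by (auto simp: \<gamma>_def)
qed

text \<open>In \<open>contr_eq\<close>, replacing every factor (y - mid i)^2 - (gap i)^2 by (y - mid
  i)^2 leads to the sum of \<open>sum_mid_quotient\<close>, which is 1; at the gap i0 the sharper
  bound with \<open>\<gamma> i0\<close> is kept.\<close>

lemma sum_contr_le:
  assumes i0: "i0 \<in> {1..<N}" and x: "0 < x" "x < \<beta>"
  shows "(\<Sum>j\<in>{1..N}. contr j x) \<le> \<gamma> i0"
proof -
  have "contr j x \<le> \<gamma> i0 * (\<bar>lead_coeff P\<bar> * \<bar>\<Prod>i\<in>{1..<N}. \<phi> j x - mid i\<bar> / \<bar>poly (pderiv P) (\<phi> j x)\<bar>)"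
    if j: "j \<in> {1..N}" for j
  proof -
    define y where "y = \<phi> j x"
    have y: "0 < y" "y < \<beta>" using phi_inner[OF j x] by (auto simp: y_def)
    \<comment> \<open>y lies in the band j, hence outside the interior of every gap.\<close>
    have nn: "0 \<le> (y - mid i) ^ 2 - gap i ^ 2" if i: "i \<in> {1..<N}" for i
    proof -
      have "(y - hi i) * (y - lo (Suc i)) = (y - mid i) ^ 2 - gap i ^ 2"
        by (simp add: mid_def gap_def power2_eq_square field_simps)
      moreover have "y \<le> hi i \<and> y \<le> lo (Suc i) \<or> hi i \<le> y \<and> lo (Suc i) \<le> y"
      proof -
        have lj: "lo j < y" "y < hi j" using phi_between[OF j x] by (auto simp: y_def)
        have "hi i \<le> lo (Suc i)" using hi_le_lo[of i "Suc i"] i by auto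
        moreover have "hi j \<le> hi i" if "j \<le> i"
          using hi_le_lo[of j i] lo_hi(2)[of i] i j that by (cases "i = j") auto
        moreover have "lo (Suc i) \<le> lo j" if "i < j"
          using hi_le_lo[of "Suc i" j] lo_hi(2)[of "Suc i"] i j that by (cases "Suc i = j") auto
        ultimately show ?thesis using lj by (cases "i < j") auto
      qed
      ultimately show ?thesis by (metis diff_ge_0_iff_ge mult_nonneg_nonneg mult_nonpos_nonpos diff_le_0_iff_le)
    qed
    have i0': "(y - mid i0) ^ 2 - gap i0 ^ 2 \<le> \<gamma> i0 ^ 2 * (y - mid i0) ^ 2"
    proof -
      have gr: "gap i0 / \<beta> \<le> 1" "0 \<le> gap i0 / \<beta>"
        using lo_hi[of i0] lo_hi[of "Suc i0"] i0 beta_pos gap_nonneg[OF i0] by (auto simp: gap_def)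
      have "0 \<le> mid i0" "mid i0 \<le> \<beta>" using lo_hi[of i0] lo_hi[of "Suc i0"] i0 by (auto simp: mid_def)
      hence "\<bar>y - mid i0\<bar> \<le> \<beta>" using y by linarith
      hence "(y - mid i0) ^ 2 \<le> \<beta> ^ 2" by (metis abs_ge_zero power2_abs power_mono)
      hence "(gap i0 / \<beta>) ^ 2 * (y - mid i0) ^ 2 \<le> (gap i0 / \<beta>) ^ 2 * \<beta> ^ 2" by (intro mult_left_mono) auto
      also have "\<dots> = gap i0 ^ 2" using beta_pos by (simp add: power_divide)
      finally have "(gap i0 / \<beta>) ^ 2 * (y - mid i0) ^ 2 \<le> gap i0 ^ 2" .
      moreover have "\<gamma> i0 ^ 2 = 1 - (gap i0 / \<beta>) ^ 2"
        unfolding \<gamma>_def using gr power_le_one[of "gap i0 / \<beta>" 2] by simp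
      ultimately show ?thesis by (simp add: left_diff_distrib)
    qed
    have "(\<Prod>i\<in>{1..<N}. (y - mid i) ^ 2 - gap i ^ 2) =
        ((y - mid i0) ^ 2 - gap i0 ^ 2) * (\<Prod>i\<in>{1..<N}-{i0}. (y - mid i) ^ 2 - gap i ^ 2)"
      using i0 by (intro prod.remove) auto
    also have "\<dots> \<le> (\<gamma> i0 ^ 2 * (y - mid i0) ^ 2) * (\<Prod>i\<in>{1..<N}-{i0}. (y - mid i) ^ 2)"
      using i0' nn i0 by (intro mult_mono prod_mono prod_nonneg) auto
    also have "\<dots> = \<gamma> i0 ^ 2 * (\<Prod>i\<in>{1..<N}. (y - mid i) ^ 2)"
      using i0 prod.remove[of "{1..<N}" i0 "\<lambda>i. (y - mid i) ^ 2"] by simp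
    also have "\<dots> = (\<gamma> i0 * (\<Prod>i\<in>{1..<N}. y - mid i)) ^ 2" by (simp add: power_mult_distrib prod_power_distrib)
    finally have "sqrt (\<Prod>i\<in>{1..<N}. (y - mid i) ^ 2 - gap i ^ 2) \<le> \<bar>\<gamma> i0 * (\<Prod>i\<in>{1..<N}. y - mid i)\<bar>"
      by (metis real_sqrt_abs real_sqrt_le_mono)
    also have "\<dots> = \<gamma> i0 * \<bar>\<Prod>i\<in>{1..<N}. y - mid i\<bar>"
    proof -
      have "(gap i0 / \<beta>) ^ 2 \<le> 1"
        using lo_hi[of i0] lo_hi[of "Suc i0"] i0 beta_pos gap_nonneg[OF i0] by (intro power_le_one) (auto simp: gap_def)
      thus ?thesis by (simp add: abs_mult \<gamma>_def)
    qed
    finally have "\<bar>lead_coeff P\<bar> * sqrt (\<Prod>i\<in>{1..<N}. (y - mid i) ^ 2 - gap i ^ 2) / \<bar>poly (pderiv P) y\<bar>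
       \<le> \<bar>lead_coeff P\<bar> * (\<gamma> i0 * \<bar>\<Prod>i\<in>{1..<N}. y - mid i\<bar>) / \<bar>poly (pderiv P) y\<bar>"
      by (intro divide_right_mono mult_left_mono) auto
    thus ?thesis unfolding contr_eq[OF j x] y_def[symmetric] by (simp add: mult_ac)
  qed
  hence "(\<Sum>j\<in>{1..N}. contr j x) \<le> (\<Sum>j\<in>{1..N}. \<gamma> i0 * (\<bar>lead_coeff P\<bar> * \<bar>\<Prod>i\<in>{1..<N}. \<phi> j x - mid i\<bar> / \<bar>poly (pderiv P) (\<phi> j x)\<bar>))"
    by (rule sum_mono)
  also have "\<dots> = \<gamma> i0" unfolding sum_distrib_left[symmetric] sum_mid_quotient[OF x] by simp
  finally show ?thesis .
qed

text \<open>Degenerate gaps have the critical points as midpoints, so the root in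
  \<open>contr_eq\<close> is |P'(y)| divided by N times the modulus of the leading coefficient, and
  all branches contract equally.\<close>

lemma no_gap_contr:
  assumes "\<And>i. i \<in> {1..<N} \<Longrightarrow> gap i = 0" and j: "j \<in> {1..N}" and x: "0 < x" "x < \<beta>"
  shows "contr j x = 1 / N"
proof -
  define y where "y = \<phi> j x"
  have mid: "mid i = b i" if "i \<in> {1..<N}" for i
    using assms(1)[OF that] lo_hi[of i] lo_hi[of "Suc i"] that by (auto simp: gap_def mid_def)
  have inj: "inj_on (\<lambda>i. b i) {1..<N}"
  proof (rule inj_onI)
    fix i k assume "i \<in> {1..<N}" "k \<in> {1..<N}" "b i = b k"
    thus "i = k" using b_less[of i k] b_less[of k i] by (cases i k rule: linorder_cases) auto
  qed
  have "crit = (\<lambda>i. b i) ` {1..<N}" using crit_b b_crit by force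
  hence "(\<Prod>p\<in>crit. y - p) = (\<Prod>i\<in>{1..<N}. y - b i)"
    using prod.reindex[OF inj, of "\<lambda>p. y - p"] by (simp add: o_def)
  hence "poly (pderiv P) y = real N * lead_coeff P * (\<Prod>i\<in>{1..<N}. y - b i)"
    by (subst pderiv_P_factor) (simp add: poly_prod)
  moreover have "(\<Prod>i\<in>{1..<N}. (y - mid i) ^ 2 - gap i ^ 2) = (\<Prod>i\<in>{1..<N}. y - b i) ^ 2"
    using assms(1) mid by (simp add: prod_power_distrib)
  moreover have "poly (pderiv P) y \<noteq> 0" using phi_inner[OF j x] by (simp add: y_def)
  ultimately show ?thesis unfolding contr_eq[OF j x] y_def[symmetric] using lead_P_nz
    by (simp add: abs_mult)
qed

text \<open>The arcsine length of [0, x]: the substitution x = \<beta>/2 (1 - cos t) turns the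
  metric into dt, and the hull has length pi.\<close>

definition Lam :: "real \<Rightarrow> real" where "Lam x = arccos (1 - 2 * x / \<beta>)"

lemma Lam_arg: "0 \<le> x \<Longrightarrow> x \<le> \<beta> \<Longrightarrow> -1 \<le> 1 - 2 * x / \<beta> \<and> 1 - 2 * x / \<beta> \<le> 1"
  using beta_pos by (auto simp: field_simps)

lemma cos_Lam: "0 \<le> x \<Longrightarrow> x \<le> \<beta> \<Longrightarrow> x = \<beta> / 2 * (1 - cos (Lam x))"
  using Lam_arg[of x] beta_pos by (simp add: Lam_def cos_arccos field_simps)

lemma Lam_range: "0 \<le> x \<Longrightarrow> x \<le> \<beta> \<Longrightarrow> 0 \<le> Lam x \<and> Lam x \<le> pi"
  using Lam_arg[of x] by (simp add: Lam_def arccos_lbound arccos_ubound)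

lemma Lam_mono: "0 \<le> x \<Longrightarrow> x \<le> y \<Longrightarrow> y \<le> \<beta> \<Longrightarrow> Lam x \<le> Lam y"
  unfolding Lam_def using Lam_arg[of x] Lam_arg[of y] beta_pos
  by (intro arccos_le_arccos) (auto intro!: divide_right_mono)

lemma Lam_continuous: "continuous_on {0..\<beta>} Lam"
  unfolding Lam_def by (intro continuous_on_arccos continuous_intros) (use Lam_arg beta_pos in auto)

lemma Lam_DERIV:
  assumes "0 < x" "x < \<beta>" shows "DERIV Lam x :> 1 / sqrt (x * (\<beta> - x))"
proof -
  have "-1 < 1 - 2 * x / \<beta>" "1 - 2 * x / \<beta> < 1" using assms by (auto simp: field_simps)
  hence D: "DERIV Lam x :> inverse (- sqrt (1 - (1 - 2 * x / \<beta>) ^ 2)) * (- 2 / \<beta>)"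
    unfolding Lam_def[abs_def] by (intro DERIV_chain2[OF DERIV_arccos]) (auto intro!: derivative_eq_intros)
  have "1 - (1 - 2 * x / \<beta>) ^ 2 = (2 / \<beta>) ^ 2 * (x * (\<beta> - x))"
    using beta_pos by (simp add: power2_eq_square field_simps)
  hence "sqrt (1 - (1 - 2 * x / \<beta>) ^ 2) = 2 / \<beta> * sqrt (x * (\<beta> - x))"
    using beta_pos by (simp add: real_sqrt_mult)
  thus ?thesis using D beta_pos by (simp add: field_simps)
qed

lemma phi_DERIV:
  assumes "j \<in> {1..N}" "0 < x" "x < \<beta>"
  shows "DERIV (\<phi> j) x :> 1 / poly (pderiv P) (\<phi> j x)"
proof -
  have "DERIV (\<phi> j) x :> inverse (poly (pderiv P) (\<phi> j x))"
  proof (rule DERIV_inverse_function[OF poly_DERIV _ assms(2,3)])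
    show "poly P (\<phi> j y) = y" if "0 < y" "y < \<beta>" for y using phi_inner[OF assms(1) that] by simp
    show "isCont (\<phi> j) x"
      using phi_continuous[OF assms(1)] assms beta_le_B
      by (intro continuous_on_interior[of "{0..B}"]) auto
  qed (use phi_inner[OF assms] in auto)
  thus ?thesis by (simp add: inverse_eq_divide)
qed

text \<open>The derivative of the sum of \<open>\<tau> j * Lam (\<phi> j x)\<close> is the sum of
  the \<open>contr j x\<close> divided by sqrt(x (\<beta> - x)), so the bound t is integrated from u
  to v through the monotonicity of G. J is the whole alphabet when there is a gap and a single
  letter when there is none.\<close>

lemma Lam_contraction:
  assumes J: "J \<subseteq> {1..N}" and bound: "\<And>x. 0 < x \<Longrightarrow> x < \<beta> \<Longrightarrow> (\<Sum>j\<in>J. contr j x) \<le> t"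
    and uv: "0 \<le> u" "u \<le> \<beta>" "0 \<le> v" "v \<le> \<beta>"
  shows "(\<Sum>j\<in>J. \<bar>Lam (\<phi> j u) - Lam (\<phi> j v)\<bar>) \<le> t * \<bar>Lam u - Lam v\<bar>"
proof -
  define \<tau> where "\<tau> j = (if increasing_piece (j - 1) then 1 else -1 :: real)" for j
  have fin: "finite J" using J finite_subset by blast
  have *: "(\<Sum>j\<in>J. \<bar>Lam (\<phi> j u) - Lam (\<phi> j v)\<bar>) \<le> t * \<bar>Lam u - Lam v\<bar>"
    if uv: "0 \<le> u" "u < v" "v \<le> \<beta>" for u v
  proof -
    define G where "G x = t * Lam x - (\<Sum>j\<in>J. \<tau> j * Lam (\<phi> j x))" for x
    have phir: "0 \<le> \<phi> j x \<and> \<phi> j x \<le> \<beta>" if "j \<in> J" "0 \<le> x" "x \<le> \<beta>" for j x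
      using phi_range[of j x] that J beta_le_B by auto
    have "G u \<le> G v"
    proof (rule DERIV_nonneg_imp_increasing_open[of u v G])
      fix x assume x: "u < x" "x < v"
      hence x0: "0 < x" "x < \<beta>" using uv by auto
      have Dj: "DERIV (\<lambda>x. \<tau> j * Lam (\<phi> j x)) x :> \<tau> j * (1 / sqrt (\<phi> j x * (\<beta> - \<phi> j x)) * (1 / poly (pderiv P) (\<phi> j x)))"
        if "j \<in> J" for j
      proof -
        have j: "j \<in> {1..N}" using J that by auto
        show ?thesis
          by (rule DERIV_cmult[OF DERIV_chain2[OF Lam_DERIV[OF phi_inner(1,2)[OF j x0]] phi_DERIV[OF j x0]]])
      qed
      have D: "DERIV G x :> t * (1 / sqrt (x * (\<beta> - x))) -
          (\<Sum>j\<in>J. \<tau> j * (1 / sqrt (\<phi> j x * (\<beta> - \<phi> j x)) * (1 / poly (pderiv P) (\<phi> j x))))"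
        unfolding G_def[abs_def] by (intro DERIV_diff DERIV_cmult[OF Lam_DERIV[OF x0]] DERIV_sum Dj)
      have "\<tau> j * (1 / sqrt (\<phi> j x * (\<beta> - \<phi> j x)) * (1 / poly (pderiv P) (\<phi> j x))) = contr j x / sqrt (x * (\<beta> - x))"
        if "j \<in> J" for j
      proof -
        have j: "j \<in> {1..N}" using J that by auto
        have pc: "b (j - 1) < \<phi> j x" "\<phi> j x < b j" using phi_between[OF j x0] lo_hi[OF j] by linarith+
        have "\<tau> j / poly (pderiv P) (\<phi> j x) = 1 / \<bar>poly (pderiv P) (\<phi> j x)\<bar>"
        proof (cases "increasing_piece (j - 1)")
          case True
          hence "poly (pderiv P) (\<phi> j x) > 0" using pc j by (simp add: increasing_piece_def)
          thus ?thesis using True by (simp add: \<tau>_def)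
        next
          case False
          hence "poly (pderiv P) (\<phi> j x) < 0" using pc j by (intro decreasing_piece[of "j - 1"]) auto
          thus ?thesis using False by (simp add: \<tau>_def)
        qed
        moreover define X r where "X = sqrt (x * (\<beta> - x))" and "r = sqrt (\<phi> j x * (\<beta> - \<phi> j x))"
        moreover have "\<tau> j * (1 / r * (1 / poly (pderiv P) (\<phi> j x))) = (\<tau> j / poly (pderiv P) (\<phi> j x)) * (1 / r)" by simp
        moreover have "X > 0" using x0 by (simp add: X_def)
        ultimately show ?thesis unfolding contr_def X_def[symmetric] r_def[symmetric] by simp
      qed
      hence "(\<Sum>j\<in>J. \<tau> j * (1 / sqrt (\<phi> j x * (\<beta> - \<phi> j x)) * (1 / poly (pderiv P) (\<phi> j x)))) =
          (\<Sum>j\<in>J. contr j x) / sqrt (x * (\<beta> - x))" by (simp add: sum_divide_distrib)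
      also have "\<dots> \<le> t / sqrt (x * (\<beta> - x))" using bound[OF x0] x0 by (intro divide_right_mono) auto
      finally show "\<exists>y. DERIV G x :> y \<and> 0 \<le> y" using D by (intro exI conjI) auto
    next
      have "continuous_on {u..v} (\<lambda>x. Lam (\<phi> j x))" if "j \<in> J" for j
        using phir[OF that] uv that J beta_le_B
        by (intro continuous_on_compose2[OF Lam_continuous] continuous_on_subset[OF phi_continuous]) force+
      thus "continuous_on {u..v} G" unfolding G_def
        using uv by (intro continuous_intros continuous_on_subset[OF Lam_continuous]) auto
    qed (use uv in auto)
    hence "(\<Sum>j\<in>J. \<tau> j * (Lam (\<phi> j v) - Lam (\<phi> j u))) \<le> t * (Lam v - Lam u)"
      by (simp add: G_def algebra_simps sum_subtractf)
    moreover have "\<tau> j * (Lam (\<phi> j v) - Lam (\<phi> j u)) = \<bar>Lam (\<phi> j u) - Lam (\<phi> j v)\<bar>" if "j \<in> J" for j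
    proof -
      have j: "j \<in> {1..N}" using J that by auto
      show ?thesis
      proof (cases "increasing_piece (j - 1)")
        case True
        have "Lam (\<phi> j u) \<le> Lam (\<phi> j v)"
          using phi_increasing[OF j True, of u v] phir[OF that, of u] phir[OF that, of v] uv beta_le_B by (intro Lam_mono) auto
        thus ?thesis using True by (simp add: \<tau>_def)
      next
        case False
        have "Lam (\<phi> j v) \<le> Lam (\<phi> j u)"
          using phi_decreasing[OF j False, of u v] phir[OF that, of u] phir[OF that, of v] uv beta_le_B by (intro Lam_mono) auto
        thus ?thesis using False by (simp add: \<tau>_def)
      qed
    qed
    moreover have "Lam u \<le> Lam v" using uv by (intro Lam_mono) auto
    ultimately show ?thesis by simp
  qed
  show ?thesis
  proof (cases u v rule: linorder_cases)
    case greater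
    thus ?thesis using *[of v u] uv by (simp add: abs_minus_commute)
  qed (use * uv in auto)
qed

text \<open>Without gaps the polynomial is a Chebyshev polynomial up to affine maps.\<close>

lemma no_gap_julia:
  assumes ng: "\<And>i. i \<in> {1..<N} \<Longrightarrow> gap i = 0"
  shows "{0..\<beta>} \<subseteq> rjulia R"
proof
  fix x assume x: "x \<in> {0..\<beta>}"
  \<comment> \<open>The bands fill the hull, so the orbit of x stays in it. A Julia point pulled
    back along the itinerary of x approaches x by the factor 1/N per step, starting from a distance
    of at most pi.\<close>
  have approx: "\<exists>p\<in>rjulia R. \<bar>Lam x - Lam p\<bar> \<le> pi * (1 / N) ^ m" if "x \<in> {0..\<beta>}" for x m
    using that
  proof (induction m arbitrary: x)
    case 0
    thus ?case using Lam_range[of x] Lam_range[of 0] beta_pos zero_rjulia by (intro bexI[of _ 0]) auto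
  next
    case (Suc m)
    obtain i where i: "i < N" "b i \<le> x" "x \<le> b (Suc i)" using pieces_cover Suc.prems by auto
    define j where "j = Suc i"
    have j: "j \<in> {1..N}" using i by (auto simp: j_def)
    have mid: "hi i = b i" "lo (Suc i) = b i" if "i \<in> {1..<N}" for i
      using ng[OF that] lo_hi[of i] lo_hi[of "Suc i"] that by (auto simp: gap_def)
    have "lo j = b i" using mid(2)[of i] lo_1 b_0 i by (cases "i = 0") (auto simp: j_def)
    moreover have "hi j = b (Suc i)" using mid(1)[of "Suc i"] hi_N b_N i by (cases "Suc i = N") (auto simp: j_def)
    ultimately have lh: "lo j \<le> x" "x \<le> hi j" using i by auto
    have e: "b i \<le> \<phi> j 0" "\<phi> j 0 \<le> b (Suc i)" "poly P (\<phi> j 0) = 0"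
        "b i \<le> \<phi> j \<beta>" "\<phi> j \<beta> \<le> b (Suc i)" "poly P (\<phi> j \<beta>) = \<beta>"
      using phi_mem[OF j, of 0] phi_mem[OF j, of \<beta>] beta_pos beta_le_B B_pos by (auto simp: j_def)
    have Px: "poly P x \<in> {0..\<beta>}"
    proof (cases "increasing_piece i")
      case True
      have "\<phi> j 0 < \<phi> j \<beta>" using phi_increasing[OF j, of 0 \<beta>] True beta_pos beta_le_B by (simp add: j_def)
      hence "\<phi> j 0 \<le> x" "x \<le> \<phi> j \<beta>" using lh by (auto simp: lo_def hi_def)
      thus ?thesis using increasing_strict[OF i(1) True, of "\<phi> j 0" x] increasing_strict[OF i(1) True, of x "\<phi> j \<beta>"] e i
        by (cases "x = \<phi> j 0"; cases "x = \<phi> j \<beta>") auto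
    next
      case False
      have "\<phi> j \<beta> < \<phi> j 0" using phi_decreasing[OF j, of 0 \<beta>] False beta_pos beta_le_B by (simp add: j_def)
      hence "\<phi> j \<beta> \<le> x" "x \<le> \<phi> j 0" using lh by (auto simp: lo_def hi_def)
      thus ?thesis using decreasing_strict[OF i(1) False, of "\<phi> j \<beta>" x] decreasing_strict[OF i(1) False, of x "\<phi> j 0"] e i
        by (cases "x = \<phi> j 0"; cases "x = \<phi> j \<beta>") auto
    qed
    obtain p where p: "p \<in> rjulia R" "\<bar>Lam (poly P x) - Lam p\<bar> \<le> pi * (1 / N) ^ m" using Suc.IH[OF Px] by blast
    have "(\<Sum>j\<in>{j}. \<bar>Lam (\<phi> j (poly P x)) - Lam (\<phi> j p)\<bar>) \<le> 1 / N * \<bar>Lam (poly P x) - Lam p\<bar>"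
      by (rule Lam_contraction) (use j no_gap_contr[OF ng j] Px rjulia_nonneg[OF p(1)] rjulia_le[OF p(1)] in auto)
    also have "\<dots> \<le> 1 / N * (pi * (1 / N) ^ m)" using p by (intro mult_left_mono) auto
    finally have "\<bar>Lam (\<phi> j (poly P x)) - Lam (\<phi> j p)\<bar> \<le> pi * (1 / N) ^ Suc m" by simp
    moreover have "\<phi> j (poly P x) = x" using i by (intro phi_eq[OF j]) (auto simp: j_def)
    ultimately show ?case using phi_rjulia[OF j p(1)] by (intro bexI[of _ "\<phi> j p"]) auto
  qed
  have "\<forall>m. \<exists>p\<in>rjulia R. \<bar>Lam x - Lam p\<bar> \<le> pi * (1 / N) ^ m" using approx[OF x] by blast
  then obtain p where p: "\<And>m. p m \<in> rjulia R" "\<And>m. \<bar>Lam x - Lam (p m)\<bar> \<le> pi * (1 / N) ^ m" by metis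
  have "(\<lambda>m. pi * (1 / real N) ^ m) \<longlonglongrightarrow> pi * 0" using N2 by (intro tendsto_intros LIMSEQ_power_zero) auto
  hence lim: "(\<lambda>m. pi * (1 / real N) ^ m) \<longlonglongrightarrow> 0" by simp
  have "\<forall>\<^sub>F m in sequentially. norm (Lam (p m) - Lam x) \<le> pi * (1 / real N) ^ m"
    using p(2) by (simp add: abs_minus_commute)
  hence "(\<lambda>m. Lam (p m) - Lam x) \<longlonglongrightarrow> 0" by (rule Lim_null_comparison[OF _ lim])
  hence "(\<lambda>m. Lam (p m)) \<longlonglongrightarrow> Lam x" by (simp add: LIM_zero_iff)
  hence "(\<lambda>m. \<beta> / 2 * (1 - cos (Lam (p m)))) \<longlonglongrightarrow> \<beta> / 2 * (1 - cos (Lam x))" by (intro tendsto_intros)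
  moreover have "\<beta> / 2 * (1 - cos (Lam (p m))) = p m" for m
    using cos_Lam[of "p m"] rjulia_nonneg[OF p(1)] rjulia_le[OF p(1)] by simp
  moreover have "\<beta> / 2 * (1 - cos (Lam x)) = x" using cos_Lam[of x] x by simp
  ultimately have "p \<longlonglongrightarrow> x" by simp
  thus "x \<in> rjulia R" using p(1) closed_sequentially[OF compact_imp_closed[OF rjulia_compact]] by blast
qed

lemma gap_exists:
  assumes "totally_disconnected (julia_set R)"
  obtains i where "i \<in> {1..<N}" "gap i > 0"
proof (rule ccontr)
  assume "\<not> thesis"
  hence "\<And>i. i \<in> {1..<N} \<Longrightarrow> gap i = 0" using gap_nonneg that by force
  hence "{0..\<beta>} \<subseteq> rjulia R" by (rule no_gap_julia)
  hence sub: "complex_of_real ` {0..\<beta>} \<subseteq> julia_set R" by (auto simp: rjulia_def)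
  have con: "connected (complex_of_real ` {0..\<beta>})"
    by (intro connected_continuous_image continuous_intros) auto
  have "complex_of_real ` {0..\<beta>} \<subseteq> connected_component_set (julia_set R) 0"
    by (rule connected_component_maximal[OF _ con sub]) (use beta_pos in auto)
  also have "\<dots> = {0}" using assms zero_in_julia by (simp add: totally_disconnected_def)
  finally have "complex_of_real ` {0..\<beta>} \<subseteq> {0}" .
  moreover have "complex_of_real \<beta> \<in> complex_of_real ` {0..\<beta>}" using beta_pos by (intro imageI) auto
  ultimately have "complex_of_real \<beta> = 0" by blast
  thus False using beta_pos by simp
qed

lemma dsum_Lam:
  assumes i: "i \<in> {1..<N}" "gap i > 0" and "0 \<le> u" "u \<le> \<beta>" "0 \<le> v" "v \<le> \<beta>"
  shows "dsum m (\<lambda>x y. \<bar>Lam x - Lam y\<bar>) u v \<le> \<gamma> i ^ m * \<bar>Lam u - Lam v\<bar>"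
  using assms(3-)
proof (induction m arbitrary: u v)
  case (Suc m)
  have "dsum (Suc m) (\<lambda>x y. \<bar>Lam x - Lam y\<bar>) u v \<le> (\<Sum>j=1..N. \<gamma> i ^ m * \<bar>Lam (\<phi> j u) - Lam (\<phi> j v)\<bar>)"
    unfolding dsum.simps
    by (intro sum_mono Suc.IH) (use phi_range[of _ u] phi_range[of _ v] Suc.prems beta_le_B in auto)
  also have "\<dots> = \<gamma> i ^ m * (\<Sum>j=1..N. \<bar>Lam (\<phi> j u) - Lam (\<phi> j v)\<bar>)" by (simp add: sum_distrib_left)
  also have "\<dots> \<le> \<gamma> i ^ m * (\<gamma> i * \<bar>Lam u - Lam v\<bar>)"
    using gamma_range[OF i] Suc.prems by (intro mult_left_mono Lam_contraction sum_contr_le i) auto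
  finally show ?case by (simp add: mult_ac del: dsum.simps)
qed simp

text \<open>A convex function is Lipschitz away from the right end; L bounds the slopes through
  chords ending at \<beta>. As \<K> may be steep near \<beta>, the equation \<K> = c \<K> o S first
  moves the points into [0, b 1]. There |S x - S y| is controlled by \<open>Lam\<close>, because the
  cosine is 1-Lipschitz and S does not expand \<open>Lam\<close>.\<close>

lemma koenigs_Lam_lipschitz:
  assumes i: "i \<in> {1..<N}" "gap i > 0" and xy: "0 \<le> x" "x \<le> \<beta>" "0 \<le> y" "y \<le> \<beta>"
  shows "\<bar>\<K> x - \<K> y\<bar> \<le> (c * (\<K> \<beta> / (\<beta> - b 1)) * (\<beta> / 2)) * \<bar>Lam x - Lam y\<bar>"
proof -
  define L where "L = \<K> \<beta> / (\<beta> - b 1)"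
  have Kb: "\<K> \<beta> \<ge> 0" using koenigs_lower[of \<beta>] beta_pos beta_le_B by simp
  have L0: "L \<ge> 0" using Kb b1_less by (simp add: L_def)
  have 1: "\<K> t - \<K> s \<le> L * (t - s)" if st: "0 \<le> s" "s < t" "t \<le> b 1" for s t
  proof -
    define l where "l = (t - s) / (\<beta> - s)"
    have bs: "\<beta> - s > 0" using st b1_less by simp
    have "l * (\<beta> - s) = t - s" using bs by (simp add: l_def)
    hence l3: "t = (1 - l) *\<^sub>R s + l *\<^sub>R \<beta>" by (simp add: algebra_simps)
    have l: "0 \<le> l" "l \<le> 1" using st b1_less bs by (auto simp: l_def)
    have "\<K> t \<le> (1 - l) * \<K> s + l * \<K> \<beta>"
      unfolding l3 using l st b1_less beta_le_B by (intro convex_onD[OF koenigs_convex]) auto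
    hence "\<K> t - \<K> s \<le> l * (\<K> \<beta> - \<K> s)" by (simp add: algebra_simps)
    also have "\<dots> \<le> l * \<K> \<beta>" using koenigs_lower[of s] st b1_less beta_le_B l by (intro mult_left_mono) auto
    also have "\<dots> \<le> ((t - s) / (\<beta> - b 1)) * \<K> \<beta>"
      unfolding l_def using st b1_less Kb bs by (intro mult_right_mono divide_left_mono mult_pos_pos) auto
    finally show ?thesis by (simp add: L_def mult.commute)
  qed
  have 2: "\<bar>\<K> s - \<K> t\<bar> \<le> L * \<bar>s - t\<bar>" if "0 \<le> s" "s \<le> b 1" "0 \<le> t" "t \<le> b 1" for s t
    using 1[of s t] 1[of t s] that koenigs_mono[of s t] koenigs_mono[of t s] b1_less beta_le_B
    by (cases s t rule: linorder_cases) auto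
  have S: "0 \<le> S x" "S x \<le> b 1" "0 \<le> S y" "S y \<le> b 1" using S_mem[of x] S_mem[of y] xy beta_le_B by auto
  have cosd: "\<bar>cos u - cos v\<bar> \<le> \<bar>u - v\<bar>" for u v :: real
  proof -
    have "norm (cos u - cos v) \<le> 1 * norm (u - v)"
      by (rule field_differentiable_bound[of UNIV cos "\<lambda>x. - sin x"]) (auto intro!: derivative_eq_intros)
    thus ?thesis by simp
  qed
  have e: "S x - S y = \<beta> / 2 * (cos (Lam (S y)) - cos (Lam (S x)))"
    using cos_Lam[of "S x"] cos_Lam[of "S y"] S b1_less by (simp add: algebra_simps)
  have "\<bar>S x - S y\<bar> = \<beta> / 2 * \<bar>cos (Lam (S y)) - cos (Lam (S x))\<bar>"
    unfolding e abs_mult using beta_pos by simp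
  also have "\<dots> \<le> \<beta> / 2 * \<bar>Lam (S x) - Lam (S y)\<bar>"
    using cosd[of "Lam (S y)" "Lam (S x)"] beta_pos by (intro mult_left_mono) (auto simp: abs_minus_commute)
  also have "\<bar>Lam (S x) - Lam (S y)\<bar> \<le> (\<Sum>j\<in>{1..N}. \<bar>Lam (\<phi> j x) - Lam (\<phi> j y)\<bar>)"
    by (rule member_le_sum[of "Suc 0" "{1..N}" "\<lambda>j. \<bar>Lam (\<phi> j x) - Lam (\<phi> j y)\<bar>"]) (use N2 in auto)
  also have "\<dots> \<le> \<gamma> i * \<bar>Lam x - Lam y\<bar>"
    by (rule Lam_contraction) (use sum_contr_le i xy in auto)
  also have "\<dots> \<le> 1 * \<bar>Lam x - Lam y\<bar>" using gamma_range[OF i] by (intro mult_right_mono) auto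
  finally have S': "\<bar>S x - S y\<bar> \<le> \<beta> / 2 * \<bar>Lam x - Lam y\<bar>" using beta_pos by simp
  have "\<bar>\<K> x - \<K> y\<bar> = c * \<bar>\<K> (S x) - \<K> (S y)\<bar>"
    using koenigs_S[of x] koenigs_S[of y] xy beta_le_B c1 by (simp add: abs_mult flip: right_diff_distrib)
  also have "\<dots> \<le> c * (L * \<bar>S x - S y\<bar>)" using 2 S c1 by (intro mult_left_mono) auto
  also have "\<dots> \<le> c * (L * (\<beta> / 2 * \<bar>Lam x - Lam y\<bar>))" using S' L0 c1 by (intro mult_left_mono) auto
  finally show ?thesis by (simp add: L_def mult_ac)
qed

lemma psi_totally_disconnected:
  assumes td: "totally_disconnected (julia_set R)" and z0: "0 \<le> z0" "z0 \<le> B"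
  shows "\<exists>\<epsilon>>0. psi z0 holomorphic_on {s. Re s > - \<epsilon>}"
proof -
  obtain i where i: "i \<in> {1..<N}" "gap i > 0" using gap_exists[OF td] .
  \<comment> \<open>Chosen such that c^(\<epsilon>/2) = 1 / \<open>\<gamma> i\<close>, which
    balances the rate \<open>\<gamma> i / N\<close> against |q|.\<close>
  define \<epsilon> where "\<epsilon> = - 2 * ln (\<gamma> i) / ln c"
  have g: "0 < \<gamma> i" "\<gamma> i < 1" using gamma_range[OF i] .
  have "\<epsilon> > 0" using g c1 by (auto simp: \<epsilon>_def field_simps)
  moreover have "psi z0 holomorphic_on {s. Re s > - \<epsilon>}"
  proof (rule psi_holomorphic_of_oscillation[OF z0, of "\<gamma> i / N"])
    show "\<gamma> i / N > 0" using g N2 by simp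
    have "c powr (- (- \<epsilon>) / 2) = 1 / \<gamma> i"
      using g c1 by (simp add: powr_def \<epsilon>_def exp_minus inverse_eq_divide)
    thus "\<gamma> i / N * (N * c powr (- (- \<epsilon>) / 2)) \<le> 1" using g N2 by simp
    fix r :: real
    define C where "C = c * (\<K> \<beta> / (\<beta> - b 1)) * (\<beta> / 2)"
    have C0: "C \<ge> 0" unfolding C_def using c1 b1_less beta_pos koenigs_lower[of \<beta>] beta_le_B by simp
    have "norm (av m s u - av m s v) \<le> (lip r * C * pi) * (\<gamma> i / N) ^ m"
      if s: "norm s \<le> r" and uv: "0 \<le> u" "u \<le> \<beta>" "0 \<le> v" "v \<le> \<beta>" for s m u v
    proof -
      have r: "r \<ge> 0" using s norm_ge_zero order.trans by blast
      have "dsum (Suc m) (\<lambda>x y. \<bar>\<K> x - \<K> y\<bar>) u v \<le> dsum (Suc m) (\<lambda>x y. C * \<bar>Lam x - Lam y\<bar>) u v"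
        unfolding C_def by (rule dsum_mono[OF order_refl beta_le_B]) (use koenigs_Lam_lipschitz[OF i] uv in auto)
      also have "\<dots> = C * dsum (Suc m) (\<lambda>x y. \<bar>Lam x - Lam y\<bar>) u v" by (rule dsum_mult)
      also have "\<dots> \<le> C * (\<gamma> i ^ Suc m * \<bar>Lam u - Lam v\<bar>)"
        by (rule mult_left_mono[OF dsum_Lam[OF i uv] C0])
      also have "\<dots> \<le> C * (\<gamma> i ^ m * pi)"
      proof (intro mult_left_mono mult_mono C0)
        show "\<gamma> i ^ Suc m \<le> \<gamma> i ^ m" using g by (intro power_decreasing) auto
        show "\<bar>Lam u - Lam v\<bar> \<le> pi" using Lam_range[of u] Lam_range[of v] uv by auto
      qed (use g in auto)
      finally have d: "dsum (Suc m) (\<lambda>x y. \<bar>\<K> x - \<K> y\<bar>) u v \<le> C * (\<gamma> i ^ m * pi)" .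
      have "norm (av m s u - av m s v) \<le> lip r * dsum (Suc m) (\<lambda>x y. \<bar>\<K> x - \<K> y\<bar>) u v / real N ^ Suc m"
        using uv beta_le_B by (intro av_diff_le s) auto
      also have "\<dots> \<le> lip r * (C * (\<gamma> i ^ m * pi)) / real N ^ m"
        using d lip_nonneg[OF r] N2 C0 g by (intro frac_le mult_left_mono power_increasing mult_nonneg_nonneg) auto
      also have "\<dots> = (lip r * C * pi) * (\<gamma> i / N) ^ m" by (simp add: power_divide)
      finally show ?thesis .
    qed
    thus "\<exists>C. \<forall>s m u v. norm s \<le> r \<longrightarrow> 0 \<le> u \<longrightarrow> u \<le> \<beta> \<longrightarrow> 0 \<le> v \<longrightarrow> v \<le> \<beta> \<longrightarrow>
        norm (av m s u - av m s v) \<le> C * (\<gamma> i / N) ^ m" by blast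
  qed
  ultimately show ?thesis by blast
qed

section \<open>Word sums of the Cauchy kernel\<close>

lemma log_derivative:
  assumes w: "0 \<le> w" "w \<le> B" and z: "\<And>j. j \<in> {1..N} \<Longrightarrow> z \<noteq> of_real (\<phi> j w)"
  shows "(\<Sum>j=1..N. 1 / (z - of_real (\<phi> j w))) = poly (pderiv R) z / (poly R z - of_real w)"
proof -
  define p where "p = (\<Prod>j\<in>{1..N}. [:- complex_of_real (\<phi> j w), 1:])"
  have "R = smult (lead_coeff R) p + [:of_real w:]"
  proof (rule poly_eq_poly_eq_iff[THEN iffD1, OF ext])
    fix x
    show "poly R x = poly (smult (lead_coeff R) p + [:of_real w:]) x"
      using poly_factor[OF w, of x] by (simp add: p_def poly_prod algebra_simps)
  qed
  hence "pderiv R = pderiv (smult (lead_coeff R) p + [:of_real w:])" by (rule arg_cong)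
  hence "pderiv R = smult (lead_coeff R) (pderiv p)"
    by (simp add: pderiv_add pderiv_smult pderiv_pCons)
  moreover have "poly (pderiv p) z = (\<Sum>j\<in>{1..N}. \<Prod>k\<in>{1..N}-{j}. z - of_real (\<phi> k w))"
    by (simp add: p_def pderiv_prod poly_sum poly_prod pderiv_pCons)
  ultimately have "poly (pderiv R) z = lead_coeff R * (\<Sum>j\<in>{1..N}. \<Prod>k\<in>{1..N}-{j}. z - of_real (\<phi> k w))"
    by simp
  also have "(\<Sum>j\<in>{1..N}. \<Prod>k\<in>{1..N}-{j}. z - of_real (\<phi> k w)) =
      (\<Sum>j\<in>{1..N}. (\<Prod>k\<in>{1..N}. z - of_real (\<phi> k w)) * (1 / (z - of_real (\<phi> j w))))"
  proof (intro sum.cong refl)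
    fix j assume j: "j \<in> {1..N}"
    have "(\<Prod>k\<in>{1..N}. z - of_real (\<phi> k w)) = (z - of_real (\<phi> j w)) * (\<Prod>k\<in>{1..N}-{j}. z - of_real (\<phi> k w))"
      by (rule prod.remove) (use j in auto)
    thus "(\<Prod>k\<in>{1..N}-{j}. z - of_real (\<phi> k w)) = (\<Prod>k\<in>{1..N}. z - of_real (\<phi> k w)) * (1 / (z - of_real (\<phi> j w)))"
      using z[OF j] by simp
  qed
  finally have "poly (pderiv R) z = (poly R z - of_real w) * (\<Sum>j=1..N. 1 / (z - of_real (\<phi> j w)))"
    unfolding poly_factor[OF w, of z] sum_distrib_left[symmetric] by (simp only: mult.assoc)
  moreover have "poly R z - of_real w \<noteq> 0"
    unfolding poly_factor[OF w, of z] using z R_nz by auto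
  ultimately show ?thesis by simp
qed

definition segment :: "complex set" where "segment = of_real ` {0..\<beta>}"

lemma segment_backward: "z \<notin> segment \<Longrightarrow> poly R z \<notin> segment"
proof
  assume z: "z \<notin> segment" and "poly R z \<in> segment"
  then obtain w where w: "0 \<le> w" "w \<le> \<beta>" "poly R z = of_real w" by (auto simp: segment_def)
  hence "lead_coeff R * (\<Prod>j\<in>{1..N}. z - of_real (\<phi> j w)) = 0"
    using poly_factor[of w z] beta_le_B by simp
  then obtain j where j: "j \<in> {1..N}" "z = of_real (\<phi> j w)" using R_nz by auto
  thus False using z phi_range[OF j(1), of w] w beta_le_B by (auto simp: segment_def)
qed

text \<open>By the chain rule this is the derivative of the m-th iterate of R at z.\<close>

primrec dpow :: "nat \<Rightarrow> complex \<Rightarrow> complex" where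
  "dpow 0 z = 1"
| "dpow (Suc m) z = poly (pderiv R) z * dpow m (poly R z)"

text \<open>The sum of 1/(z - p) over the preimages p of y under R^m is the logarithmic derivative
  of R^m - y. Points off the hull stay off it under R, so the induction may move z to R(z).\<close>

lemma wsum_cauchy_kernel:
  assumes "z \<notin> segment" "0 \<le> y" "y \<le> \<beta>"
  shows "wsum m (\<lambda>x. 1 / (z - of_real x)) y = dpow m z / ((poly R ^^ m) z - of_real y)"
  using assms(1)
proof (induction m arbitrary: z)
  case (Suc m)
  have "wsum (Suc m) (\<lambda>x. 1 / (z - of_real x)) y = wsum m (\<lambda>x. \<Sum>j=1..N. 1 / (z - of_real (\<phi> j x))) y"
    by (rule wsum_Suc_inner)
  also have "\<dots> = wsum m (\<lambda>x. poly (pderiv R) z * (1 / (poly R z - of_real x))) y"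
  proof (rule wsum_cong[OF order_refl beta_le_B _ assms(2,3)])
    fix x assume x: "0 \<le> x" "x \<le> \<beta>"
    have "z \<noteq> of_real (\<phi> j x)" if "j \<in> {1..N}" for j
      using Suc.prems phi_range[OF that, of x] x beta_le_B by (auto simp: segment_def)
    thus "(\<Sum>j=1..N. 1 / (z - of_real (\<phi> j x))) = poly (pderiv R) z * (1 / (poly R z - of_real x))"
      using log_derivative[of x z] x beta_le_B by simp
  qed
  also have "\<dots> = poly (pderiv R) z * wsum m (\<lambda>x. 1 / (poly R z - of_real x)) y" by (rule wsum_mult)
  also have "\<dots> = dpow (Suc m) z / ((poly R ^^ Suc m) z - of_real y)"
    unfolding Suc.IH[OF segment_backward[OF Suc.prems]] by (simp add: funpow_swap1)
  finally show ?case .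
qed simp

lemma iterate_not_segment: "z \<notin> segment \<Longrightarrow> (poly R ^^ m) z \<notin> segment"
  by (induction m) (auto simp: segment_backward)

text \<open>By the closed form, the difference is the sum at base point 0 times y / (Q - y) with Q =
  R^m(z). The first factor is bounded trivially, by N^m terms of size 1/d; the smallness comes
  entirely from the escape of Q.\<close>

lemma cauchy_kernel_diff:
  assumes z: "z \<notin> segment" and d: "d > 0" "\<And>x. 0 \<le> x \<Longrightarrow> x \<le> \<beta> \<Longrightarrow> d \<le> norm (z - of_real x)"
    and y: "0 \<le> y" "y \<le> \<beta>" and large: "2 * \<beta> \<le> norm ((poly R ^^ m) z)"
  shows "norm (wsum m (\<lambda>x. 1 / (z - of_real x)) y - wsum m (\<lambda>x. 1 / (z - of_real x)) 0)
      \<le> real N ^ m / d * (2 * \<beta> / norm ((poly R ^^ m) z))"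
proof -
  define Q where "Q = (poly R ^^ m) z"
  have Q: "Q \<notin> segment" unfolding Q_def by (rule iterate_not_segment[OF z])
  have Q0: "Q \<noteq> 0" "Q - of_real y \<noteq> 0" using Q y beta_pos by (auto simp: segment_def)
  have w0: "wsum m (\<lambda>x. 1 / (z - of_real x)) 0 = dpow m z / Q"
    using wsum_cauchy_kernel[OF z, of 0 m] beta_pos by (simp add: Q_def)
  have "wsum m (\<lambda>x. 1 / (z - of_real x)) y - wsum m (\<lambda>x. 1 / (z - of_real x)) 0 =
      wsum m (\<lambda>x. 1 / (z - of_real x)) 0 * (of_real y / (Q - of_real y))"
    unfolding w0 unfolding wsum_cauchy_kernel[OF z y] Q_def[symmetric] using Q0 by (simp add: field_simps)
  hence "norm (wsum m (\<lambda>x. 1 / (z - of_real x)) y - wsum m (\<lambda>x. 1 / (z - of_real x)) 0) =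
      norm (wsum m (\<lambda>x. 1 / (z - of_real x)) 0) * (y / norm (Q - of_real y))"
    using y by (simp add: norm_mult norm_divide)
  also have "\<dots> \<le> (real N ^ m * (1 / d)) * (\<beta> / (norm Q / 2))"
  proof (intro mult_mono)
    show "norm (wsum m (\<lambda>x. 1 / (z - of_real x)) 0) \<le> real N ^ m * (1 / d)"
    proof (rule wsum_norm_le[OF order_refl beta_le_B])
      fix x assume "0 \<le> x" "x \<le> \<beta>"
      from d(2)[OF this] d(1) show "norm (1 / (z - of_real x)) \<le> 1 / d"
        by (simp add: norm_divide frac_le)
    qed (use beta_pos in auto)
    have "norm Q - y \<le> norm (Q - of_real y)" using norm_triangle_ineq2[of Q "of_real y"] y by simp
    hence "norm Q / 2 \<le> norm (Q - of_real y)" using large y by (simp add: Q_def)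
    moreover have "norm Q > 0" using Q0 by simp
    ultimately show "y / norm (Q - of_real y) \<le> \<beta> / (norm Q / 2)" using y by (intro frac_le) auto
  qed (use y d in auto)
  also have "\<dots> = real N ^ m / d * (2 * \<beta> / norm ((poly R ^^ m) z))" by (simp add: Q_def)
  finally show ?thesis .
qed

text \<open>The rate M holds outside a large disc; compactness gives one time n0 from which on all
  orbits starting in K are there.\<close>

lemma compact_escape:
  assumes K: "compact K" "K \<inter> segment = {}" and M: "M \<ge> 1"
  obtains n0 where "\<And>z m. z \<in> K \<Longrightarrow> n0 \<le> m \<Longrightarrow> M ^ (m - n0) \<le> norm ((poly R ^^ m) z)"
     "\<And>z m. z \<in> K \<Longrightarrow> n0 \<le> m \<Longrightarrow> 2 * \<beta> \<le> norm ((poly R ^^ m) z)"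
proof -
  obtain \<rho>0 where \<rho>0: "\<rho>0 \<ge> 1" "\<And>z. \<rho>0 \<le> norm z \<Longrightarrow> M * norm z \<le> norm (poly R z)"
    using poly_superlinear_growth[of R M] deg N2 R0 by auto
  define \<rho> where "\<rho> = max \<rho>0 (2 * \<beta>)"
  have \<rho>: "\<rho> \<ge> 1" "\<rho> \<ge> 2 * \<beta>" "\<And>z. \<rho> \<le> norm z \<Longrightarrow> M * norm z \<le> norm (poly R z)"
    using \<rho>0 by (auto simp: \<rho>_def)
  define A where "A n = {z. \<rho> < norm ((poly R ^^ n) z)}" for n
  have openA: "open (A n)" for n
    unfolding A_def by (intro open_Collect_less continuous_intros continuous_on_funpow)
  have step: "\<rho> \<le> norm ((poly R ^^ (l + n)) z) \<and> M ^ l * norm ((poly R ^^ n) z) \<le> norm ((poly R ^^ (l + n)) z)"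
    if "\<rho> \<le> norm ((poly R ^^ n) z)" for l n z
    using funpow_growth[of \<rho> M "poly R" "(poly R ^^ n) z" l] \<rho> M that by (simp add: funpow_add)
  have "K \<subseteq> (\<Union>n. A n)"
  proof
    fix z assume "z \<in> K"
    hence "z \<notin> segment" using K by auto
    have "z \<notin> julia_set R"
    proof
      assume J: "z \<in> julia_set R"
      hence "Re z \<in> rjulia R" by (auto simp: rjulia_eq)
      hence "of_real (Re z) \<in> segment" using rjulia_nonneg rjulia_le by (auto simp: segment_def)
      thus False using J julia_real[of z] \<open>z \<notin> segment\<close> by simp
    qed
    hence "z \<in> escaping" by (simp add: julia_set_def fatou_eq_escaping)
    hence "\<forall>\<^sub>F n in sequentially. \<rho> < norm ((poly R ^^ n) z)"
      using escaping_to_infinity by (simp add: filterlim_at_top_dense)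
    then obtain n where "\<rho> < norm ((poly R ^^ n) z)" using eventually_happens'[OF sequentially_bot] by blast
    thus "z \<in> (\<Union>n. A n)" by (auto simp: A_def)
  qed
  then obtain F where F: "finite F" "K \<subseteq> (\<Union>n\<in>F. A n)"
    using compactE_image[OF K(1), of UNIV A] openA by auto
  define n0 where "n0 = Max (insert 0 F)"
  have n0: "\<rho> \<le> norm ((poly R ^^ n0) z)" if z: "z \<in> K" for z
  proof -
    obtain n where n: "n \<in> F" "\<rho> < norm ((poly R ^^ n) z)" using F(2) z by (auto simp: A_def)
    have "n \<le> n0" unfolding n0_def using F(1) n by (intro Max_ge) auto
    thus ?thesis using step[of n z "n0 - n"] n by simp
  qed
  show ?thesis
  proof (rule that[of n0])
    fix z m assume zm: "z \<in> K" "n0 \<le> m"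
    have s: "\<rho> \<le> norm ((poly R ^^ m) z)" "M ^ (m - n0) * norm ((poly R ^^ n0) z) \<le> norm ((poly R ^^ m) z)"
      using step[OF n0[OF zm(1)], of "m - n0"] zm by auto
    show "2 * \<beta> \<le> norm ((poly R ^^ m) z)" using s \<rho> by simp
    have "M ^ (m - n0) * 1 \<le> M ^ (m - n0) * norm ((poly R ^^ n0) z)"
      using n0[OF zm(1)] \<rho>(1) M by (intro mult_left_mono) auto
    thus "M ^ (m - n0) \<le> norm ((poly R ^^ m) z)" using s(2) by simp
  qed
qed

end

section \<open>Hyperbolic Julia sets\<close>

definition nbhd :: "real \<Rightarrow> real \<Rightarrow> real \<Rightarrow> complex set" where
  "nbhd l u e = (\<Union>x\<in>{l..u}. ball (complex_of_real x) e)"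

lemma nbhdI: "l \<le> x \<Longrightarrow> x \<le> u \<Longrightarrow> norm (z - of_real x) < e \<Longrightarrow> z \<in> nbhd l u e"
  unfolding nbhd_def by (rule UN_I[of x]) (auto simp: dist_norm norm_minus_commute)

lemma nbhdE:
  assumes "z \<in> nbhd l u e"
  obtains x where "l \<le> x" "x \<le> u" "norm (z - of_real x) < e"
  using assms that unfolding nbhd_def by (force simp: dist_norm norm_minus_commute)

lemma open_nbhd [simp]: "open (nbhd l u e)"
  by (auto simp: nbhd_def)

lemma convex_nbhd: "convex (nbhd l u e)"
proof (rule convexI)
  fix z w and s t :: real
  assume zw: "z \<in> nbhd l u e" "w \<in> nbhd l u e" and st: "0 \<le> s" "0 \<le> t" "s + t = 1"
  obtain x y where x: "x \<in> {l..u}" "norm (z - of_real x) < e" and y: "y \<in> {l..u}" "norm (w - of_real y) < e"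
    using zw by (auto simp: nbhd_def dist_norm norm_minus_commute)
  have "s *\<^sub>R (z - of_real x) + t *\<^sub>R (w - of_real y) \<in> ball 0 e"
    using x y st by (intro convexD[OF convex_ball]) auto
  moreover have "s *\<^sub>R z + t *\<^sub>R w - of_real (s * x + t * y) = s *\<^sub>R (z - of_real x) + t *\<^sub>R (w - of_real y)"
    by (simp add: scaleR_conv_of_real algebra_simps)
  ultimately have "norm (s *\<^sub>R z + t *\<^sub>R w - of_real (s * x + t * y)) < e" by simp
  moreover have "s * x + t * y \<in> {l..u}"
    using convexD[of "{l..u}" x y s t] x y st by simp
  ultimately show "s *\<^sub>R z + t *\<^sub>R w \<in> nbhd l u e"
    unfolding nbhd_def by (intro UN_I[of "s * x + t * y"]) (auto simp: dist_norm norm_minus_commute)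
qed

lemma nbhd_mono: "e \<le> e' \<Longrightarrow> nbhd l u e \<subseteq> nbhd l u e'"
  unfolding nbhd_def using subset_ball by blast

lemma of_real_nbhd: "e > 0 \<Longrightarrow> x \<in> {l..u} \<Longrightarrow> of_real x \<in> nbhd l u e"
  unfolding nbhd_def by (rule UN_I[of x]) auto

lemma nbhd_within_open:
  assumes "open T" "of_real ` {l..u} \<subseteq> T"
  obtains e where "e > 0" "nbhd l u e \<subseteq> T"
proof -
  have "compact (complex_of_real ` {l..u})" by (intro compact_continuous_image continuous_intros) auto
  from compact_subset_open_imp_ball_epsilon_subset[OF this assms] obtain e
    where "e > 0" "(\<Union>x\<in>complex_of_real ` {l..u}. ball x e) \<subseteq> T" by blast
  thus ?thesis using that[of e] by (simp add: nbhd_def)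
qed

text \<open>The Noshiro-Warschawski criterion, by the mean value theorem along the segment from w to
  z. The real factor t admits derivatives of negative real part, for the decreasing
  branches.\<close>

lemma inj_on_convex_deriv:
  fixes f :: "complex \<Rightarrow> complex"
  assumes "convex A" and f: "\<And>z. z \<in> A \<Longrightarrow> (f has_field_derivative f' z) (at z)"
    and pos: "\<And>z. z \<in> A \<Longrightarrow> Re (of_real t * f' z) > 0"
  shows "inj_on f A"
proof (rule inj_onI, rule ccontr)
  fix w z assume wz: "w \<in> A" "z \<in> A" "f w = f z" "w \<noteq> z"
  define k where "k = of_real t * cnj (z - w)"
  have sub: "closed_segment w z \<subseteq> A" using wz \<open>convex A\<close> by (simp add: closed_segment_subset)
  have "((\<lambda>x. k * f x) has_field_derivative k * f' u) (at u)" if "u \<in> closed_segment w z" for u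
    using that sub by (intro DERIV_cmult f) auto
  from complex_mvt_line[of w z "\<lambda>x. k * f x" "\<lambda>u. k * f' u", OF this] obtain u where u: "u \<in> closed_segment w z"
    "Re (k * f z) - Re (k * f w) = Re (k * f' u * (z - w))" by blast
  have "k * f' u * (z - w) = of_real t * f' u * ((z - w) * cnj (z - w))" by (simp add: k_def mult_ac)
  also have "\<dots> = of_real t * f' u * of_real (norm (z - w) ^ 2)" by (simp only: complex_norm_square)
  finally have eq: "k * f' u * (z - w) = of_real t * f' u * of_real (norm (z - w) ^ 2)" .
  have "Re (k * f' u * (z - w)) = Re (of_real t * f' u) * norm (z - w) ^ 2"
    unfolding eq by (simp del: of_real_power)
  also have "\<dots> > 0" using pos[of u] u sub wz by (intro mult_pos_pos) auto
  finally show False using u wz by simp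
qed

locale hyperbolic_julia_poly = julia_poly +
  fixes r :: real
  assumes r_pos: "0 < r" and r_less_1: "r < 1"
    and expanding: "\<And>z. z \<in> julia_set R \<Longrightarrow> 1 / r \<le> norm (poly (pderiv R) z)"
begin

lemma expanding_real: "x \<in> rjulia R \<Longrightarrow> 1 / r \<le> \<bar>poly (pderiv P) x\<bar>"
  using expanding[of "of_real x"] by (simp add: rjulia_def poly_P')

text \<open>Critical values avoid (0, \<beta>) in any case. A critical value 0 or \<beta> would make
  the critical point a Julia point, where P' cannot vanish.\<close>

lemma crit_escapes: assumes "x \<in> crit" shows "poly P x \<notin> {0..\<beta>}"
proof
  assume "poly P x \<in> {0..\<beta>}"
  hence "poly P x = 0 \<or> poly P x = \<beta>" using crit_value[OF assms] by force
  hence "x \<in> rjulia R" using rjulia_invariant[of x] zero_rjulia beta_rjulia by auto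
  hence "1 / r \<le> \<bar>poly (pderiv P) x\<bar>" by (rule expanding_real)
  thus False using assms r_pos by (simp add: crit_def)
qed

lemma pderiv_nonzero_cylinder:
  assumes j: "j \<in> {1..N}" and y: "lo j \<le> y" "y \<le> hi j"
  shows "poly (pderiv P) y \<noteq> 0"
proof
  assume "poly (pderiv P) y = 0"
  hence cr: "y \<in> crit" by (simp add: crit_def)
  have "b (j - 1) \<le> y" "y \<le> b j" using y lo_hi[OF j] by linarith+
  moreover have "j - 1 < N" using j by auto
  hence "\<not> (b (j - 1) < y \<and> y < b j)" using no_crit_between[of "j - 1" y] cr j by (auto simp: crit_def)
  ultimately have "y = lo j \<or> y = hi j" using lo_hi[OF j] y by linarith
  hence "y \<in> {\<phi> j 0, \<phi> j \<beta>}" by (auto simp: lo_def hi_def min_def max_def split: if_splits)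
  moreover have "poly P (\<phi> j 0) = 0" "poly P (\<phi> j \<beta>) = \<beta>"
    using phi_mem(3)[OF j, of 0] phi_mem(3)[OF j, of \<beta>] beta_pos beta_le_B B_pos by auto
  ultimately have "poly P y \<in> {0..\<beta>}" using beta_pos by auto
  thus False using crit_escapes[OF cr] by blast
qed

lemma pderiv_sign_cylinder:
  assumes j: "j \<in> {1..N}"
  obtains t :: real where "\<And>y. lo j \<le> y \<Longrightarrow> y \<le> hi j \<Longrightarrow> 0 < t * poly (pderiv P) y"
proof -
  define t where "t = sgn (poly (pderiv P) (lo j))"
  have "0 < t * poly (pderiv P) y" if y: "lo j \<le> y" "y \<le> hi j" for y
  proof (rule ccontr)
    assume neg: "\<not> 0 < t * poly (pderiv P) y"
    have nz: "poly (pderiv P) x \<noteq> 0" if "lo j \<le> x" "x \<le> y" for x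
      using pderiv_nonzero_cylinder[OF j, of x] that y by auto
    have "y \<noteq> lo j" using neg nz[of "lo j"] y by (auto simp: t_def sgn_mult_self_eq abs_sgn[symmetric] mult.commute)
    hence ly: "lo j < y" using y by simp
    consider "poly (pderiv P) (lo j) > 0" "poly (pderiv P) y < 0" | "poly (pderiv P) (lo j) < 0" "poly (pderiv P) y > 0"
      using neg nz[of "lo j"] nz[of y] y by (cases "poly (pderiv P) (lo j) > 0") (auto simp: t_def not_less)
    thus False
    proof cases
      case 1
      then obtain x where "lo j < x" "x < y" "poly (pderiv P) x = 0" using poly_IVT_neg[OF ly] by blast
      thus ?thesis using nz[of x] by simp
    next
      case 2
      then obtain x where "lo j < x" "x < y" "poly (pderiv P) x = 0" using poly_IVT_pos[OF ly] by blast
      thus ?thesis using nz[of x] by simp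
    qed
  qed
  thus ?thesis by (rule that)
qed

lemma phi_lo_hi: "j \<in> {1..N} \<Longrightarrow> 0 \<le> x \<Longrightarrow> x \<le> \<beta> \<Longrightarrow> lo j \<le> \<phi> j x \<and> \<phi> j x \<le> hi j"
  using phi_between[of j x] by (cases "x = 0"; cases "x = \<beta>") (auto simp: lo_def hi_def)

text \<open>R is injective on a convex neighbourhood of the band, where Re (t R') > 0. The open set
  T lets each application prescribe where the extended branch takes its values: a region of large
  |R'| for S, a region where the extension of \<K> has positive real part for the others.\<close>

lemma branch_extension:
  assumes j: "j \<in> {1..N}" and T: "open T" "of_real ` {lo j..hi j} \<subseteq> T"
  obtains \<eta> \<Phi> where "\<eta> > 0" "\<Phi> holomorphic_on nbhd 0 \<beta> \<eta>"
    "\<And>z. z \<in> nbhd 0 \<beta> \<eta> \<Longrightarrow> \<Phi> z \<in> T \<and> poly R (\<Phi> z) = z \<and> poly (pderiv R) (\<Phi> z) * deriv \<Phi> z = 1"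
    "\<And>x. 0 \<le> x \<Longrightarrow> x \<le> \<beta> \<Longrightarrow> \<Phi> (of_real x) = of_real (\<phi> j x)"
proof -
  obtain t where t: "\<And>y. lo j \<le> y \<Longrightarrow> y \<le> hi j \<Longrightarrow> 0 < t * poly (pderiv P) y"
    using pderiv_sign_cylinder[OF j] by blast
  define T' where "T' = T \<inter> {z. Re (of_real t * poly (pderiv R) z) > 0}"
  have "open {z. Re (of_real t * poly (pderiv R) z) > 0}"
    by (intro open_Collect_less continuous_intros)
  hence "open T'" unfolding T'_def using T by blast
  moreover have "of_real ` {lo j..hi j} \<subseteq> T'" using T t by (auto simp: T'_def poly_P')
  ultimately obtain e where e: "e > 0" "nbhd (lo j) (hi j) e \<subseteq> T'" by (rule nbhd_within_open)
  define W where "W = nbhd (lo j) (hi j) e"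
  have W: "open W" "convex W" "W \<subseteq> T'" using e convex_nbhd by (auto simp: W_def)
  have der: "(poly R has_field_derivative poly (pderiv R) z) (at z)" for z by (rule poly_DERIV)
  have hol: "poly R holomorphic_on W" by (intro holomorphic_intros)
  have inj: "inj_on (poly R) W"
    by (rule inj_on_convex_deriv[OF W(2) der, of t]) (use W(3) in \<open>auto simp: T'_def\<close>)
  from holomorphic_has_inverse[OF hol W(1) inj] obtain \<Phi> where \<Phi>: "\<Phi> holomorphic_on (poly R ` W)"
     "\<And>z. z \<in> W \<Longrightarrow> deriv (poly R) z * deriv \<Phi> (poly R z) = 1" "\<And>z. z \<in> W \<Longrightarrow> \<Phi> (poly R z) = z" by blast
  have phiW: "of_real (\<phi> j x) \<in> W" if "0 \<le> x" "x \<le> \<beta>" for x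
    using phi_lo_hi[OF j that] e(1) by (auto simp: W_def intro: of_real_nbhd)
  have Rphi: "poly R (of_real (\<phi> j x)) = of_real x" if "0 \<le> x" "x \<le> \<beta>" for x
    using phi_mem(3)[OF j, of x] that beta_le_B by (simp add: poly_P)
  have "open (poly R ` W)" by (rule open_mapping_thm3[OF hol W(1) inj])
  moreover have "of_real ` {0..\<beta>} \<subseteq> poly R ` W"
  proof
    fix z assume "z \<in> complex_of_real ` {0..\<beta>}"
    then obtain x where "0 \<le> x" "x \<le> \<beta>" "z = of_real x" by auto
    thus "z \<in> poly R ` W" using phiW[of x] Rphi[of x] by (intro image_eqI[of _ _ "of_real (\<phi> j x)"]) auto
  qed
  ultimately obtain \<eta> where \<eta>: "\<eta> > 0" "nbhd 0 \<beta> \<eta> \<subseteq> poly R ` W" by (rule nbhd_within_open)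
  show ?thesis
  proof (rule that[of \<eta> \<Phi>])
    show "\<Phi> holomorphic_on nbhd 0 \<beta> \<eta>" using \<Phi>(1) \<eta>(2) by (rule holomorphic_on_subset)
    show "\<Phi> (of_real x) = of_real (\<phi> j x)" if "0 \<le> x" "x \<le> \<beta>" for x
      using \<Phi>(3)[OF phiW[OF that]] Rphi[OF that] by simp
    fix z assume "z \<in> nbhd 0 \<beta> \<eta>"
    then obtain w where w: "w \<in> W" "z = poly R w" using \<eta> by blast
    have "deriv (poly R) w = poly (pderiv R) w" by (rule DERIV_imp_deriv[OF der])
    thus "\<Phi> z \<in> T \<and> poly R (\<Phi> z) = z \<and> poly (pderiv R) (\<Phi> z) * deriv \<Phi> z = 1"
      using \<Phi>(2,3)[OF w(1)] w W(3) by (auto simp: T'_def)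
  qed (use \<eta> in auto)
qed

text \<open>P' decreases on the first piece, so its minimum on [0, S \<beta>] is at the Julia point
  S \<beta>. Expansion, assumed on the Julia set only, thus extends to the whole first band.\<close>

lemma S_beta_slope:
  assumes "0 \<le> y" "y \<le> S \<beta>" shows "1 / r \<le> poly (pderiv P) y"
proof -
  have b: "0 \<le> S \<beta>" "S \<beta> \<le> b 1" "poly P (S \<beta>) = \<beta>" using S_mem[of \<beta>] beta_pos beta_le_B by auto
  have "S \<beta> \<noteq> b 1" using crit_escapes[of "b 1"] b_crit[of 1] N2 b(3) beta_pos by auto
  hence Sb: "S \<beta> < b 1" using b by simp
  have "S \<beta> \<in> rjulia R" using phi_rjulia[of "Suc 0" \<beta>] beta_rjulia N2 by simp
  hence 1: "1 / r \<le> poly (pderiv P) (S \<beta>)" using expanding_real[of "S \<beta>"] P'_pos[of "S \<beta>"] b Sb by simp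
  show ?thesis
  proof (cases "y = S \<beta>")
    case False
    hence y: "y < S \<beta>" using assms by simp
    obtain x where x: "y < x" "x < S \<beta>" "poly (pderiv P) (S \<beta>) - poly (pderiv P) y = (S \<beta> - y) * poly (pderiv (pderiv P)) x"
      using poly_MVT[OF y, of "pderiv P"] by blast
    have "poly (pderiv (pderiv P)) x < 0" using x assms Sb by (intro pderiv_factor_0 P'_pos) auto
    hence "(S \<beta> - y) * poly (pderiv (pderiv P)) x < 0" using y by (intro mult_pos_neg) auto
    thus ?thesis using 1 x(3) by linarith
  qed (use 1 in simp)
qed

text \<open>Expansion near the first band makes the extended branch a contraction; it preserves the
  hull, so it maps the tube around the hull into itself and drives its points to the fixed point
  0.\<close>

lemma S_extension:
  obtains \<eta> \<Phi> \<rho> where "\<eta> > 0" "0 \<le> \<rho>" "\<rho> < 1" "\<Phi> holomorphic_on nbhd 0 \<beta> \<eta>"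
    "\<And>z. z \<in> nbhd 0 \<beta> \<eta> \<Longrightarrow> \<Phi> z \<in> nbhd 0 \<beta> \<eta> \<and> poly R (\<Phi> z) = z \<and> norm (\<Phi> z) \<le> \<rho> * norm z"
    "\<And>x. 0 \<le> x \<Longrightarrow> x \<le> \<beta> \<Longrightarrow> \<Phi> (of_real x) = of_real (S x)"
proof -
  \<comment> \<open>Above r, so that the set T below is an open neighbourhood of the first band;
    below 1, for contraction.\<close>
  define \<rho> where "\<rho> = (1 + r) / 2"
  have \<rho>: "r < \<rho>" "\<rho> < 1" "0 < \<rho>" using r_pos r_less_1 by (auto simp: \<rho>_def)
  define T where "T = {z. 1 / \<rho> < norm (poly (pderiv R) z)}"
  have one: "Suc 0 \<in> {1..N}" using N2 by simp
  have S0: "S 0 = 0" using S_mem[of 0] S_upper[of 0] B_pos by force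
  have "hi (Suc 0) = S \<beta>"
    using S_mono[of 0 \<beta>] beta_pos beta_le_B by (simp add: hi_def S0)
  hence "1 / \<rho> < norm (poly (pderiv R) (of_real y))" if "y \<in> {lo (Suc 0)..hi (Suc 0)}" for y
  proof -
    have "1 / \<rho> < 1 / r" using \<rho> r_pos by (simp add: field_simps)
    thus ?thesis using S_beta_slope[of y] that lo_1 \<open>hi (Suc 0) = S \<beta>\<close> by (simp add: poly_P')
  qed
  hence sub: "of_real ` {lo (Suc 0)..hi (Suc 0)} \<subseteq> T" by (auto simp: T_def)
  have "open T" unfolding T_def by (intro open_Collect_less continuous_intros)
  from branch_extension[OF one this sub] obtain \<eta> \<Phi> where \<eta>: "\<eta> > 0" "\<Phi> holomorphic_on nbhd 0 \<beta> \<eta>"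
    "\<And>z. z \<in> nbhd 0 \<beta> \<eta> \<Longrightarrow> \<Phi> z \<in> T \<and> poly R (\<Phi> z) = z \<and> poly (pderiv R) (\<Phi> z) * deriv \<Phi> z = 1"
    "\<And>x. 0 \<le> x \<Longrightarrow> x \<le> \<beta> \<Longrightarrow> \<Phi> (of_real x) = of_real (S x)" by blast
  have lip: "norm (\<Phi> z - \<Phi> w) \<le> \<rho> * norm (z - w)" if "z \<in> nbhd 0 \<beta> \<eta>" "w \<in> nbhd 0 \<beta> \<eta>" for z w
  proof (rule field_differentiable_bound[OF convex_nbhd _ _ that])
    fix u assume u: "u \<in> nbhd 0 \<beta> \<eta>"
    show "(\<Phi> has_field_derivative deriv \<Phi> u) (at u within nbhd 0 \<beta> \<eta>)"
      using holomorphic_derivI[OF \<eta>(2) open_nbhd u] by (rule DERIV_subset) auto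
    have "norm (poly (pderiv R) (\<Phi> u)) * norm (deriv \<Phi> u) = 1"
      using \<eta>(3)[OF u] by (metis norm_mult norm_one)
    moreover have "1 / \<rho> < norm (poly (pderiv R) (\<Phi> u))" using \<eta>(3)[OF u] by (simp add: T_def)
    ultimately have "1 / \<rho> * norm (deriv \<Phi> u) \<le> 1" by (metis less_imp_le mult_right_mono norm_ge_zero)
    thus "norm (deriv \<Phi> u) \<le> \<rho>" using \<rho> by (simp add: field_simps)
  qed
  have zero: "0 \<in> nbhd 0 \<beta> \<eta>" using of_real_nbhd[OF \<eta>(1), of 0 0 \<beta>] beta_pos by simp
  have \<Phi>0: "\<Phi> 0 = 0" using \<eta>(4)[of 0] beta_pos S0 by simp
  show ?thesis
  proof (rule that[of \<eta> \<rho> \<Phi>])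
    fix z assume z: "z \<in> nbhd 0 \<beta> \<eta>"
    then obtain x where x: "0 \<le> x" "x \<le> \<beta>" "norm (z - of_real x) < \<eta>" by (rule nbhdE)
    have "of_real x \<in> nbhd 0 \<beta> \<eta>" using x \<eta>(1) by (intro of_real_nbhd) auto
    from lip[OF z this] have "norm (\<Phi> z - of_real (S x)) \<le> \<rho> * norm (z - of_real x)" using \<eta>(4) x by simp
    also have "\<dots> \<le> 1 * norm (z - of_real x)" using \<rho> by (intro mult_right_mono) auto
    finally have "norm (\<Phi> z - of_real (S x)) < \<eta>" using x by simp
    moreover have "S x \<in> {0..\<beta>}" using S_mem[of x] x b1_less beta_le_B by auto
    ultimately have "\<Phi> z \<in> nbhd 0 \<beta> \<eta>"
      by (intro nbhdI[of _ "S x"]) auto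
    thus "\<Phi> z \<in> nbhd 0 \<beta> \<eta> \<and> poly R (\<Phi> z) = z \<and> norm (\<Phi> z) \<le> \<rho> * norm z"
      using \<eta>(3)[OF z] lip[OF z zero] \<Phi>0 by simp
  qed (use \<eta> \<rho> in auto)
qed

text \<open>\<open>koenigs_sequence\<close> for the extended branch, with constants uniform on the
  tube, so that the approximants converge uniformly and the limit is holomorphic.\<close>

lemma koenigs_extension:
  obtains \<eta> K where "\<eta> > 0" "K holomorphic_on nbhd 0 \<beta> \<eta>"
    "\<And>x. 0 \<le> x \<Longrightarrow> x \<le> \<beta> \<Longrightarrow> K (of_real x) = of_real (\<K> x)"
proof -
  obtain \<eta> \<Phi> \<rho> where \<eta>: "\<eta> > 0" and \<rho>: "0 \<le> \<rho>" "\<rho> < 1" and hol: "\<Phi> holomorphic_on nbhd 0 \<beta> \<eta>" and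
    \<Phi>: "\<And>z. z \<in> nbhd 0 \<beta> \<eta> \<Longrightarrow> \<Phi> z \<in> nbhd 0 \<beta> \<eta> \<and> poly R (\<Phi> z) = z \<and> norm (\<Phi> z) \<le> \<rho> * norm z" and
    \<Phi>x: "\<And>x. 0 \<le> x \<Longrightarrow> x \<le> \<beta> \<Longrightarrow> \<Phi> (of_real x) = of_real (S x)"
    by (rule S_extension) (rule that; assumption)
  define V where "V = nbhd 0 \<beta> \<eta>"
  have V: "open V" by (simp add: V_def)
  define D where "D = \<beta> + \<eta>"
  have bound: "norm z \<le> D" if z: "z \<in> V" for z
  proof -
    obtain x where x: "0 \<le> x" "x \<le> \<beta>" "norm (z - of_real x) < \<eta>"
      using z unfolding V_def by (rule nbhdE)
    have "norm z \<le> norm (complex_of_real x) + norm (z - of_real x)"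
      by (metis add.commute diff_add_cancel norm_triangle_ineq)
    thus ?thesis using x by (simp add: D_def)
  qed
  obtain K where K: "K \<ge> 0" "\<And>z. norm z \<le> D \<Longrightarrow> norm (poly R z - of_real c * z) \<le> K * norm z ^ 2"
    using quad_bound[of D] by blast
  have powV: "(\<Phi> ^^ n) z \<in> V" if "z \<in> V" for n z
    using that by (induction n) (use \<Phi> in \<open>auto simp: V_def\<close>)
  have pow_hol: "(\<Phi> ^^ n) holomorphic_on V" for n
  proof (induction n)
    case (Suc n)
    have "(\<Phi> \<circ> (\<Phi> ^^ n)) holomorphic_on V"
      using Suc hol powV by (intro holomorphic_on_compose_gen[of _ _ _ V]) (auto simp: V_def)
    thus ?case by (simp only: funpow.simps)
  qed (auto simp: id_def)
  define kn where "kn n z = of_real c ^ n * (\<Phi> ^^ n) z" for n z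
  have kn_hol: "kn n holomorphic_on V" for n unfolding kn_def by (intro holomorphic_intros pow_hol)
  have quad: "norm (of_real c * \<Phi> z - z) \<le> K * norm z ^ 2" if "z \<in> V" for z
  proof -
    have \<Phi>z: "\<Phi> z \<in> V" "poly R (\<Phi> z) = z" "norm (\<Phi> z) \<le> \<rho> * norm z" using \<Phi> that by (auto simp: V_def)
    have "norm (\<Phi> z) \<le> norm z" using \<Phi>z(3) \<rho> mult_right_mono[of \<rho> 1 "norm z"] by simp
    hence "K * norm (\<Phi> z) ^ 2 \<le> K * norm z ^ 2" using K by (intro mult_left_mono power_mono) auto
    moreover have "norm (poly R (\<Phi> z) - of_real c * \<Phi> z) \<le> K * norm (\<Phi> z) ^ 2" by (intro K bound \<Phi>z)
    ultimately show ?thesis using \<Phi>z(2) by (simp add: norm_minus_commute)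
  qed
  define E' where "E' = exp (K * D / (1 - \<rho>))"
  have step: "norm (kn (Suc n) z - kn n z) \<le> K * (D * E') ^ 2 * (1 / c) ^ n" if z: "z \<in> V" for n z
    unfolding kn_def E'_def
    by (rule koenigs_sequence(2)[where z="\<lambda>n. (\<Phi> ^^ n) z", OF c1 \<rho> K(1)])
       (use bound[OF z] \<Phi> powV[OF z] quad[OF powV[OF z]] in \<open>auto simp: V_def\<close>)
  define k where "k z = z + (\<Sum>n. kn (Suc n) z - kn n z)" for z
  have "uniform_limit V (\<lambda>n z. \<Sum>i<n. kn (Suc i) z - kn i z) (\<lambda>z. \<Sum>i. kn (Suc i) z - kn i z) sequentially"
  proof (rule Weierstrass_m_test)
    show "norm (kn (Suc n) z - kn n z) \<le> K * (D * E') ^ 2 * (1 / c) ^ n" if "z \<in> V" for n z by (rule step[OF that])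
    show "summable (\<lambda>n. K * (D * E') ^ 2 * (1 / c) ^ n)"
      using c1 by (intro summable_mult summable_geometric) auto
  qed
  hence "uniform_limit V (\<lambda>n z. z + (\<Sum>i<n. kn (Suc i) z - kn i z)) k sequentially"
    unfolding k_def by (intro uniform_limit_add uniform_limit_const)
  moreover have "z + (\<Sum>i<n. kn (Suc i) z - kn i z) = kn n z" for n z
    using sum_lessThan_telescope[of "\<lambda>i. kn i z" n] by (simp add: kn_def[of 0])
  ultimately have lim: "uniform_limit V kn k sequentially" by simp
  have "k holomorphic_on V"
  proof (rule holomorphic_uniform_sequence[OF V kn_hol])
    fix x assume "x \<in> V"
    then obtain d where "d > 0" "cball x d \<subseteq> V" using V open_contains_cball by metis
    thus "\<exists>d>0. cball x d \<subseteq> V \<and> uniform_limit (cball x d) kn k sequentially"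
      using uniform_limit_on_subset[OF lim] by blast
  qed
  moreover have "k (of_real x) = of_real (\<K> x)" if x: "0 \<le> x" "x \<le> \<beta>" for x
  proof (rule LIMSEQ_unique)
    have "of_real x \<in> V" unfolding V_def using x \<eta> by (intro of_real_nbhd) auto
    thus "(\<lambda>n. kn n (of_real x)) \<longlonglongrightarrow> k (of_real x)" by (rule tendsto_uniform_limitI[OF lim])
    have "(\<Phi> ^^ n) (of_real x) = of_real ((S ^^ n) x) \<and> 0 \<le> (S ^^ n) x \<and> (S ^^ n) x \<le> \<beta>" for n
    proof (induction n)
      case (Suc n)
      thus ?case using \<Phi>x[of "(S ^^ n) x"] S_mem[of "(S ^^ n) x"] b1_less beta_le_B by auto
    qed (use x in auto)
    hence "kn n (of_real x) = of_real (Kn n x)" for n by (simp add: kn_def Kn_def)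
    thus "(\<lambda>n. kn n (of_real x)) \<longlonglongrightarrow> of_real (\<K> x)"
      using Kn_tendsto[of x] x beta_le_B by (simp add: tendsto_of_real_iff)
  qed
  ultimately show ?thesis using that[of \<eta> k] \<eta> by (simp add: V_def)
qed

text \<open>Positive real part keeps the values off the branch cut, so the principal powers with
  exponent -s/2 are holomorphic in a complex neighbourhood of the hull.\<close>

lemma outer_extension:
  obtains \<eta> k where "\<eta> > 0" "\<And>j. j \<in> {2..N} \<Longrightarrow> k j holomorphic_on nbhd 0 \<beta> \<eta>"
    "\<And>j z. j \<in> {2..N} \<Longrightarrow> z \<in> nbhd 0 \<beta> \<eta> \<Longrightarrow> Re (k j z) > 0"
    "\<And>j x. j \<in> {2..N} \<Longrightarrow> 0 \<le> x \<Longrightarrow> x \<le> \<beta> \<Longrightarrow> k j (of_real x) = of_real (\<K> (\<phi> j x))"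
proof -
  obtain \<eta>0 K where K: "\<eta>0 > 0" "K holomorphic_on nbhd 0 \<beta> \<eta>0"
    "\<And>x. 0 \<le> x \<Longrightarrow> x \<le> \<beta> \<Longrightarrow> K (of_real x) = of_real (\<K> x)" by (rule koenigs_extension) (rule that; assumption)
  define T where "T = {z \<in> nbhd 0 \<beta> \<eta>0. Re (K z) > 0}"
  have "open T"
  proof -
    have "continuous_on (nbhd 0 \<beta> \<eta>0) (\<lambda>z. Re (K z))"
      by (intro continuous_intros holomorphic_on_imp_continuous_on K)
    from continuous_on_open_vimage[OF open_nbhd, THEN iffD1, rule_format, OF this open_greaterThan]
    have "open ((\<lambda>z. Re (K z)) -` {0<..} \<inter> nbhd 0 \<beta> \<eta>0)" .
    moreover have "T = (\<lambda>z. Re (K z)) -` {0<..} \<inter> nbhd 0 \<beta> \<eta>0" by (auto simp: T_def)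
    ultimately show ?thesis by simp
  qed
  have ex: "\<exists>\<eta> \<Phi>. \<eta> > 0 \<and> \<Phi> holomorphic_on nbhd 0 \<beta> \<eta> \<and> \<Phi> ` nbhd 0 \<beta> \<eta> \<subseteq> T \<and>
      (\<forall>x. 0 \<le> x \<longrightarrow> x \<le> \<beta> \<longrightarrow> \<Phi> (of_real x) = of_real (\<phi> j x))" if j: "j \<in> {2..N}" for j
  proof -
    have j1: "j \<in> {1..N}" using j by auto
    have "of_real ` {lo j..hi j} \<subseteq> T"
    proof
      fix z assume "z \<in> complex_of_real ` {lo j..hi j}"
      then obtain y where y: "lo j \<le> y" "y \<le> hi j" "z = of_real y" by auto
      have "b 1 \<le> b (j - 1)" using b_le[of 1 "j - 1"] j by auto
      hence y': "0 < y" "y \<le> \<beta>" using y lo_hi[OF j1] b1_pos by linarith+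
      hence "\<K> y > 0" using koenigs_lower[of y] beta_le_B by simp
      moreover have "of_real y \<in> nbhd 0 \<beta> \<eta>0" using y' K(1) by (intro of_real_nbhd) auto
      ultimately show "z \<in> T" using y(3) y' K(3)[of y] by (simp add: T_def)
    qed
    from branch_extension[OF j1 \<open>open T\<close> this] obtain \<eta> \<Phi> where "\<eta> > 0" "\<Phi> holomorphic_on nbhd 0 \<beta> \<eta>"
    "\<And>z. z \<in> nbhd 0 \<beta> \<eta> \<Longrightarrow> \<Phi> z \<in> T \<and> poly R (\<Phi> z) = z \<and> poly (pderiv R) (\<Phi> z) * deriv \<Phi> z = 1"
    "\<And>x. 0 \<le> x \<Longrightarrow> x \<le> \<beta> \<Longrightarrow> \<Phi> (of_real x) = of_real (\<phi> j x)" by blast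
    thus ?thesis by (intro exI[of _ \<eta>] exI[of _ \<Phi>]) blast
  qed
  then obtain \<eta>j \<Phi> where j: "\<And>j. j \<in> {2..N} \<Longrightarrow> \<eta>j j > 0 \<and> \<Phi> j holomorphic_on nbhd 0 \<beta> (\<eta>j j) \<and> \<Phi> j ` nbhd 0 \<beta> (\<eta>j j) \<subseteq> T \<and>
      (\<forall>x. 0 \<le> x \<longrightarrow> x \<le> \<beta> \<longrightarrow> \<Phi> j (of_real x) = of_real (\<phi> j x))" by metis
  define \<eta> where "\<eta> = Min (\<eta>j ` {2..N})"
  have ne: "\<eta>j ` {2..N} \<noteq> {}" "finite (\<eta>j ` {2..N})" using N2 by auto
  have \<eta>: "\<eta> > 0" unfolding \<eta>_def using ne j by (subst Min_gr_iff) auto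
  have sub: "nbhd 0 \<beta> \<eta> \<subseteq> nbhd 0 \<beta> (\<eta>j i)" if "i \<in> {2..N}" for i
    unfolding \<eta>_def using that ne by (intro nbhd_mono Min_le) auto
  show ?thesis
  proof (rule that[of \<eta> "\<lambda>j z. K (\<Phi> j z)"])
    fix i assume i: "i \<in> {2..N}"
    have img: "\<Phi> i ` nbhd 0 \<beta> \<eta> \<subseteq> T" using j[OF i] sub[OF i] by blast
    have "(K \<circ> \<Phi> i) holomorphic_on nbhd 0 \<beta> \<eta>"
      using j[OF i] sub[OF i] img K(2)
      by (intro holomorphic_on_compose_gen[of _ _ _ "nbhd 0 \<beta> \<eta>0"]) (auto simp: T_def intro: holomorphic_on_subset)
    thus "(\<lambda>z. K (\<Phi> i z)) holomorphic_on nbhd 0 \<beta> \<eta>" by (simp add: o_def)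
    show "0 < Re (K (\<Phi> i z))" if "z \<in> nbhd 0 \<beta> \<eta>" for z using img that by (auto simp: T_def)
    fix x :: real assume x: "0 \<le> x" "x \<le> \<beta>"
    thus "K (\<Phi> i (of_real x)) = of_real (\<K> (\<phi> i x))"
      using j[OF i] K(3)[of "\<phi> i x"] phi_range[of i x] i beta_le_B by auto
  qed (use \<eta> in auto)
qed

text \<open>Word sums of a holomorphic function are contour integrals of word sums of the Cauchy kernel,
  and the latter become constant in the base point because the contour escapes to infinity.\<close>

lemma oscillation_superexponential:
  assumes M: "M \<ge> 1"
  shows "\<exists>C. \<forall>s m u v. norm s \<le> t \<longrightarrow> 0 \<le> u \<longrightarrow> u \<le> \<beta> \<longrightarrow> 0 \<le> v \<longrightarrow> v \<le> \<beta> \<longrightarrow>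
        norm (av m s u - av m s v) \<le> C * (1 / M) ^ m"
proof -
  obtain \<eta> k where \<eta>: "\<eta> > 0" and k: "\<And>j. j \<in> {2..N} \<Longrightarrow> k j holomorphic_on nbhd 0 \<beta> \<eta>"
    "\<And>j z. j \<in> {2..N} \<Longrightarrow> z \<in> nbhd 0 \<beta> \<eta> \<Longrightarrow> Re (k j z) > 0"
    "\<And>j x. j \<in> {2..N} \<Longrightarrow> 0 \<le> x \<Longrightarrow> x \<le> \<beta> \<Longrightarrow> k j (of_real x) = of_real (\<K> (\<phi> j x))"
    by (rule outer_extension) (rule that; assumption)
  define H where "H s z = (\<Sum>j=2..N. k j z powr (- s / 2))" for s z
  define V where "V = nbhd 0 \<beta> \<eta>"
  have V: "open V" "convex V" by (auto simp: V_def convex_nbhd)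
  have H_hol: "H s holomorphic_on V" for s
    unfolding H_def V_def
    by (intro holomorphic_intros k) (use k(2) in \<open>force simp: complex_nonpos_Reals_iff\<close>)+
  have H_real: "H s (of_real x) = outer (g s) x" if "0 \<le> x" "x \<le> \<beta>" for s x
    unfolding H_def outer_def g_def using k(3) that by (intro sum.cong) auto
  \<comment> \<open>The box extending 3e/2 beyond the hull then stays within 3e/2 + 3e/2 < 4e =
    \<eta> of it, inside the tube.\<close>
  define e where "e = \<eta> / 4"
  have e: "e > 0" using \<eta> by (simp add: e_def)
  define box' where "box' d = box (Complex (- d) (- d)) (Complex (\<beta> + d) d)" for d
  define cbox' where "cbox' d = cbox (Complex (- d) (- d)) (Complex (\<beta> + d) d)" for d
  \<comment> \<open>The contour lies in the open frame U, where the integrand is holomorphic; T is a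
    compact frame containing U, which supplies the uniform bounds.\<close>
  define U where "U = box' (3 * e / 2) - cbox' (e / 2)"
  define T where "T = cbox' (3 * e / 2) - box' (e / 2)"
  define \<Gamma> where "\<Gamma> = rectpath (Complex (- e) (- e)) (Complex (\<beta> + e) e)"
  have bx: "z \<in> box' d \<longleftrightarrow> - d < Re z \<and> Re z < \<beta> + d \<and> - d < Im z \<and> Im z < d" for z d
    by (auto simp: box'_def in_box_complex_iff)
  have cbx: "z \<in> cbox' d \<longleftrightarrow> - d \<le> Re z \<and> Re z \<le> \<beta> + d \<and> - d \<le> Im z \<and> Im z \<le> d" for z d
    by (auto simp: cbox'_def in_cbox_complex_iff)
  have "open U" unfolding U_def box'_def cbox'_def by (intro open_Diff open_box closed_cbox)
  have "compact T" unfolding T_def box'_def cbox'_def by (intro compact_diff compact_cbox open_box)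
  have UT: "U \<subseteq> T" unfolding U_def T_def using e by (auto simp: bx cbx)
  have cbox_V: "cbox' (3 * e / 2) \<subseteq> V"
  proof
    fix z assume z: "z \<in> cbox' (3 * e / 2)"
    define x where "x = max 0 (min (Re z) \<beta>)"
    have x: "x \<in> {0..\<beta>}" using beta_pos by (auto simp: x_def)
    have "\<bar>Re (z - of_real x)\<bar> \<le> 3 * e / 2" "\<bar>Im (z - of_real x)\<bar> \<le> 3 * e / 2"
      using z beta_pos e by (auto simp: cbx x_def max_def min_def abs_le_iff)
    hence "norm (z - of_real x) \<le> 3 * e" using cmod_le[of "z - of_real x"] by linarith
    hence "norm (z - of_real x) < \<eta>" using \<eta> by (simp add: e_def)
    thus "z \<in> V" unfolding V_def using x by (intro nbhdI[of _ x]) auto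
  qed
  have TV: "T \<subseteq> V" using cbox_V by (auto simp: T_def)
  have dist: "e / 2 \<le> norm (z - of_real x)" if "z \<in> T" "0 \<le> x" "x \<le> \<beta>" for z x
  proof (rule ccontr)
    assume "\<not> ?thesis"
    hence "\<bar>Re (z - of_real x)\<bar> < e / 2" "\<bar>Im (z - of_real x)\<bar> < e / 2"
      using abs_Re_le_cmod[of "z - of_real x"] abs_Im_le_cmod[of "z - of_real x"] by linarith+
    hence "\<bar>Re z - x\<bar> < e / 2" "\<bar>Im z\<bar> < e / 2" by simp_all
    hence "- (e / 2) < Re z" "Re z < \<beta> + e / 2" "- (e / 2) < Im z" "Im z < e / 2"
      using that(2,3) by linarith+
    hence "z \<in> box' (e / 2)" by (simp only: bx)
    thus False using that by (simp add: T_def)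
  qed
  have T_segment: "T \<inter> segment = {}" using dist e by (force simp: segment_def)
  have pathU: "path_image \<Gamma> \<subseteq> U"
  proof
    fix z assume "z \<in> path_image \<Gamma>"
    hence "z \<in> cbox' e - box' e" unfolding \<Gamma>_def cbox'_def box'_def
      using e beta_pos by (subst (asm) path_image_rectpath_cbox_minus_box) auto
    thus "z \<in> U" unfolding U_def using e by (auto simp: bx cbx)
  qed
  obtain n0 where n0: "\<And>z m. z \<in> T \<Longrightarrow> n0 \<le> m \<Longrightarrow> M ^ (m - n0) \<le> norm ((poly R ^^ m) z)"
     "\<And>z m. z \<in> T \<Longrightarrow> n0 \<le> m \<Longrightarrow> 2 * \<beta> \<le> norm ((poly R ^^ m) z)"
    using compact_escape[OF \<open>compact T\<close> T_segment M] by blast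
  have "\<exists>Q. \<forall>z\<in>T. norm (Ln (k j z)) \<le> Q" if j: "j \<in> {2..N}" for j
  proof -
    have "continuous_on T (\<lambda>z. Ln (k j z))"
    proof (rule continuous_on_Ln')
      show "continuous_on T (k j)"
        using holomorphic_on_imp_continuous_on[OF k(1)[OF j]] TV unfolding V_def
        by (rule continuous_on_subset)
      show "k j z \<notin> \<real>\<^sub>\<le>\<^sub>0" if "z \<in> T" for z
        using k(2)[OF j, of z] that TV by (auto simp: complex_nonpos_Reals_iff V_def)
    qed
    hence "compact ((\<lambda>z. Ln (k j z)) ` T)" by (intro compact_continuous_image \<open>compact T\<close>)
    hence "bounded ((\<lambda>z. Ln (k j z)) ` T)" by (rule compact_imp_bounded)
    then obtain q where "\<forall>x\<in>(\<lambda>z. Ln (k j z)) ` T. norm x \<le> q" unfolding bounded_iff ..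
    thus ?thesis by (intro exI[of _ q]) simp
  qed
  hence "\<forall>j\<in>{2..N}. \<exists>Q. \<forall>z\<in>T. norm (Ln (k j z)) \<le> Q" by simp
  then obtain Q where "\<forall>j\<in>{2..N}. \<forall>z\<in>T. norm (Ln (k j z)) \<le> Q j" by (rule bchoice[THEN exE])
  hence Q: "\<And>j z. j \<in> {2..N} \<Longrightarrow> z \<in> T \<Longrightarrow> norm (Ln (k j z)) \<le> Q j" by simp
  define HB where "HB = (\<Sum>j=2..N. exp (\<bar>t\<bar> / 2 * \<bar>Q j\<bar>))"
  have HB: "norm (H s z) \<le> HB" if s: "norm s \<le> t" and z: "z \<in> T" for s z
    unfolding H_def HB_def
  proof (rule sum_norm_le)
    fix j assume j: "j \<in> {2..N}"
    have "z \<in> nbhd 0 \<beta> \<eta>" using z TV by (auto simp: V_def)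
    hence nz: "k j z \<noteq> 0" using k(2)[OF j] by force
    have "norm (- s / 2 * Ln (k j z)) \<le> \<bar>t\<bar> / 2 * \<bar>Q j\<bar>"
      unfolding norm_mult using s Q[OF j z] by (intro mult_mono) (auto simp: norm_divide)
    hence "Re (- s / 2 * Ln (k j z)) \<le> \<bar>t\<bar> / 2 * \<bar>Q j\<bar>"
      using complex_Re_le_cmod order.trans by blast
    thus "norm (k j z powr (- s / 2)) \<le> exp (\<bar>t\<bar> / 2 * \<bar>Q j\<bar>)"
      using nz by (simp add: powr_def)
  qed
  have HB0: "HB \<ge> 0" unfolding HB_def by (intro sum_nonneg) auto
  \<comment> \<open>The case m = 0 is Cauchy's formula for \<open>H s\<close>; larger m follow by
    summing over the branches, as only the base point changes.\<close>
  have cauchy: "((\<lambda>z. H s z * wsum m (\<lambda>x. 1 / (z - of_real x)) y) has_contour_integral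
      (2 * pi * \<i> * wsum m (outer (g s)) y)) \<Gamma>" if y: "0 \<le> y" "y \<le> \<beta>" for s m y
    using y
  proof (induction m arbitrary: y)
    case 0
    have "((\<lambda>z. H s z / (z - of_real y)) has_contour_integral (2 * pi * \<i> * winding_number \<Gamma> (of_real y) * H s (of_real y))) \<Gamma>"
    proof (rule Cauchy_integral_formula_convex_simple[OF V(2) H_hol])
      show "of_real y \<in> interior V" using V(1) 0 \<eta> by (auto simp: interior_open V_def intro: of_real_nbhd)
      have "of_real y \<notin> T" using T_segment 0 by (auto simp: segment_def)
      thus "path_image \<Gamma> \<subseteq> V - {of_real y}" using pathU UT TV by blast
    qed (auto simp: \<Gamma>_def)
    moreover have "winding_number \<Gamma> (of_real y) = 1"
      unfolding \<Gamma>_def using e 0 by (intro winding_number_rectpath) (auto simp: in_box_complex_iff)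
    ultimately show ?case using H_real 0 by simp
  next
    case (Suc m)
    have "((\<lambda>z. \<Sum>j=1..N. H s z * wsum m (\<lambda>x. 1 / (z - of_real x)) (\<phi> j y)) has_contour_integral
        (\<Sum>j=1..N. 2 * pi * \<i> * wsum m (outer (g s)) (\<phi> j y))) \<Gamma>"
      by (intro has_contour_integral_sum Suc.IH) (use phi_range[of _ y] Suc.prems beta_le_B in auto)
    thus ?case by (simp add: sum_distrib_left)
  qed
  obtain L where L: "L > 0" "\<And>f B. f holomorphic_on U \<Longrightarrow> (\<And>z. z \<in> U \<Longrightarrow> norm (f z) \<le> B) \<Longrightarrow> norm (contour_integral \<Gamma> f) \<le> L * B"
    using contour_integral_bound_exists[OF \<open>open U\<close> _ pathU] by (auto simp: \<Gamma>_def)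
  define A where "A = L * (HB * (2 / e * (2 * \<beta>)))"
  have A0: "A \<ge> 0" unfolding A_def using L HB0 e beta_pos by simp
  have main: "norm (wsum m (outer (g s)) y - wsum m (outer (g s)) 0) \<le> A * (real N ^ m * (M ^ n0 * (1 / M) ^ m))"
    if s: "norm s \<le> t" and y: "0 \<le> y" "y \<le> \<beta>" and m: "n0 \<le> m" for s m y
  proof -
    define f where "f z = H s z * (wsum m (\<lambda>x. 1 / (z - of_real x)) y - wsum m (\<lambda>x. 1 / (z - of_real x)) 0)" for z
    have nz: "z - of_real x \<noteq> 0" if "z \<in> U" "0 \<le> x" "x \<le> \<beta>" for z x
      using dist[of z x] UT that e by auto
    have "f holomorphic_on U"
      unfolding f_def using UT TV y beta_pos nz
      by (intro holomorphic_intros wsum_holomorphic[OF order_refl beta_le_B] holomorphic_on_subset[OF H_hol]) auto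
    moreover have "norm (f z) \<le> HB * (real N ^ m * (2 / e * (2 * \<beta>)) * (M ^ n0 * (1 / M) ^ m))" if z: "z \<in> U" for z
    proof -
      have zT: "z \<in> T" using z UT by blast
      have zh: "z \<notin> segment" using zT T_segment by blast
      have "M ^ m = M ^ n0 * M ^ (m - n0)" using m by (simp add: power_add[symmetric])
      hence "2 * \<beta> / norm ((poly R ^^ m) z) \<le> 2 * \<beta> * (M ^ n0 * (1 / M) ^ m)"
      proof -
        have Mp: "0 < M ^ (m - n0)" using M by (intro zero_less_power) linarith
        have "2 * \<beta> / norm ((poly R ^^ m) z) \<le> 2 * \<beta> / M ^ (m - n0)"
          using n0(1)[OF zT m] Mp less_le_trans[OF Mp n0(1)[OF zT m]] beta_pos
          by (intro divide_left_mono mult_pos_pos) simp_all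
        also have "\<dots> = 2 * \<beta> * (M ^ n0 * (1 / M) ^ m)"
          using M \<open>M ^ m = M ^ n0 * M ^ (m - n0)\<close> by (simp add: power_one_over field_simps)
        finally show ?thesis .
      qed
      hence "real N ^ m / (e / 2) * (2 * \<beta> / norm ((poly R ^^ m) z)) \<le> real N ^ m / (e / 2) * (2 * \<beta> * (M ^ n0 * (1 / M) ^ m))"
        using e by (intro mult_left_mono) auto
      moreover have "norm (wsum m (\<lambda>x. 1 / (z - of_real x)) y - wsum m (\<lambda>x. 1 / (z - of_real x)) 0)
        \<le> real N ^ m / (e / 2) * (2 * \<beta> / norm ((poly R ^^ m) z))"
        using e dist[OF zT] n0(2)[OF zT m] by (intro cauchy_kernel_diff zh y) auto
      ultimately have "norm (wsum m (\<lambda>x. 1 / (z - of_real x)) y - wsum m (\<lambda>x. 1 / (z - of_real x)) 0)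
        \<le> real N ^ m * (2 / e * (2 * \<beta>)) * (M ^ n0 * (1 / M) ^ m)" by (simp add: mult_ac)
      thus ?thesis unfolding f_def norm_mult using HB[OF s zT] HB0 by (intro mult_mono) auto
    qed
    ultimately have "norm (contour_integral \<Gamma> f) \<le> L * (HB * (real N ^ m * (2 / e * (2 * \<beta>)) * (M ^ n0 * (1 / M) ^ m)))"
      by (rule L(2))
    moreover have "(f has_contour_integral (2 * pi * \<i> * wsum m (outer (g s)) y - 2 * pi * \<i> * wsum m (outer (g s)) 0)) \<Gamma>"
      unfolding f_def right_diff_distrib using y beta_pos by (intro has_contour_integral_diff cauchy) auto
    hence "contour_integral \<Gamma> f = 2 * pi * \<i> * (wsum m (outer (g s)) y - wsum m (outer (g s)) 0)"
      by (simp add: contour_integral_unique right_diff_distrib)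
    hence "norm (contour_integral \<Gamma> f) = 2 * pi * norm (wsum m (outer (g s)) y - wsum m (outer (g s)) 0)"
      by (simp add: norm_mult)
    moreover have "1 * norm (wsum m (outer (g s)) y - wsum m (outer (g s)) 0) \<le> 2 * pi * norm (wsum m (outer (g s)) y - wsum m (outer (g s)) 0)"
      using pi_gt3 by (intro mult_right_mono) auto
    ultimately show ?thesis by (simp add: A_def mult_ac)
  qed
  \<comment> \<open>The second summand covers m < n0, where M^n0 (1/M)^m is at least 1 and the
    variation bound suffices.\<close>
  define C where "C = (2 * A + \<bar>lip t * \<K> B\<bar>) * M ^ n0"
  have "norm (av m s u - av m s v) \<le> C * (1 / M) ^ m"
    if s: "norm s \<le> t" and uv: "0 \<le> u" "u \<le> \<beta>" "0 \<le> v" "v \<le> \<beta>" for s m u v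
  proof (cases "n0 \<le> m")
    case True
    have "norm (wsum m (outer (g s)) u - wsum m (outer (g s)) v) \<le>
        norm (wsum m (outer (g s)) u - wsum m (outer (g s)) 0) + norm (wsum m (outer (g s)) v - wsum m (outer (g s)) 0)"
      by (metis norm_triangle_ineq4 diff_diff_eq2 diff_add_cancel add_diff_eq)
    also have "\<dots> \<le> 2 * (A * (real N ^ m * (M ^ n0 * (1 / M) ^ m)))"
      using main[OF s uv(1,2) True] main[OF s uv(3,4) True] by simp
    finally have "norm (wsum m (outer (g s)) u - wsum m (outer (g s)) v) / real N ^ Suc m \<le>
        2 * (A * (real N ^ m * (M ^ n0 * (1 / M) ^ m))) / real N ^ Suc m" by (intro divide_right_mono) auto
    also have "\<dots> = (2 * A * M ^ n0 * (1 / M) ^ m) / N" using N2 by simp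
    also have "\<dots> \<le> (2 * A * M ^ n0 * (1 / M) ^ m) / 1" using N2 A0 M by (intro divide_left_mono) auto
    also have "\<dots> \<le> C * (1 / M) ^ m" unfolding C_def using M A0 by (simp add: mult_right_mono field_simps)
    finally show ?thesis by (simp add: av_def diff_divide_distrib[symmetric] norm_divide norm_mult norm_power)
  next
    case False
    have "norm (av m s u - av m s v) \<le> lip t * \<K> B / real N ^ Suc m"
      using uv beta_le_B by (intro av_diff_le_variation s) auto
    also have "\<dots> \<le> \<bar>lip t * \<K> B\<bar> / real N ^ Suc m" by (intro divide_right_mono) auto
    also have "\<dots> \<le> \<bar>lip t * \<K> B\<bar> / 1" using N2 by (intro divide_left_mono one_le_power) auto
    also have "\<dots> \<le> \<bar>lip t * \<K> B\<bar> * (M ^ n0 * (1 / M) ^ m)"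
    proof -
      have "M ^ m \<le> M ^ n0" using False M by (intro power_increasing) auto
      hence "1 \<le> M ^ n0 * (1 / M) ^ m" using M by (simp add: power_one_over field_simps)
      thus ?thesis using mult_left_mono[of 1 "M ^ n0 * (1 / M) ^ m" "\<bar>lip t * \<K> B\<bar>"] by simp
    qed
    also have "\<dots> \<le> C * (1 / M) ^ m"
      unfolding C_def using A0 M by (simp add: mult.assoc[symmetric] mult_right_mono)
    finally show ?thesis .
  qed
  thus ?thesis by blast
qed

text \<open>Every rate 1/M is available; M = N / r is the one for which the boundary of the
  half-plane becomes 2 ln r / ln c.\<close>

lemma psi_hyperbolic:
  assumes z0: "0 \<le> z0" "z0 \<le> B"
  shows "psi z0 holomorphic_on {s. Re s > 2 * ln r / ln c}"
proof (rule psi_holomorphic_of_oscillation[OF z0, of "r / N"])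
  have M: "N / r \<ge> 1" using N2 r_pos r_less_1 by (simp add: field_simps)
  show "\<exists>C. \<forall>s m u v. norm s \<le> t \<longrightarrow> 0 \<le> u \<longrightarrow> u \<le> \<beta> \<longrightarrow> 0 \<le> v \<longrightarrow> v \<le> \<beta> \<longrightarrow>
        norm (av m s u - av m s v) \<le> C * (r / N) ^ m" for t
    using oscillation_superexponential[OF M, of t] by simp
  have "c powr (- (2 * ln r / ln c) / 2) = 1 / r"
    using r_pos c1 by (simp add: powr_def exp_minus inverse_eq_divide)
  thus "r / N * (N * c powr (- (2 * ln r / ln c) / 2)) \<le> 1" using r_pos N2 by simp
qed (use r_pos N2 in auto)

end

context julia_poly
begin

text \<open>The supremum is finite, being below 1, and positive, since 0 is a Julia point with
  |R'(0)| = c; so it is a legitimate real r.\<close>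

lemma contraction_ratio_hyperbolic:
  assumes "contraction_ratio R < 1"
  shows "hyperbolic_julia_poly R N c (real_of_ereal (contraction_ratio R))"
proof -
  define r where "r = real_of_ereal (contraction_ratio R)"
  have sup: "inverse (ereal (norm (poly (pderiv R) z))) \<le> contraction_ratio R" if "z \<in> julia_set R" for z
    unfolding contraction_ratio_def using that by (intro SUP_upper)
  have "ereal (1 / c) \<le> contraction_ratio R"
    using sup[OF zero_in_julia] R'0 c1 by (simp add: inverse_eq_divide)
  with assms obtain x where x: "contraction_ratio R = ereal x" "1 / c \<le> x" "x < 1"
    by (cases "contraction_ratio R") auto
  have r: "contraction_ratio R = ereal r" "1 / c \<le> r" "r < 1" using x by (simp_all add: r_def)
  have r_pos: "0 < r" using r(2) c1 by (meson less_le_trans divide_pos_pos zero_less_one less_trans)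
  have "1 / r \<le> norm (poly (pderiv R) z)" if z: "z \<in> julia_set R" for z
  proof -
    have le: "inverse (ereal (norm (poly (pderiv R) z))) \<le> ereal r" using sup[OF z] r(1) by simp
    \<comment> \<open>In \<open>ereal\<close> the inverse of 0 is infinite, so R' has no zero on the
      Julia set.\<close>
    hence nz: "poly (pderiv R) z \<noteq> 0" by auto
    hence "inverse (norm (poly (pderiv R) z)) \<le> r" using le by simp
    thus ?thesis using nz r_pos by (simp add: field_simps)
  qed
  thus ?thesis using r_pos r(3) unfolding r_def by unfold_locales auto
qed

end

theorem theorem2:
  fixes R :: "complex poly" and N :: nat and c d z0 :: real
  assumes "degree R = N" and "N \<ge> 2"
    and "poly R 0 = 0"
    and "poly (pderiv R) 0 = complex_of_real c" and "c > 1"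
    and "julia_set R \<subseteq> \<real>\<^sub>\<ge>\<^sub>0"
    and "d = 2 * ln (real N) / ln c"
    and "z0 \<in> I0 R"
  shows "xi_fun R holomorphic_on UNIV \<and>
    (\<exists>\<psi> Z :: complex \<Rightarrow> complex.
       Z = (\<lambda>s. xi_fun R s / (1 - of_nat N * complex_of_real c powr (- s / 2)) + \<psi> s) \<and>
       \<psi> holomorphic_on {s. Re s > 0} \<and>
       Z meromorphic_on {s. Re s > 0} \<and>
       (\<forall>s. Re s > d \<longrightarrow> zeta_fun R z0 s = Z s) \<and>
       {s. Re s > 0 \<and> is_pole Z s}
         \<subseteq> {complex_of_real d + 4 * \<i> * of_int n * of_real pi / of_real (ln c) | n :: int. True} \<and>
       is_pole Z (complex_of_real d) \<and>
       (totally_disconnected (julia_set R) \<longrightarrow>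
          (\<exists>\<epsilon>>0. \<psi> holomorphic_on {s. Re s > - \<epsilon>})) \<and>
       (totally_disconnected (julia_set R) \<and> contraction_ratio R < 1 \<longrightarrow>
          (\<forall>\<epsilon>. \<epsilon> = - 2 * ln (real_of_ereal (contraction_ratio R)) / ln c \<longrightarrow>
             \<epsilon> > 0 \<and> \<psi> holomorphic_on {s. Re s > - \<epsilon>})))"
proof -
  interpret julia_poly R N c using assms(1-6) by unfold_locales auto
  have d: "d = dR" using assms(7) by (simp add: dR_def)
  have z0: "0 \<le> z0" "z0 \<le> B" using assms(8) by (auto simp: I0_eq)
  have poles: "{s. Re s > 0 \<and> is_pole (Z z0) s}
         \<subseteq> {complex_of_real d + 4 * \<i> * of_int n * of_real pi / of_real (ln c) | n :: int. True}"
    using Z_poles[OF z0] by (auto simp: q_eq_1 d)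
  have hyperbolic: "\<epsilon> > 0 \<and> psi z0 holomorphic_on {s. Re s > - \<epsilon>}"
    if "contraction_ratio R < 1" "\<epsilon> = - 2 * ln (real_of_ereal (contraction_ratio R)) / ln c" for \<epsilon>
  proof -
    interpret hyperbolic_julia_poly R N c "real_of_ereal (contraction_ratio R)"
      using that(1) by (rule contraction_ratio_hyperbolic)
    have "ln (real_of_ereal (contraction_ratio R)) < 0" "ln c > 0"
      using r_pos r_less_1 c1 by (auto simp: ln_less_zero_iff)
    hence "\<epsilon> > 0" unfolding that(2) by (intro divide_pos_pos) auto
    moreover have "- \<epsilon> = 2 * ln (real_of_ereal (contraction_ratio R)) / ln c" by (simp add: that(2))
    ultimately show ?thesis using psi_hyperbolic[OF z0] by simp
  qed
  show ?thesis
    using xi_holomorphic Z_def[of z0, abs_def] psi_holomorphic_right[OF z0] Z_meromorphic[OF z0]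
      zeta_eq_Z[OF z0] poles Z_pole_dR[OF z0] psi_totally_disconnected[OF _ z0] hyperbolic
    unfolding d by (intro conjI exI[of _ "psi z0"] exI[of _ "Z z0"]) blast+
qed

end
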